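(* Let $t>1$ be an integer coprime to $p$. For $i\in\mathbb{N}$ coprime to $p$ let $\omega_i$ denote a primitive $i$-th root of unity in an algebraic closure of $\mathbb{F}_p$. Let $n$ be the smallest positive integer with $\omega_{t^2}\in\mathbb{F}_{p^n}$ (i.e. the multiplicative order of $p$ modulo $t^2$), and set $s:=(p^{nt}-1)/(t(p^n-1))$, which is an integer coprime to both $p$ and $t$. Let $D:=(C_p)^{nt}$, identified with the additive group of $\mathbb{F}_{p^{nt}}$. For $\lambda\in\mathbb{F}_{p^{nt}}^\times$ let $m_\lambda\in\operatorname{Aut}(D)$ be multiplication by $\lambda$, and let $\Phi_{p^n}\in\operatorname{Aut}(D)$ be $x\mapsto x^{p^n}$. Set $g:=m_{\omega_s}$, of order $s$, and $h:=\Phi_{p^n}\circ m_{\omega_{t^2}}$, of order $t^2$, so that ${}^hg=g^{p^n}$. Let $E:=\langle g\rangle\rtimes\langle h\rangle$, which acts faithfully on $D$, and set $G:=D\rtimes E$; then $\mathcal{O}G$ is a block. Then $\operatorname{Out}_c(G)$ is non-trivial. Moreover, the image of $\operatorname{Out}_c(G)$ in $\operatorname{Picent}(\mathcal{O}G)$ is non-trivial.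
   Context: $\mathcal{O}$ is a complete discrete valuation ring whose residue field $k=\mathcal{O}/J(\mathcal{O})$ is algebraically closed of prime characteristic $p$, and whose field of fractions $K$ has characteristic zero. $K$ is assumed large enough: it contains all $|X|$-th roots of unity for all finite groups $X$ involved. For a finite group $H$: $\operatorname{Aut}_c(H)$ is the group of class-preserving automorphisms of $H$, i.e. those automorphisms leaving every conjugacy class of $H$ invariant (equivalently, fixing every irreducible character of $H$); $\operatorname{Inn}(H)$ is the group of inner automorphisms; $\operatorname{Out}_c(H):=\operatorname{Aut}_c(H)/\operatorname{Inn}(H)$. For group elements, ${}^hg:=hgh^{-1}$. For a block $b$ of a finite group, $\operatorname{Irr}(b)$ denotes the set of irreducible ($K$-)characters lying in $b$. $\operatorname{Pic}(b)$ is the group of isomorphism classes of $b$-$b$-bimodules inducing $\mathcal{O}$-linear Morita auto-equivalences of $b$, with multiplication $M\otimes_bN$, and $\operatorname{Picent}(b)$ is the subgroup of those elements inducing the trivial permutation of $\operatorname{Irr}(b)$ (via $K\otimes_{\mathcal{O}}M$). For an $\mathcal{O}$-algebra automorphism $\alpha$ of $b$, ${}_\alpha b\in\operatorname{Pic}(b)$ is $b$ as a set with bimodule structure $x.m.y:=\alpha(x)my$. The map from $\operatorname{Out}_c(G)$ to $\operatorname{Picent}(\mathcal{O}G)$ sends the class of $\psi\in\operatorname{Aut}_c(G)$ to the class of ${}_\psi(\mathcal{O}G)$, where $\psi$ is extended $\mathcal{O}$-linearly to an automorphism of $\mathcal{O}G$. *)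

theory Defs
  imports "HOL-Algebra.Algebra"
begin

section \<open>Complete discrete valuation rings\<close>

text \<open>The additive order of \<open>1\<close>; \<^const>\<open>group.ord\<close> is \<open>0\<close> on elements of infinite order.\<close>

definition ring_char :: "('a, 'm) ring_scheme \<Rightarrow> nat"
  where "ring_char R = group.ord (add_monoid R) \<one>\<^bsub>R\<^esub>"

definition jacobson_radical :: "('a, 'm) ring_scheme \<Rightarrow> 'a set"
  where "jacobson_radical R = {x \<in> carrier R. \<forall>M. maximalideal M R \<longrightarrow> x \<in> M}"

text \<open>Multiplication in \<^const>\<open>ideals_set\<close> is the product of ideals, so the powers below are the
  powers of the maximal ideal. Separatedness of the adic topology is automatic.\<close>

definition complete_dvr :: "('a, 'm) ring_scheme \<Rightarrow> bool"
  where "complete_dvr R \<longleftrightarrow>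
    principal_domain R \<and> \<not> field R \<and> (\<exists>!M. maximalideal M R) \<and>
    (\<forall>x :: nat \<Rightarrow> 'a.
       (\<forall>i. x i \<in> carrier R \<and>
            x (Suc i) \<ominus>\<^bsub>R\<^esub> x i \<in> jacobson_radical R [^]\<^bsub>ideals_set R\<^esub> i) \<longrightarrow>
       (\<exists>l \<in> carrier R. \<forall>i. l \<ominus>\<^bsub>R\<^esub> x i \<in> jacobson_radical R [^]\<^bsub>ideals_set R\<^esub> i))"

text \<open>The valuation ring is a subset \<open>S\<close> of its field of fractions \<open>K\<close>.\<close>

definition p_modular_system :: "nat \<Rightarrow> ('a, 'm) ring_scheme \<Rightarrow> 'a set \<Rightarrow> bool"
  where "p_modular_system p K S \<longleftrightarrow>
    (let R = K\<lparr>carrier := S\<rparr>; k = R Quot (jacobson_radical R) in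
      Factorial_Ring.prime p \<and>
      field K \<and> ring_char K = 0 \<and>
      subring S K \<and> complete_dvr R \<and>
      (\<forall>x \<in> carrier K. \<exists>a \<in> S. \<exists>b \<in> S - {\<zero>\<^bsub>K\<^esub>}. x = a \<otimes>\<^bsub>K\<^esub> inv\<^bsub>K\<^esub> b) \<and>
      algebraically_closed k \<and> ring_char k = p)"

definition contains_roots_of_unity :: "('a, 'm) ring_scheme \<Rightarrow> nat \<Rightarrow> bool"
  where "contains_roots_of_unity K m \<longleftrightarrow>
    (\<exists>\<zeta> \<in> carrier (units_of K). group.ord (units_of K) \<zeta> = m)"


section \<open>Semidirect products and class-preserving automorphisms\<close>

definition semidirect ::
    "('n, 'a) monoid_scheme \<Rightarrow> ('h, 'b) monoid_scheme \<Rightarrow> ('h \<Rightarrow> 'n \<Rightarrow> 'n) \<Rightarrow> ('n \<times> 'h) monoid"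
  where "semidirect N H act =
    \<lparr>carrier = carrier N \<times> carrier H,
     monoid.mult = (\<lambda>(n, h) (n', h'). (n \<otimes>\<^bsub>N\<^esub> act h n', h \<otimes>\<^bsub>H\<^esub> h')),
     one = (\<one>\<^bsub>N\<^esub>, \<one>\<^bsub>H\<^esub>)\<rparr>"

definition conj_class :: "('g, 'm) monoid_scheme \<Rightarrow> 'g \<Rightarrow> 'g set"
  where "conj_class H x = {y \<otimes>\<^bsub>H\<^esub> x \<otimes>\<^bsub>H\<^esub> inv\<^bsub>H\<^esub> y | y. y \<in> carrier H}"

definition Aut_c :: "('g, 'm) monoid_scheme \<Rightarrow> ('g \<Rightarrow> 'g) set"
  where "Aut_c H = {\<phi> \<in> auto H. \<forall>x \<in> carrier H. \<phi> ` conj_class H x = conj_class H x}"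

definition Inn :: "('g, 'm) monoid_scheme \<Rightarrow> ('g \<Rightarrow> 'g) set"
  where "Inn H = {\<lambda>x \<in> carrier H. y \<otimes>\<^bsub>H\<^esub> x \<otimes>\<^bsub>H\<^esub> inv\<^bsub>H\<^esub> y | y. y \<in> carrier H}"

definition Out_c :: "('g, 'm) monoid_scheme \<Rightarrow> ('g \<Rightarrow> 'g) set monoid"
  where "Out_c H = ((AutoGroup H)\<lparr>carrier := Aut_c H\<rparr>) Mod (Inn H)"


section \<open>Modules and bimodules\<close>

text \<open>The underlying abelian group of a module is stored, multiplicatively written, in the
  monoid part of the record.\<close>

record ('a, 'm) lmod = "'m monoid" +
  lact :: "'a \<Rightarrow> 'm \<Rightarrow> 'm"

record ('a, 'b, 'm) bimod = "('a, 'm) lmod" +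
  ract :: "'m \<Rightarrow> 'b \<Rightarrow> 'm"

locale left_module = A?: ring A + M: comm_group M
  for A :: "('a, 'r) ring_scheme" (structure) and M :: "('a, 'm, 'z) lmod_scheme" +
  assumes lact_closed: "\<lbrakk>a \<in> carrier A; m \<in> carrier M\<rbrakk> \<Longrightarrow> lact M a m \<in> carrier M"
    and lact_distr: "\<lbrakk>a \<in> carrier A; m \<in> carrier M; m' \<in> carrier M\<rbrakk> \<Longrightarrow>
      lact M a (m \<otimes>\<^bsub>M\<^esub> m') = lact M a m \<otimes>\<^bsub>M\<^esub> lact M a m'"
    and lact_add: "\<lbrakk>a \<in> carrier A; a' \<in> carrier A; m \<in> carrier M\<rbrakk> \<Longrightarrow>
      lact M (a \<oplus> a') m = lact M a m \<otimes>\<^bsub>M\<^esub> lact M a' m"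
    and lact_mult: "\<lbrakk>a \<in> carrier A; a' \<in> carrier A; m \<in> carrier M\<rbrakk> \<Longrightarrow>
      lact M (a \<otimes> a') m = lact M a (lact M a' m)"
    and lact_one: "m \<in> carrier M \<Longrightarrow> lact M \<one> m = m"

locale bimodule = left_module A M + B: ring B
  for A :: "('a, 'r) ring_scheme" (structure) and B :: "('b, 's) ring_scheme"
    and M :: "('a, 'b, 'm, 'z) bimod_scheme" +
  assumes ract_closed: "\<lbrakk>b \<in> carrier B; m \<in> carrier M\<rbrakk> \<Longrightarrow> ract M m b \<in> carrier M"
    and ract_distr: "\<lbrakk>b \<in> carrier B; m \<in> carrier M; m' \<in> carrier M\<rbrakk> \<Longrightarrow>
      ract M (m \<otimes>\<^bsub>M\<^esub> m') b = ract M m b \<otimes>\<^bsub>M\<^esub> ract M m' b"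
    and ract_add: "\<lbrakk>b \<in> carrier B; b' \<in> carrier B; m \<in> carrier M\<rbrakk> \<Longrightarrow>
      ract M m (b \<oplus>\<^bsub>B\<^esub> b') = ract M m b \<otimes>\<^bsub>M\<^esub> ract M m b'"
    and ract_mult: "\<lbrakk>b \<in> carrier B; b' \<in> carrier B; m \<in> carrier M\<rbrakk> \<Longrightarrow>
      ract M m (b \<otimes>\<^bsub>B\<^esub> b') = ract M (ract M m b) b'"
    and ract_one: "m \<in> carrier M \<Longrightarrow> ract M m \<one>\<^bsub>B\<^esub> = m"
    and lact_ract: "\<lbrakk>a \<in> carrier A; b \<in> carrier B; m \<in> carrier M\<rbrakk> \<Longrightarrow>
      ract M (lact M a m) b = lact M a (ract M m b)"

definition simple_module ::
    "('a, 'r) ring_scheme \<Rightarrow> ('a, 'm, 'z) lmod_scheme \<Rightarrow> bool"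
  where "simple_module A M \<longleftrightarrow> left_module A M \<and> carrier M \<noteq> {\<one>\<^bsub>M\<^esub>} \<and>
    (\<forall>W. subgroup W M \<and> (\<forall>a \<in> carrier A. \<forall>w \<in> W. lact M a w \<in> W) \<longrightarrow>
      W = {\<one>\<^bsub>M\<^esub>} \<or> W = carrier M)"

definition bimod_iso ::
    "('a, 'r) ring_scheme \<Rightarrow> ('b, 's) ring_scheme \<Rightarrow>
     ('a, 'b, 'm, 'y) bimod_scheme \<Rightarrow> ('a, 'b, 'n, 'z) bimod_scheme \<Rightarrow> bool"
  where "bimod_iso A B M N \<longleftrightarrow> (\<exists>f \<in> iso M N. \<forall>m \<in> carrier M.
    (\<forall>a \<in> carrier A. f (lact M a m) = lact N a (f m)) \<and>
    (\<forall>b \<in> carrier B. f (ract M m b) = ract N (f m) b))"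

definition regular_bimod :: "('a, 'r) ring_scheme \<Rightarrow> ('a, 'a, 'a) bimod"
  where "regular_bimod A =
    \<lparr>carrier = carrier A, monoid.mult = ring.add A, one = \<zero>\<^bsub>A\<^esub>,
     lact = monoid.mult A, ract = monoid.mult A\<rparr>"

definition twisted_bimod :: "('a \<Rightarrow> 'a) \<Rightarrow> ('a, 'r) ring_scheme \<Rightarrow> ('a, 'a, 'a) bimod"
  where "twisted_bimod \<alpha> A = (regular_bimod A)\<lparr>lact := \<lambda>x m. \<alpha> x \<otimes>\<^bsub>A\<^esub> m\<rparr>"

definition restrict_left ::
    "('c \<Rightarrow> 'a) \<Rightarrow> ('a, 'm, 'z) lmod_scheme \<Rightarrow> ('c, 'm) lmod"
  where "restrict_left f M =
    \<lparr>carrier = carrier M, monoid.mult = monoid.mult M, one = \<one>\<^bsub>M\<^esub>,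
     lact = \<lambda>c. lact M (f c)\<rparr>"


subsection \<open>Tensor products\<close>

text \<open>\<open>M \<otimes>\<^sub>B N\<close> is the free abelian group on \<open>M \<times> N\<close> modulo the
  bilinearity and balancing relations; its elements are cosets.\<close>

definition tensor_relations ::
    "('b, 's) ring_scheme \<Rightarrow> ('a, 'b, 'm, 'y) bimod_scheme \<Rightarrow> ('b, 'n, 'z) lmod_scheme \<Rightarrow>
     ('m \<times> 'n \<Rightarrow>\<^sub>0 int) set"
  where "tensor_relations B M N =
    generate (free_Abelian_group (carrier M \<times> carrier N))
     ({frag_of (m \<otimes>\<^bsub>M\<^esub> m', n) - frag_of (m, n) - frag_of (m', n) | m m' n.
         m \<in> carrier M \<and> m' \<in> carrier M \<and> n \<in> carrier N} \<union>
      {frag_of (m, n \<otimes>\<^bsub>N\<^esub> n') - frag_of (m, n) - frag_of (m, n') | m n n'.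
         m \<in> carrier M \<and> n \<in> carrier N \<and> n' \<in> carrier N} \<union>
      {frag_of (ract M m b, n) - frag_of (m, lact N b n) | m b n.
         m \<in> carrier M \<and> b \<in> carrier B \<and> n \<in> carrier N})"

definition tensor_group ::
    "('b, 's) ring_scheme \<Rightarrow> ('a, 'b, 'm, 'y) bimod_scheme \<Rightarrow> ('b, 'n, 'z) lmod_scheme \<Rightarrow>
     ('m \<times> 'n \<Rightarrow>\<^sub>0 int) set monoid"
  where "tensor_group B M N =
    free_Abelian_group (carrier M \<times> carrier N) Mod tensor_relations B M N"

text \<open>The map \<open>m \<otimes> n \<mapsto> f m \<otimes> g n\<close> on cosets. For compatible \<open>f\<close> and \<open>g\<close>
  all the cosets in the union coincide.\<close>

definition tensor_map ::
    "('b, 's) ring_scheme \<Rightarrow> ('a, 'b, 'm, 'y) bimod_scheme \<Rightarrow> ('b, 'n, 'z) lmod_scheme \<Rightarrow>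
     ('m \<Rightarrow> 'm) \<Rightarrow> ('n \<Rightarrow> 'n) \<Rightarrow> ('m \<times> 'n \<Rightarrow>\<^sub>0 int) set \<Rightarrow> ('m \<times> 'n \<Rightarrow>\<^sub>0 int) set"
  where "tensor_map B M N f g U =
    (\<Union>z \<in> U. r_coset (free_Abelian_group (carrier M \<times> carrier N)) (tensor_relations B M N)
       (frag_extend (\<lambda>(m, n). frag_of (f m, g n)) z))"

definition tensor_lmod ::
    "('b, 's) ring_scheme \<Rightarrow> ('a, 'b, 'm, 'y) bimod_scheme \<Rightarrow> ('b, 'n, 'z) lmod_scheme \<Rightarrow>
     ('a, ('m \<times> 'n \<Rightarrow>\<^sub>0 int) set) lmod"
  where "tensor_lmod B M N =
    \<lparr>carrier = carrier (tensor_group B M N),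
     monoid.mult = monoid.mult (tensor_group B M N),
     one = one (tensor_group B M N),
     lact = \<lambda>a. tensor_map B M N (lact M a) (\<lambda>n. n)\<rparr>"

definition tensor_bimod ::
    "('b, 's) ring_scheme \<Rightarrow> ('a, 'b, 'm, 'y) bimod_scheme \<Rightarrow> ('b, 'c, 'n, 'z) bimod_scheme \<Rightarrow>
     ('a, 'c, ('m \<times> 'n \<Rightarrow>\<^sub>0 int) set) bimod"
  where "tensor_bimod B M N =
    \<lparr>carrier = carrier (tensor_group B M N),
     monoid.mult = monoid.mult (tensor_group B M N),
     one = one (tensor_group B M N),
     lact = \<lambda>a. tensor_map B M N (lact M a) (\<lambda>n. n),
     ract = \<lambda>x c. tensor_map B M N (\<lambda>m. m) (\<lambda>n. ract N n c) x\<rparr>"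


section \<open>Picard groups\<close>

text \<open>A bimodule induces a Morita auto-equivalence iff it is invertible under the tensor product;
  linearity over the ring of central scalars \<open>S\<close> means that \<open>S\<close> acts symmetrically.\<close>

definition morita_bimod ::
    "'a set \<Rightarrow> ('a, 'r) ring_scheme \<Rightarrow> ('a, 'a, 'a) bimod \<Rightarrow> bool"
  where "morita_bimod S A M \<longleftrightarrow>
    (let sym = (\<lambda>P :: ('a, 'a, 'a) bimod.
       bimodule A A P \<and> (\<forall>r \<in> S. \<forall>m \<in> carrier P. lact P r m = ract P m r))
     in sym M \<and>
       (\<exists>N. sym N \<and>
          bimod_iso A A (tensor_bimod A M N) (regular_bimod A) \<and>
          bimod_iso A A (tensor_bimod A N M) (regular_bimod A)))"

definition bimod_class ::
    "('a, 'r) ring_scheme \<Rightarrow> ('a, 'a, 'a) bimod \<Rightarrow> ('a, 'a, 'a) bimod set"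
  where "bimod_class A M = {N. bimodule A A N \<and> bimod_iso A A M N}"

text \<open>Isomorphism classes are taken among bimodules carried by the type of the algebra itself.
  For a group algebra \<open>\<O>G\<close> no class is lost: a bimodule inducing a Morita auto-equivalence,
  as well as its inverse, is free of finite rank over \<open>\<O>\<close>.\<close>

definition Pic :: "'a set \<Rightarrow> ('a, 'r) ring_scheme \<Rightarrow> ('a, 'a, 'a) bimod set monoid"
  where "Pic S A =
    \<lparr>carrier = {bimod_class A M | M. morita_bimod S A M},
     monoid.mult = (\<lambda>U W. {P. bimodule A A P \<and>
       (\<exists>M \<in> U. \<exists>N \<in> W. bimod_iso A A P (tensor_bimod A M N))}),
     one = bimod_class A (regular_bimod A)\<rparr>"


section \<open>Group algebras and characters\<close>

definition group_algebra ::
    "('k, 'r) ring_scheme \<Rightarrow> ('g, 'm) monoid_scheme \<Rightarrow> ('g \<Rightarrow> 'k) ring"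
  where "group_algebra R G =
    \<lparr>carrier = carrier G \<rightarrow>\<^sub>E carrier R,
     monoid.mult = (\<lambda>x y. \<lambda>g \<in> carrier G.
       \<Oplus>\<^bsub>R\<^esub>h \<in> carrier G. x h \<otimes>\<^bsub>R\<^esub> y (inv\<^bsub>G\<^esub> h \<otimes>\<^bsub>G\<^esub> g)),
     one = (\<lambda>g \<in> carrier G. if g = \<one>\<^bsub>G\<^esub> then \<one>\<^bsub>R\<^esub> else \<zero>\<^bsub>R\<^esub>),
     ring.zero = (\<lambda>g \<in> carrier G. \<zero>\<^bsub>R\<^esub>),
     ring.add = (\<lambda>x y. \<lambda>g \<in> carrier G. x g \<oplus>\<^bsub>R\<^esub> y g)\<rparr>"

text \<open>The element \<open>c\<cdot>g\<close> of the group algebra.\<close>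

definition ga_single ::
    "('k, 'r) ring_scheme \<Rightarrow> ('g, 'm) monoid_scheme \<Rightarrow> 'k \<Rightarrow> 'g \<Rightarrow> 'g \<Rightarrow> 'k"
  where "ga_single R G c g = (\<lambda>x \<in> carrier G. if x = g then c else \<zero>\<^bsub>R\<^esub>)"

text \<open>The linear extension \<open>\<Sum> x\<^sub>g g \<mapsto> \<Sum> x\<^sub>g \<psi>(g)\<close> of an automorphism \<open>\<psi>\<close>.\<close>

definition ga_extend :: "('g, 'm) monoid_scheme \<Rightarrow> ('g \<Rightarrow> 'g) \<Rightarrow> ('g \<Rightarrow> 'k) \<Rightarrow> 'g \<Rightarrow> 'k"
  where "ga_extend G \<psi> x = (\<lambda>g \<in> carrier G. x (inv_into (carrier G) \<psi> g))"

definition central_idempotents :: "('a, 'r) ring_scheme \<Rightarrow> 'a set"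
  where "central_idempotents A = {e \<in> carrier A. e \<otimes>\<^bsub>A\<^esub> e = e \<and>
    (\<forall>x \<in> carrier A. e \<otimes>\<^bsub>A\<^esub> x = x \<otimes>\<^bsub>A\<^esub> e)}"

definition block_idempotent :: "('a, 'r) ring_scheme \<Rightarrow> 'a \<Rightarrow> bool"
  where "block_idempotent A e \<longleftrightarrow> e \<in> central_idempotents A \<and> e \<noteq> \<zero>\<^bsub>A\<^esub> \<and>
    (\<forall>e1 \<in> central_idempotents A. \<forall>e2 \<in> central_idempotents A.
       e = e1 \<oplus>\<^bsub>A\<^esub> e2 \<and> e1 \<otimes>\<^bsub>A\<^esub> e2 = \<zero>\<^bsub>A\<^esub> \<longrightarrow> e1 = \<zero>\<^bsub>A\<^esub> \<or> e2 = \<zero>\<^bsub>A\<^esub>)"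

text \<open>\<open>\<chi>\<close> is the trace character of the finite-dimensional \<open>KG\<close>-module \<open>V\<close>: \<open>v\<close> is a
  \<open>K\<close>-basis of \<open>V\<close>, and \<open>a g\<close> the matrix of \<open>g\<close> with respect to it.\<close>

definition affords ::
    "('k, 'r) ring_scheme \<Rightarrow> ('g, 'm) monoid_scheme \<Rightarrow> ('g \<Rightarrow> 'k, 'v, 'z) lmod_scheme \<Rightarrow>
     ('g \<Rightarrow> 'k) \<Rightarrow> bool"
  where "affords K G V \<chi> \<longleftrightarrow>
    left_module (group_algebra K G) V \<and> \<chi> \<in> carrier G \<rightarrow>\<^sub>E carrier K \<and>
    (\<exists>(d::nat) v (a :: 'g \<Rightarrow> nat \<Rightarrow> nat \<Rightarrow> 'k).
      (let comb = (\<lambda>c. \<Otimes>\<^bsub>V\<^esub>i \<in> {..<d}. lact V (ga_single K G (c i) \<one>\<^bsub>G\<^esub>) (v i)) in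
        v \<in> {..<d} \<rightarrow> carrier V \<and>
        (\<forall>x \<in> carrier V. \<exists>!c. c \<in> {..<d} \<rightarrow>\<^sub>E carrier K \<and> x = comb c) \<and>
        (\<forall>g \<in> carrier G.
          (\<forall>i<d. \<forall>j<d. a g i j \<in> carrier K) \<and>
          (\<forall>j<d. lact V (ga_single K G \<one>\<^bsub>K\<^esub> g) (v j) = comb (\<lambda>i. a g i j)) \<and>
          \<chi> g = (\<Oplus>\<^bsub>K\<^esub>i \<in> {..<d}. a g i i))))"

text \<open>A simple \<open>KG\<close>-module embeds into \<open>KG\<close> as a vector space, so it suffices to consider modules
  carried by the type of \<open>KG\<close>.\<close>

definition Irr :: "('k, 'r) ring_scheme \<Rightarrow> ('g, 'm) monoid_scheme \<Rightarrow> ('g \<Rightarrow> 'k) set"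
  where "Irr K G = {\<chi>. \<exists>V :: ('g \<Rightarrow> 'k, 'g \<Rightarrow> 'k) lmod.
    simple_module (group_algebra K G) V \<and> affords K G V \<chi>}"

text \<open>The \<open>KG\<close>-\<open>KG\<close>-bimodule \<open>K \<otimes>\<^sub>\<O> M\<close> for an \<open>\<O>G\<close>-\<open>\<O>G\<close>-bimodule \<open>M\<close>, where \<open>\<O>\<close> is the
  subring \<open>S\<close> of \<open>K\<close>: \<open>(\<Sum> x\<^sub>g g) (c \<otimes> m) = \<Sum> x\<^sub>g c \<otimes> g m\<close>, and likewise on the right.\<close>

definition base_change ::
    "'k ring \<Rightarrow> 'k set \<Rightarrow> ('g, 'l) monoid_scheme \<Rightarrow>
     ('g \<Rightarrow> 'k, 'g \<Rightarrow> 'k, 'm, 'z) bimod_scheme \<Rightarrow>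
     ('g \<Rightarrow> 'k, 'g \<Rightarrow> 'k, ('k \<times> 'm \<Rightarrow>\<^sub>0 int) set) bimod"
  where "base_change K S G M =
    (let R = K\<lparr>carrier := S\<rparr>;
         K' = regular_bimod K;
         M' = restrict_left (\<lambda>r. ga_single K G r \<one>\<^bsub>G\<^esub>) M;
         T = tensor_group R K' M'
     in \<lparr>carrier = carrier T, monoid.mult = monoid.mult T, one = one T,
         lact = (\<lambda>x U. \<Otimes>\<^bsub>T\<^esub>g \<in> carrier G.
           tensor_map R K' M' (\<lambda>c. x g \<otimes>\<^bsub>K\<^esub> c) (lact M (ga_single K G \<one>\<^bsub>K\<^esub> g)) U),
         ract = (\<lambda>U x. \<Otimes>\<^bsub>T\<^esub>g \<in> carrier G.
           tensor_map R K' M' (\<lambda>c. c \<otimes>\<^bsub>K\<^esub> x g) (\<lambda>m. ract M m (ga_single K G \<one>\<^bsub>K\<^esub> g)) U)\<rparr>)"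

text \<open>\<open>M\<close> induces the trivial permutation of \<open>Irr(G)\<close>: if a simple \<open>KG\<close>-module \<open>V\<close> affords \<open>\<chi>\<close>,
  then so does \<open>(K \<otimes>\<^sub>\<O> M) \<otimes>\<^bsub>KG\<^esub> V\<close>.\<close>

definition trivial_on_Irr ::
    "'k ring \<Rightarrow> 'k set \<Rightarrow> ('g, 'l) monoid_scheme \<Rightarrow>
     ('g \<Rightarrow> 'k, 'g \<Rightarrow> 'k, 'm, 'z) bimod_scheme \<Rightarrow> bool"
  where "trivial_on_Irr K S G M \<longleftrightarrow>
    (\<forall>\<chi> \<in> Irr K G. \<forall>V :: ('g \<Rightarrow> 'k, 'g \<Rightarrow> 'k) lmod.
       simple_module (group_algebra K G) V \<and> affords K G V \<chi> \<longrightarrow>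
       affords K G (tensor_lmod (group_algebra K G) (base_change K S G M) V) \<chi>)"

text \<open>\<open>Pic(\<O>G)\<close> and \<open>Picent(\<O>G)\<close>.\<close>

definition Pic_group_algebra ::
    "'k ring \<Rightarrow> 'k set \<Rightarrow> ('g, 'l) monoid_scheme \<Rightarrow>
     ('g \<Rightarrow> 'k, 'g \<Rightarrow> 'k, 'g \<Rightarrow> 'k) bimod set monoid"
  where "Pic_group_algebra K S G =
    Pic ((\<lambda>r. ga_single K G r \<one>\<^bsub>G\<^esub>) ` S) (group_algebra (K\<lparr>carrier := S\<rparr>) G)"

definition Picent_group_algebra ::
    "'k ring \<Rightarrow> 'k set \<Rightarrow> ('g, 'l) monoid_scheme \<Rightarrow>
     ('g \<Rightarrow> 'k, 'g \<Rightarrow> 'k, 'g \<Rightarrow> 'k) bimod set monoid"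
  where "Picent_group_algebra K S G = (Pic_group_algebra K S G)
    \<lparr>carrier := {U \<in> carrier (Pic_group_algebra K S G). \<forall>M \<in> U. trivial_on_Irr K S G M}\<rparr>"

text \<open>The map \<open>Out\<^sub>c(G) \<rightarrow> Picent(\<O>G)\<close>, on a coset of \<open>Inn(G)\<close>: the class of
  \<open>\<^sub>\<psi>(\<O>G)\<close> does not depend on the representative \<open>\<psi>\<close>.\<close>

definition Out_c_to_Picent ::
    "'k ring \<Rightarrow> 'k set \<Rightarrow> ('g, 'l) monoid_scheme \<Rightarrow> ('g \<Rightarrow> 'g) set \<Rightarrow>
     ('g \<Rightarrow> 'k, 'g \<Rightarrow> 'k, 'g \<Rightarrow> 'k) bimod set"
  where "Out_c_to_Picent K S G C =
    (let A = group_algebra (K\<lparr>carrier := S\<rparr>) G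
     in bimod_class A (twisted_bimod (ga_extend G (SOME \<psi>. \<psi> \<in> C)) A))"

end

theory Submission
  imports Defs
begin

text \<open>Write \<open>q = p\<^sup>n\<close>, \<open>\<omega> = \<omega>\<^bsub>t\<^sup>2\<^esub>\<close> and \<open>\<zeta> = \<omega>\<^sub>s\<close>. The automorphism that does the job is
  \<open>\<psi> (v, e) = (\<omega>v, e)\<close>: multiplication by \<open>\<omega>\<close> on \<open>D\<close> and the identity on \<open>E\<close>. It is a homomorphism
  because \<open>\<omega>\<close> lies in the field with \<open>q\<close> elements, so that it commutes with the action of \<open>E\<close>, which
  is by maps \<open>x \<mapsto> c x\<^bsup>q^j\<^esup>\<close>.

  \<^emph>\<open>It preserves classes.\<close> The order \<open>st\<^sup>2\<close> of \<open>E\<close> is prime to \<open>p\<close>, so averaging over the powers of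
  \<open>e \<in> E\<close> splits \<open>v = v\<^sub>0 + (w - ew)\<close> with \<open>ev\<^sub>0 = v\<^sub>0\<close> (\<open>fixed_point_decomposition\<close>), and
  \<open>(v, e)\<close> is conjugate to \<open>(v\<^sub>0, e)\<close>. If \<open>v\<^sub>0 \<noteq> 0\<close>, then \<open>v\<^sub>0\<^bsup>1-q\<^esup>\<close> is a root of unity of order
  dividing \<open>(q\<^sup>t - 1) / (q - 1) = st\<close>, that is, a power of \<open>\<zeta>\<omega>\<^sup>t\<close>, which is what \<open>E\<close> needs in
  order to contain an element \<open>l\<close> of the form \<open>x \<mapsto> c x\<^sup>q\<close> with \<open>lv\<^sub>0 = \<omega>v\<^sub>0\<close>
  (\<open>orbit_contains_multiple\<close>). Now \<open>elv\<^sub>0 = \<omega>v\<^sub>0 = lev\<^sub>0\<close>, and the maps \<open>el\<close> and \<open>le\<close> involve the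
  same power of Frobenius, so agreeing at one nonzero vector they are equal. Hence \<open>l\<close> conjugates
  \<open>(v\<^sub>0, e)\<close> to \<open>(\<omega>v\<^sub>0, e)\<close>.

  \<^emph>\<open>It is not inner, even in the group algebra.\<close> If conjugation by an element of \<open>G\<close> agreed with
  \<open>\<psi>\<close> on \<open>D\<close>, its inverse would act on \<open>D\<close> as \<open>\<omega>\<^sup>-\<^sup>1\<close>. This gives \<open>\<zeta>\<^sup>i\<omega>\<^sup>j\<^sup>+\<^sup>1 = 1\<close> with
  \<open>t\<close> dividing \<open>j\<close>, and raising to the power \<open>s\<close> shows that \<open>t\<close> divides \<open>j + 1\<close> as well
  (\<open>\<psi>_not_conjugation\<close>). A unit \<open>u\<close> of
  \<open>\<O>G\<close> does no better: if \<open>d u = u \<nu>(d)\<close> for all \<open>d \<in> D\<close>, then the coefficients of \<open>u\<close> on a coset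
  \<open>Dx\<close> are invariant under translation by \<open>d x \<nu>(d)\<^sup>-\<^sup>1 x\<^sup>-\<^sup>1\<close>. Unless \<open>\<nu>\<close> is conjugation by \<open>x\<^sup>-\<^sup>1\<close>,
  one of these translations is fixed point free of order \<open>p\<close>, and the coefficients on \<open>Dx\<close> add up to
  a multiple of \<open>p\<close>. If this happened for all cosets, the augmentation of the unit \<open>u\<close> would lie in
  the maximal ideal \<open>J\<close> (\<open>intertwiner_imp_conjugation\<close>). An isomorphism of \<open>\<^sub>\<psi>(\<O>G)\<close> with \<open>\<O>G\<close> would
  produce such a unit for a product of \<open>\<psi>\<close> and an inner automorphism
  (\<open>twisted_iso_regular_imp_inner\<close>).

  \<^emph>\<open>\<open>\<O>G\<close> is a block.\<close> For a central idempotent \<open>e\<close> the same argument with \<open>\<nu> = id\<close> shows that the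
  coset sums of \<open>e\<close> off \<open>D\<close> lie in \<open>J\<close>, because \<open>D\<close> is self-centralizing. Its augmentation is
  \<open>0\<close> or \<open>1\<close>; if it is \<open>0\<close>, the sum over \<open>D\<close> lies in \<open>J\<close> too. Then \<open>e\<close> annihilates all vectors
  that are fixed by \<open>D\<close> modulo \<open>J\<close>, and since \<open>D\<close> acts unipotently modulo \<open>J\<close>, this forces
  \<open>e \<in> J\<O>G\<close> and finally \<open>e = 0\<close> (\<open>block_idempotent_one\<close>).

  \<^emph>\<open>The image lies in \<open>Picent(\<O>G)\<close>.\<close> Tensoring with \<open>\<^sub>\<psi>(\<O>G)\<close> twists a module by \<open>\<psi>\<close>. The
  bimodule twisted by \<open>\<psi>\<^sup>-\<^sup>1\<close> is therefore an inverse, and the character of the twisted module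
  takes at \<open>g\<close> the value that the original one takes at the conjugate \<open>\<psi>(g)\<close> of \<open>g\<close>
  (\<open>trivial_on_Irr_twisted\<close>).\<close>

section \<open>Group algebras\<close>

lemma (in comm_monoid) finprod_swap:
  assumes "finite A" "finite B" "\<And>a b. a \<in> A \<Longrightarrow> b \<in> B \<Longrightarrow> f a b \<in> carrier G"
  shows "(\<Otimes>a\<in>A. \<Otimes>b\<in>B. f a b) = (\<Otimes>b\<in>B. \<Otimes>a\<in>A. f a b)"
  using assms(1,3)
proof (induction A)
  case (insert a A)
  have "(\<Otimes>a\<in>insert a A. \<Otimes>b\<in>B. f a b) = (\<Otimes>b\<in>B. f a b) \<otimes> (\<Otimes>b\<in>B. \<Otimes>a\<in>A. f a b)"
    using insert by (subst finprod_insert) (auto intro!: finprod_closed)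
  also have "\<dots> = (\<Otimes>b\<in>B. f a b \<otimes> (\<Otimes>a\<in>A. f a b))"
    using insert by (subst finprod_multf) (auto intro!: finprod_closed)
  also have "\<dots> = (\<Otimes>b\<in>B. \<Otimes>a\<in>insert a A. f a b)"
    using insert by (intro finprod_cong') (auto intro!: finprod_closed finprod_insert[symmetric])
  finally show ?case .
qed (simp_all)

lemma (in comm_monoid) finprod_reindex_bij_betw:
  assumes "bij_betw h A B" "f \<in> B \<rightarrow> carrier G"
  shows "(\<Otimes>a\<in>A. f (h a)) = finprod G f B"
  using finprod_reindex[of f h A] assms by (auto simp: bij_betw_def)

lemmas (in abelian_monoid) finsum_swap = add.finprod_swap
lemmas (in abelian_monoid) finsum_reindex_bij_betw = add.finprod_reindex_bij_betw

lemma (in group) bij_betw_l_mult: "k \<in> carrier G \<Longrightarrow> bij_betw (\<lambda>h. k \<otimes> h) (carrier G) (carrier G)"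
  by (rule bij_betw_byWitness[where f' = "\<lambda>h. inv k \<otimes> h"]) (auto simp: m_assoc[symmetric])

lemma (in group) bij_betw_r_mult: "k \<in> carrier G \<Longrightarrow> bij_betw (\<lambda>h. h \<otimes> k) (carrier G) (carrier G)"
  by (rule bij_betw_byWitness[where f' = "\<lambda>h. h \<otimes> inv k"]) (auto simp: m_assoc)

locale finite_group_algebra = R?: cring R + G?: group G
  for R :: "('k, 'r) ring_scheme" (structure) and G :: "('g, 'm) monoid_scheme" (structure) +
  assumes finite_carrier: "finite (carrier G)"
begin

abbreviation RG :: "('g \<Rightarrow> 'k) ring" where "RG \<equiv> group_algebra R G"

lemma ga_carrier: "carrier RG = carrier G \<rightarrow>\<^sub>E carrier R"
  and ga_mult: "x \<otimes>\<^bsub>RG\<^esub> y = (\<lambda>g \<in> carrier G. \<Oplus>\<^bsub>R\<^esub>h \<in> carrier G. x h \<otimes>\<^bsub>R\<^esub> y (inv\<^bsub>G\<^esub> h \<otimes>\<^bsub>G\<^esub> g))"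
  and ga_one: "\<one>\<^bsub>RG\<^esub> = ga_single R G \<one>\<^bsub>R\<^esub> \<one>\<^bsub>G\<^esub>"
  and ga_zero: "\<zero>\<^bsub>RG\<^esub> = (\<lambda>g \<in> carrier G. \<zero>\<^bsub>R\<^esub>)"
  and ga_add: "x \<oplus>\<^bsub>RG\<^esub> y = (\<lambda>g \<in> carrier G. x g \<oplus>\<^bsub>R\<^esub> y g)"
  by (simp_all add: group_algebra_def ga_single_def)

lemma ga_coeff [simp, intro]: "x \<in> carrier RG \<Longrightarrow> g \<in> carrier G \<Longrightarrow> x g \<in> carrier R"
  by (auto simp: ga_carrier)

lemma ga_eqI:
  "\<lbrakk>x \<in> carrier RG; y \<in> carrier RG; \<And>g. g \<in> carrier G \<Longrightarrow> x g = y g\<rbrakk> \<Longrightarrow> x = y"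
  by (metis PiE_ext ga_carrier)

lemma ga_mult_closed [simp]: "x \<in> carrier RG \<Longrightarrow> y \<in> carrier RG \<Longrightarrow> x \<otimes>\<^bsub>RG\<^esub> y \<in> carrier RG"
  unfolding ga_mult by (auto simp: ga_carrier intro!: R.finsum_closed R.m_closed)

lemma ga_single_closed [simp]: "c \<in> carrier R \<Longrightarrow> ga_single R G c g \<in> carrier RG"
  by (auto simp: ga_carrier ga_single_def)

lemma sum_translate:
  assumes "f \<in> carrier G \<rightarrow> carrier R" "k \<in> carrier G"
  shows "(\<Oplus>\<^bsub>R\<^esub>h \<in> carrier G. f (k \<otimes>\<^bsub>G\<^esub> h)) = (\<Oplus>\<^bsub>R\<^esub>h \<in> carrier G. f h)"
    "(\<Oplus>\<^bsub>R\<^esub>h \<in> carrier G. f (h \<otimes>\<^bsub>G\<^esub> k)) = (\<Oplus>\<^bsub>R\<^esub>h \<in> carrier G. f h)"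
  using R.finsum_reindex_bij_betw[OF G.bij_betw_l_mult[OF assms(2)] assms(1)]
    R.finsum_reindex_bij_betw[OF G.bij_betw_r_mult[OF assms(2)] assms(1)] by auto

lemma sum_delta:
  assumes "f \<in> carrier G \<rightarrow> carrier R" "k \<in> carrier G"
  shows "(\<Oplus>\<^bsub>R\<^esub>h \<in> carrier G. if h = k then f h else \<zero>\<^bsub>R\<^esub>) = f k"
  using R.add.finprod_singleton_swap[OF assms(2) finite_carrier assms(1)] .

lemma ga_assoc:
  assumes x: "x \<in> carrier RG" and y: "y \<in> carrier RG" and z: "z \<in> carrier RG"
  shows "(x \<otimes>\<^bsub>RG\<^esub> y) \<otimes>\<^bsub>RG\<^esub> z = x \<otimes>\<^bsub>RG\<^esub> (y \<otimes>\<^bsub>RG\<^esub> z)"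
proof (rule ga_eqI)
  fix g assume g: "g \<in> carrier G"
  note [simp] = ga_coeff[OF x] ga_coeff[OF y] ga_coeff[OF z] g
  have "((x \<otimes>\<^bsub>RG\<^esub> y) \<otimes>\<^bsub>RG\<^esub> z) g =
      (\<Oplus>\<^bsub>R\<^esub>h \<in> carrier G. (\<Oplus>\<^bsub>R\<^esub>k \<in> carrier G. x k \<otimes>\<^bsub>R\<^esub> y (inv\<^bsub>G\<^esub> k \<otimes>\<^bsub>G\<^esub> h)) \<otimes>\<^bsub>R\<^esub> z (inv\<^bsub>G\<^esub> h \<otimes>\<^bsub>G\<^esub> g))"
    by (auto simp: ga_mult intro!: R.finsum_cong')
  also have "\<dots> = (\<Oplus>\<^bsub>R\<^esub>h \<in> carrier G. \<Oplus>\<^bsub>R\<^esub>k \<in> carrier G.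
      x k \<otimes>\<^bsub>R\<^esub> (y (inv\<^bsub>G\<^esub> k \<otimes>\<^bsub>G\<^esub> h) \<otimes>\<^bsub>R\<^esub> z (inv\<^bsub>G\<^esub> h \<otimes>\<^bsub>G\<^esub> g)))"
    using finite_carrier by (intro R.finsum_cong') (auto simp: R.finsum_ldistr R.m_assoc intro!: R.finsum_cong')
  also have "\<dots> = (\<Oplus>\<^bsub>R\<^esub>k \<in> carrier G. \<Oplus>\<^bsub>R\<^esub>h \<in> carrier G.
      x k \<otimes>\<^bsub>R\<^esub> (y (inv\<^bsub>G\<^esub> k \<otimes>\<^bsub>G\<^esub> h) \<otimes>\<^bsub>R\<^esub> z (inv\<^bsub>G\<^esub> h \<otimes>\<^bsub>G\<^esub> g)))"
    using finite_carrier by (intro R.finsum_swap) auto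
  also have "\<dots> = (\<Oplus>\<^bsub>R\<^esub>k \<in> carrier G. \<Oplus>\<^bsub>R\<^esub>h \<in> carrier G.
      x k \<otimes>\<^bsub>R\<^esub> (y h \<otimes>\<^bsub>R\<^esub> z (inv\<^bsub>G\<^esub> h \<otimes>\<^bsub>G\<^esub> (inv\<^bsub>G\<^esub> k \<otimes>\<^bsub>G\<^esub> g))))"
  proof (rule R.finsum_cong'[OF refl])
    fix k assume k: "k \<in> carrier G"
    show "(\<Oplus>\<^bsub>R\<^esub>h \<in> carrier G. x k \<otimes>\<^bsub>R\<^esub> (y (inv\<^bsub>G\<^esub> k \<otimes>\<^bsub>G\<^esub> h) \<otimes>\<^bsub>R\<^esub> z (inv\<^bsub>G\<^esub> h \<otimes>\<^bsub>G\<^esub> g)))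
      = (\<Oplus>\<^bsub>R\<^esub>h \<in> carrier G. x k \<otimes>\<^bsub>R\<^esub> (y h \<otimes>\<^bsub>R\<^esub> z (inv\<^bsub>G\<^esub> h \<otimes>\<^bsub>G\<^esub> (inv\<^bsub>G\<^esub> k \<otimes>\<^bsub>G\<^esub> g))))"
      using k by (subst sum_translate(1)[symmetric, where k=k])
        (auto intro!: R.finsum_cong' simp: G.m_assoc[symmetric] G.inv_mult_group)
  qed (auto)
  also have "\<dots> = (x \<otimes>\<^bsub>RG\<^esub> (y \<otimes>\<^bsub>RG\<^esub> z)) g"
    using finite_carrier by (auto simp: ga_mult R.finsum_rdistr intro!: R.finsum_cong')
  finally show "((x \<otimes>\<^bsub>RG\<^esub> y) \<otimes>\<^bsub>RG\<^esub> z) g = (x \<otimes>\<^bsub>RG\<^esub> (y \<otimes>\<^bsub>RG\<^esub> z)) g" .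
qed (use assms in auto)

lemma single_mult:
  assumes "c \<in> carrier R" "k \<in> carrier G" "x \<in> carrier RG" "g \<in> carrier G"
  shows "(ga_single R G c k \<otimes>\<^bsub>RG\<^esub> x) g = c \<otimes>\<^bsub>R\<^esub> x (inv\<^bsub>G\<^esub> k \<otimes>\<^bsub>G\<^esub> g)"
proof -
  have "(ga_single R G c k \<otimes>\<^bsub>RG\<^esub> x) g
      = (\<Oplus>\<^bsub>R\<^esub>h \<in> carrier G. if h = k then c \<otimes>\<^bsub>R\<^esub> x (inv\<^bsub>G\<^esub> h \<otimes>\<^bsub>G\<^esub> g) else \<zero>\<^bsub>R\<^esub>)"
    using assms by (auto simp: ga_mult ga_single_def intro!: R.finsum_cong')
  also have "\<dots> = c \<otimes>\<^bsub>R\<^esub> x (inv\<^bsub>G\<^esub> k \<otimes>\<^bsub>G\<^esub> g)"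
    using assms by (subst sum_delta) auto
  finally show ?thesis .
qed

lemma mult_single:
  assumes "c \<in> carrier R" "k \<in> carrier G" "x \<in> carrier RG" "g \<in> carrier G"
  shows "(x \<otimes>\<^bsub>RG\<^esub> ga_single R G c k) g = x (g \<otimes>\<^bsub>G\<^esub> inv\<^bsub>G\<^esub> k) \<otimes>\<^bsub>R\<^esub> c"
proof -
  have *: "inv\<^bsub>G\<^esub> h \<otimes>\<^bsub>G\<^esub> g = k \<longleftrightarrow> h = g \<otimes>\<^bsub>G\<^esub> inv\<^bsub>G\<^esub> k" if "h \<in> carrier G" for h
    using that assms
    by (metis G.inv_closed G.inv_inv G.inv_mult_group G.inv_solve_left' G.m_closed)
  have "(x \<otimes>\<^bsub>RG\<^esub> ga_single R G c k) g
      = (\<Oplus>\<^bsub>R\<^esub>h \<in> carrier G. if h = g \<otimes>\<^bsub>G\<^esub> inv\<^bsub>G\<^esub> k then x h \<otimes>\<^bsub>R\<^esub> c else \<zero>\<^bsub>R\<^esub>)"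
    using assms * by (auto simp: ga_mult ga_single_def intro!: R.finsum_cong')
  also have "\<dots> = x (g \<otimes>\<^bsub>G\<^esub> inv\<^bsub>G\<^esub> k) \<otimes>\<^bsub>R\<^esub> c"
    using assms by (subst sum_delta) auto
  finally show ?thesis .
qed

lemma ring_group_algebra: "ring RG"
proof (rule ringI)
  show "abelian_group RG"
  proof (rule abelian_groupI)
    fix x assume x: "x \<in> carrier RG"
    have "(\<lambda>g\<in>carrier G. \<ominus>\<^bsub>R\<^esub> x g) \<in> carrier RG" "(\<lambda>g\<in>carrier G. \<ominus>\<^bsub>R\<^esub> x g) \<oplus>\<^bsub>RG\<^esub> x = \<zero>\<^bsub>RG\<^esub>"
      using x by (auto simp: ga_carrier ga_add ga_zero R.l_neg intro!: restrict_ext)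
    then show "\<exists>y\<in>carrier RG. y \<oplus>\<^bsub>RG\<^esub> x = \<zero>\<^bsub>RG\<^esub>" by blast
  qed (auto simp: ga_add ga_zero ga_carrier R.a_ac intro!: restrict_ext ext
       simp: PiE_def extensional_def)
  show "Group.monoid RG"
  proof (rule monoidI)
    show "\<one>\<^bsub>RG\<^esub> \<in> carrier RG" by (simp add: ga_one)
    fix x assume x: "x \<in> carrier RG"
    show "\<one>\<^bsub>RG\<^esub> \<otimes>\<^bsub>RG\<^esub> x = x" "x \<otimes>\<^bsub>RG\<^esub> \<one>\<^bsub>RG\<^esub> = x"
      using x by (auto intro!: ga_eqI simp: ga_one single_mult mult_single)
  qed (auto simp: ga_assoc)
next
  fix x y z assume xyz: "x \<in> carrier RG" "y \<in> carrier RG" "z \<in> carrier RG"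
  note [simp] = ga_coeff[OF xyz(1)] ga_coeff[OF xyz(2)] ga_coeff[OF xyz(3)]
  have add: "x \<oplus>\<^bsub>RG\<^esub> y \<in> carrier RG" if "x \<in> carrier RG" "y \<in> carrier RG" for x y
    using that by (auto simp: ga_carrier ga_add)
  show "(x \<oplus>\<^bsub>RG\<^esub> y) \<otimes>\<^bsub>RG\<^esub> z = x \<otimes>\<^bsub>RG\<^esub> z \<oplus>\<^bsub>RG\<^esub> y \<otimes>\<^bsub>RG\<^esub> z"
  proof (rule ga_eqI)
    fix g assume g: "g \<in> carrier G"
    have "((x \<oplus>\<^bsub>RG\<^esub> y) \<otimes>\<^bsub>RG\<^esub> z) g =
        (\<Oplus>\<^bsub>R\<^esub>h\<in>carrier G. x h \<otimes>\<^bsub>R\<^esub> z (inv\<^bsub>G\<^esub> h \<otimes>\<^bsub>G\<^esub> g) \<oplus>\<^bsub>R\<^esub> y h \<otimes>\<^bsub>R\<^esub> z (inv\<^bsub>G\<^esub> h \<otimes>\<^bsub>G\<^esub> g))"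
      using g by (auto simp: ga_mult ga_add R.l_distr simp del: R.add.finprod_multf R.finsum_addf
          intro!: R.finsum_cong')
    also have "\<dots> = (x \<otimes>\<^bsub>RG\<^esub> z \<oplus>\<^bsub>RG\<^esub> y \<otimes>\<^bsub>RG\<^esub> z) g"
      using g by (simp add: ga_mult ga_add Pi_def)
    finally show "((x \<oplus>\<^bsub>RG\<^esub> y) \<otimes>\<^bsub>RG\<^esub> z) g = (x \<otimes>\<^bsub>RG\<^esub> z \<oplus>\<^bsub>RG\<^esub> y \<otimes>\<^bsub>RG\<^esub> z) g" .
  qed (use xyz add in auto)
  show "z \<otimes>\<^bsub>RG\<^esub> (x \<oplus>\<^bsub>RG\<^esub> y) = z \<otimes>\<^bsub>RG\<^esub> x \<oplus>\<^bsub>RG\<^esub> z \<otimes>\<^bsub>RG\<^esub> y"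
  proof (rule ga_eqI)
    fix g assume g: "g \<in> carrier G"
    have "(z \<otimes>\<^bsub>RG\<^esub> (x \<oplus>\<^bsub>RG\<^esub> y)) g =
        (\<Oplus>\<^bsub>R\<^esub>h\<in>carrier G. z h \<otimes>\<^bsub>R\<^esub> x (inv\<^bsub>G\<^esub> h \<otimes>\<^bsub>G\<^esub> g) \<oplus>\<^bsub>R\<^esub> z h \<otimes>\<^bsub>R\<^esub> y (inv\<^bsub>G\<^esub> h \<otimes>\<^bsub>G\<^esub> g))"
      using g by (auto simp: ga_mult ga_add R.r_distr simp del: R.add.finprod_multf R.finsum_addf
          intro!: R.finsum_cong')
    also have "\<dots> = (z \<otimes>\<^bsub>RG\<^esub> x \<oplus>\<^bsub>RG\<^esub> z \<otimes>\<^bsub>RG\<^esub> y) g"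
      using g by (simp add: ga_mult ga_add Pi_def)
    finally show "(z \<otimes>\<^bsub>RG\<^esub> (x \<oplus>\<^bsub>RG\<^esub> y)) g = (z \<otimes>\<^bsub>RG\<^esub> x \<oplus>\<^bsub>RG\<^esub> z \<otimes>\<^bsub>RG\<^esub> y) g" .
  qed (use xyz add in auto)
qed

sublocale A: ring RG by (rule ring_group_algebra)

lemma add_coeff [simp]: "g \<in> carrier G \<Longrightarrow> (x \<oplus>\<^bsub>RG\<^esub> y) g = x g \<oplus>\<^bsub>R\<^esub> y g"
  by (simp add: ga_add)

lemma zero_coeff [simp]: "g \<in> carrier G \<Longrightarrow> \<zero>\<^bsub>RG\<^esub> g = \<zero>\<^bsub>R\<^esub>"
  by (simp add: ga_zero)

lemma minus_coeff [simp]: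
  assumes "x \<in> carrier RG" "g \<in> carrier G" shows "(\<ominus>\<^bsub>RG\<^esub> x) g = \<ominus>\<^bsub>R\<^esub> x g"
proof -
  have "(\<ominus>\<^bsub>RG\<^esub> x \<oplus>\<^bsub>RG\<^esub> x) g = \<zero>\<^bsub>R\<^esub>"
    using A.l_neg[OF assms(1)] assms by simp
  then show ?thesis using assms by (simp add: R.minus_equality)
qed

lemma finsum_coeff:
  "\<lbrakk>finite I; f \<in> I \<rightarrow> carrier RG; g \<in> carrier G\<rbrakk> \<Longrightarrow> (\<Oplus>\<^bsub>RG\<^esub>i\<in>I. f i) g = (\<Oplus>\<^bsub>R\<^esub>i\<in>I. f i g)"
proof (induction I rule: finite_induct)
  case (insert i I)
  then show ?case
    by (simp add: Pi_iff A.finsum_insert R.finsum_insert)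
qed simp

lemma single_coeff: "g \<in> carrier G \<Longrightarrow> ga_single R G c k g = (if g = k then c else \<zero>\<^bsub>R\<^esub>)"
  by (simp add: ga_single_def)

lemma single_mult_single:
  assumes "c \<in> carrier R" "d \<in> carrier R" "g \<in> carrier G" "h \<in> carrier G"
  shows "ga_single R G c g \<otimes>\<^bsub>RG\<^esub> ga_single R G d h = ga_single R G (c \<otimes>\<^bsub>R\<^esub> d) (g \<otimes>\<^bsub>G\<^esub> h)"
proof (rule ga_eqI)
  fix x assume x: "x \<in> carrier G"
  then have "inv\<^bsub>G\<^esub> g \<otimes>\<^bsub>G\<^esub> x = h \<longleftrightarrow> x = g \<otimes>\<^bsub>G\<^esub> h" using assms by (metis G.inv_solve_left)
  then show "(ga_single R G c g \<otimes>\<^bsub>RG\<^esub> ga_single R G d h) x = ga_single R G (c \<otimes>\<^bsub>R\<^esub> d) (g \<otimes>\<^bsub>G\<^esub> h) x"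
    using x assms by (simp add: single_mult single_coeff)
qed (use assms in auto)

lemma ga_expand:
  assumes "x \<in> carrier RG" shows "x = (\<Oplus>\<^bsub>RG\<^esub>g\<in>carrier G. ga_single R G (x g) g)"
proof (rule ga_eqI)
  fix h assume h: "h \<in> carrier G"
  have "(\<Oplus>\<^bsub>RG\<^esub>g\<in>carrier G. ga_single R G (x g) g) h = (\<Oplus>\<^bsub>R\<^esub>g\<in>carrier G. if g = h then x g else \<zero>\<^bsub>R\<^esub>)"
    using h assms finite_carrier by (auto simp: finsum_coeff single_coeff intro!: R.finsum_cong')
  also have "\<dots> = x h" using h assms by (intro sum_delta) auto
  finally show "x h = (\<Oplus>\<^bsub>RG\<^esub>g\<in>carrier G. ga_single R G (x g) g) h" by simp
qed (use assms in \<open>auto intro!: A.finsum_closed\<close>)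

definition augmentation :: "('g \<Rightarrow> 'k) \<Rightarrow> 'k"
  where "augmentation x = (\<Oplus>\<^bsub>R\<^esub>g\<in>carrier G. x g)"

lemma augmentation_closed [simp]: "x \<in> carrier RG \<Longrightarrow> augmentation x \<in> carrier R"
  by (auto simp: augmentation_def intro!: R.finsum_closed)

lemma augmentation_add:
  "x \<in> carrier RG \<Longrightarrow> y \<in> carrier RG \<Longrightarrow>
    augmentation (x \<oplus>\<^bsub>RG\<^esub> y) = augmentation x \<oplus>\<^bsub>R\<^esub> augmentation y"
proof -
  assume xy: "x \<in> carrier RG" "y \<in> carrier RG"
  then have "augmentation (x \<oplus>\<^bsub>RG\<^esub> y) = (\<Oplus>\<^bsub>R\<^esub>g\<in>carrier G. x g \<oplus>\<^bsub>R\<^esub> y g)"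
    unfolding augmentation_def by (intro R.finsum_cong') auto
  also have "\<dots> = augmentation x \<oplus>\<^bsub>R\<^esub> augmentation y"
    unfolding augmentation_def using xy by (intro R.finsum_addf) auto
  finally show ?thesis .
qed

lemma augmentation_one: "augmentation \<one>\<^bsub>RG\<^esub> = \<one>\<^bsub>R\<^esub>"
proof -
  have "augmentation \<one>\<^bsub>RG\<^esub> = (\<Oplus>\<^bsub>R\<^esub>g\<in>carrier G. if g = \<one>\<^bsub>G\<^esub> then \<one>\<^bsub>R\<^esub> else \<zero>\<^bsub>R\<^esub>)"
    unfolding augmentation_def by (auto simp: ga_one single_coeff intro!: R.finsum_cong')
  then show ?thesis by (simp add: sum_delta)
qed

lemma augmentation_mult:
  assumes "x \<in> carrier RG" "y \<in> carrier RG"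
  shows "augmentation (x \<otimes>\<^bsub>RG\<^esub> y) = augmentation x \<otimes>\<^bsub>R\<^esub> augmentation y"
proof -
  note [simp] = ga_coeff[OF assms(1)] ga_coeff[OF assms(2)]
  have "augmentation (x \<otimes>\<^bsub>RG\<^esub> y) =
      (\<Oplus>\<^bsub>R\<^esub>g\<in>carrier G. \<Oplus>\<^bsub>R\<^esub>h\<in>carrier G. x h \<otimes>\<^bsub>R\<^esub> y (inv\<^bsub>G\<^esub> h \<otimes>\<^bsub>G\<^esub> g))"
    unfolding augmentation_def by (auto simp: ga_mult intro!: R.finsum_cong')
  also have "\<dots> = (\<Oplus>\<^bsub>R\<^esub>h\<in>carrier G. \<Oplus>\<^bsub>R\<^esub>g\<in>carrier G. x h \<otimes>\<^bsub>R\<^esub> y (inv\<^bsub>G\<^esub> h \<otimes>\<^bsub>G\<^esub> g))"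
    using finite_carrier by (intro R.finsum_swap) auto
  also have "\<dots> = (\<Oplus>\<^bsub>R\<^esub>h\<in>carrier G. \<Oplus>\<^bsub>R\<^esub>g\<in>carrier G. x h \<otimes>\<^bsub>R\<^esub> y g)"
  proof (rule R.finsum_cong'[OF refl])
    fix h assume "h \<in> carrier G"
    then show "(\<Oplus>\<^bsub>R\<^esub>g\<in>carrier G. x h \<otimes>\<^bsub>R\<^esub> y (inv\<^bsub>G\<^esub> h \<otimes>\<^bsub>G\<^esub> g)) = (\<Oplus>\<^bsub>R\<^esub>g\<in>carrier G. x h \<otimes>\<^bsub>R\<^esub> y g)"
      by (intro sum_translate(1)) auto
  qed auto
  also have "\<dots> = augmentation x \<otimes>\<^bsub>R\<^esub> augmentation y"
    unfolding augmentation_def using finite_carrier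
    by (subst R.finsum_ldistr) (auto simp: R.finsum_rdistr intro!: R.finsum_cong')
  finally show ?thesis .
qed

lemma autoE:
  assumes "\<psi> \<in> auto G"
  shows "bij_betw \<psi> (carrier G) (carrier G)" "\<psi> \<in> hom G G" "\<psi> \<in> extensional (carrier G)"
  using assms by (auto simp: auto_def Bij_def)

lemma extend_coeff:
  assumes "\<psi> \<in> auto G" "g \<in> carrier G"
  shows "ga_extend G \<psi> x (\<psi> g) = x g"
  using assms autoE[OF assms(1)]
  by (auto simp: ga_extend_def bij_betw_def hom_def Pi_iff)

lemma extend_closed [simp]:
  assumes "\<psi> \<in> auto G" "x \<in> carrier RG" shows "ga_extend G \<psi> x \<in> carrier RG"
  using assms autoE(1)[OF assms(1)]
  by (auto simp: ga_extend_def ga_carrier bij_betw_def inv_into_into)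

lemma ga_eqI_auto:
  assumes "\<psi> \<in> auto G" "x \<in> carrier RG" "y \<in> carrier RG"
    "\<And>g. g \<in> carrier G \<Longrightarrow> x (\<psi> g) = y (\<psi> g)"
  shows "x = y"
proof (rule ga_eqI[OF assms(2,3)])
  fix g assume "g \<in> carrier G"
  then obtain h where "h \<in> carrier G" "g = \<psi> h"
    using autoE(1)[OF assms(1)] by (auto simp: bij_betw_def)
  then show "x g = y g" using assms(4) by simp
qed

lemma extend_mult:
  assumes "\<psi> \<in> auto G" "x \<in> carrier RG" "y \<in> carrier RG"
  shows "ga_extend G \<psi> (x \<otimes>\<^bsub>RG\<^esub> y) = ga_extend G \<psi> x \<otimes>\<^bsub>RG\<^esub> ga_extend G \<psi> y"
proof (rule ga_eqI_auto[OF assms(1)])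
  note \<psi> = autoE[OF assms(1)]
  interpret \<psi>: group_hom G G \<psi> using \<psi>(2) by unfold_locales
  fix g assume g: "g \<in> carrier G"
  have "(ga_extend G \<psi> x \<otimes>\<^bsub>RG\<^esub> ga_extend G \<psi> y) (\<psi> g) =
      (\<Oplus>\<^bsub>R\<^esub>h\<in>carrier G. ga_extend G \<psi> x h \<otimes>\<^bsub>R\<^esub> ga_extend G \<psi> y (inv\<^bsub>G\<^esub> h \<otimes>\<^bsub>G\<^esub> \<psi> g))"
    using g by (simp add: ga_mult)
  also have "\<dots> = (\<Oplus>\<^bsub>R\<^esub>h\<in>carrier G. ga_extend G \<psi> x (\<psi> h) \<otimes>\<^bsub>R\<^esub> ga_extend G \<psi> y (inv\<^bsub>G\<^esub> (\<psi> h) \<otimes>\<^bsub>G\<^esub> \<psi> g))"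
    using assms g by (subst R.finsum_reindex_bij_betw[OF \<psi>(1), symmetric]) auto
  also have "\<dots> = (\<Oplus>\<^bsub>R\<^esub>h\<in>carrier G. x h \<otimes>\<^bsub>R\<^esub> y (inv\<^bsub>G\<^esub> h \<otimes>\<^bsub>G\<^esub> g))"
    using assms g by (intro R.finsum_cong')
      (auto simp: extend_coeff \<psi>.hom_inv[symmetric] \<psi>.hom_mult[symmetric] simp del: \<psi>.hom_inv \<psi>.hom_mult)
  also have "\<dots> = ga_extend G \<psi> (x \<otimes>\<^bsub>RG\<^esub> y) (\<psi> g)"
    using assms g by (simp add: extend_coeff) (simp add: ga_mult)
  finally show "ga_extend G \<psi> (x \<otimes>\<^bsub>RG\<^esub> y) (\<psi> g) = (ga_extend G \<psi> x \<otimes>\<^bsub>RG\<^esub> ga_extend G \<psi> y) (\<psi> g)" ..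
qed (use assms in auto)

lemma extend_add:
  assumes "\<psi> \<in> auto G" "x \<in> carrier RG" "y \<in> carrier RG"
  shows "ga_extend G \<psi> (x \<oplus>\<^bsub>RG\<^esub> y) = ga_extend G \<psi> x \<oplus>\<^bsub>RG\<^esub> ga_extend G \<psi> y"
  using assms autoE(2)[OF assms(1)]
  by (intro ga_eqI_auto[OF assms(1)]) (auto simp: extend_coeff hom_def Pi_iff)

lemma extend_single:
  assumes "\<psi> \<in> auto G" "c \<in> carrier R" "g \<in> carrier G"
  shows "ga_extend G \<psi> (ga_single R G c g) = ga_single R G c (\<psi> g)"
proof -
  have "\<psi> h = \<psi> g \<longleftrightarrow> h = g" "\<psi> h \<in> carrier G" if "h \<in> carrier G" for h
    using that assms autoE(1)[OF assms(1)] by (auto simp: bij_betw_def inj_on_def)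
  then show ?thesis
    using assms by (intro ga_eqI_auto[OF assms(1)]) (auto simp: extend_coeff single_coeff)
qed

lemma extend_one: "\<psi> \<in> auto G \<Longrightarrow> ga_extend G \<psi> \<one>\<^bsub>RG\<^esub> = \<one>\<^bsub>RG\<^esub>"
  using extend_single[of \<psi> "\<one>\<^bsub>R\<^esub>" "\<one>\<^bsub>G\<^esub>"]
    hom_one[of \<psi> G G, OF autoE(2) G.is_group G.is_group]
  by (simp add: ga_one)

lemma scalar_central:
  assumes "c \<in> carrier R" "x \<in> carrier RG"
  shows "ga_single R G c \<one>\<^bsub>G\<^esub> \<otimes>\<^bsub>RG\<^esub> x = x \<otimes>\<^bsub>RG\<^esub> ga_single R G c \<one>\<^bsub>G\<^esub>"
  using assms by (intro ga_eqI) (auto simp: single_mult mult_single R.m_comm)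

end

section \<open>Tensor products\<close>

lemma free_Abelian_group_carrier_induct [consumes 1, case_names zero diff generator]:
  assumes "z \<in> carrier (free_Abelian_group S)" and "Q 0"
    and "\<And>x y. \<lbrakk>x \<in> carrier (free_Abelian_group S); y \<in> carrier (free_Abelian_group S); Q x; Q y\<rbrakk> \<Longrightarrow> Q (x - y)"
    and "\<And>a. a \<in> S \<Longrightarrow> Q (frag_of a)"
  shows "Q z"
  using assms by (auto intro: free_Abelian_group_induct[of z S Q])

lemma diff_in_free_Abelian_group [simp]:
  "\<lbrakk>x \<in> carrier (free_Abelian_group S); y \<in> carrier (free_Abelian_group S)\<rbrakk>
    \<Longrightarrow> x - y \<in> carrier (free_Abelian_group S)"
  using keys_diff[of x y] by auto

lemma hom_diff_free_Abelian_group: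
  assumes "group H" "f \<in> hom (free_Abelian_group S) H"
    "a \<in> carrier (free_Abelian_group S)" "b \<in> carrier (free_Abelian_group S)"
  shows "f (a - b) = f a \<otimes>\<^bsub>H\<^esub> inv\<^bsub>H\<^esub> (f b)"
proof -
  interpret f: group_hom "free_Abelian_group S" H f
    using assms by (intro group_hom.intro group_hom_axioms.intro) auto
  have "f (a - b) = f (a \<otimes>\<^bsub>free_Abelian_group S\<^esub> inv\<^bsub>free_Abelian_group S\<^esub> b)"
    using assms by simp
  also have "\<dots> = f a \<otimes>\<^bsub>H\<^esub> inv\<^bsub>H\<^esub> (f b)"
    using assms(3,4) by (simp only: f.hom_mult f.hom_inv f.G.inv_closed)
  finally show ?thesis .
qed

lemma hom_eq_on_free_Abelian_group:
  assumes "group H" "f \<in> hom (free_Abelian_group S) H" "f' \<in> hom (free_Abelian_group S) H"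
    "\<And>a. a \<in> S \<Longrightarrow> f (frag_of a) = f' (frag_of a)" "z \<in> carrier (free_Abelian_group S)"
  shows "f z = f' z"
  using assms(5)
proof (induction z rule: free_Abelian_group_carrier_induct)
  case zero
  then show ?case
    using hom_one[OF assms(2) group_free_Abelian_group assms(1)]
      hom_one[OF assms(3) group_free_Abelian_group assms(1)] by simp
next
  case (diff x y)
  then show ?case
    using hom_diff_free_Abelian_group[OF assms(1,2)] hom_diff_free_Abelian_group[OF assms(1,3)] by simp
qed (use assms in simp)

lemma (in comm_group) eq_mult_of_diff_one:
  assumes "x \<in> carrier G" "y \<in> carrier G" "z \<in> carrier G" "x \<otimes> inv y \<otimes> inv z = \<one>"
  shows "x = y \<otimes> z"
proof -
  have "x \<otimes> inv (y \<otimes> z) = \<one>" using assms by (simp add: inv_mult m_assoc)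
  then show ?thesis using assms inv_equality[of x "inv (y \<otimes> z)"] by simp
qed

lemma (in comm_group) eq_of_diff_one:
  assumes "x \<in> carrier G" "y \<in> carrier G" "x \<otimes> inv y = \<one>"
  shows "x = y"
  using assms inv_equality[of x "inv y"] by simp

locale tensor_factors =
  fixes B :: "('b, 's) ring_scheme" and M :: "('a, 'b, 'm, 'y) bimod_scheme"
    and N :: "('b, 'n, 'z) lmod_scheme"
  assumes M: "comm_group M" and N: "comm_group N"
    and ract_closed: "\<lbrakk>m \<in> carrier M; b \<in> carrier B\<rbrakk> \<Longrightarrow> ract M m b \<in> carrier M"
    and lact_closed: "\<lbrakk>n \<in> carrier N; b \<in> carrier B\<rbrakk> \<Longrightarrow> lact N b n \<in> carrier N"
begin

sublocale M: comm_group M by (rule M)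
sublocale N: comm_group N by (rule N)

abbreviation Free :: "('m \<times> 'n \<Rightarrow>\<^sub>0 int) monoid"
  where "Free \<equiv> free_Abelian_group (carrier M \<times> carrier N)"

abbreviation Rel :: "('m \<times> 'n \<Rightarrow>\<^sub>0 int) set"
  where "Rel \<equiv> tensor_relations B M N"

abbreviation T :: "('m \<times> 'n \<Rightarrow>\<^sub>0 int) set monoid"
  where "T \<equiv> tensor_group B M N"

sublocale F: comm_group Free by (rule abelian_free_Abelian_group)

definition relators :: "('m \<times> 'n \<Rightarrow>\<^sub>0 int) set"
  where "relators =
     {frag_of (m \<otimes>\<^bsub>M\<^esub> m', n) - frag_of (m, n) - frag_of (m', n) | m m' n.
         m \<in> carrier M \<and> m' \<in> carrier M \<and> n \<in> carrier N} \<union>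
      {frag_of (m, n \<otimes>\<^bsub>N\<^esub> n') - frag_of (m, n) - frag_of (m, n') | m n n'.
         m \<in> carrier M \<and> n \<in> carrier N \<and> n' \<in> carrier N} \<union>
      {frag_of (ract M m b, n) - frag_of (m, lact N b n) | m b n.
         m \<in> carrier M \<and> b \<in> carrier B \<and> n \<in> carrier N}"

declare carrier_free_Abelian_group_iff [simp del]

lemma relators_closed: "relators \<subseteq> carrier Free"
  unfolding relators_def by (auto simp: ract_closed lact_closed)

lemma Rel_eq: "Rel = generate Free relators"
  unfolding tensor_relations_def relators_def ..

lemma subgroup_Rel: "subgroup Rel Free"
  unfolding Rel_eq by (rule F.generate_is_subgroup[OF relators_closed])

lemma normal_Rel: "Rel \<lhd> Free"
  by (rule F.subgroup_imp_normal[OF subgroup_Rel])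

sublocale T: comm_group T
  unfolding tensor_group_def by (rule F.abelian_FactGroup[OF subgroup_Rel])

abbreviation coset :: "('m \<times> 'n \<Rightarrow>\<^sub>0 int) \<Rightarrow> ('m \<times> 'n \<Rightarrow>\<^sub>0 int) set"
  where "coset z \<equiv> r_coset Free Rel z"

lemma coset_hom: "coset \<in> hom Free T"
  unfolding tensor_group_def by (rule normal.r_coset_hom_Mod[OF normal_Rel])

lemma tensor_carrier: "carrier T = coset ` carrier Free"
  unfolding tensor_group_def by (rule carrier_FactGroup)

definition pure :: "'m \<Rightarrow> 'n \<Rightarrow> ('m \<times> 'n \<Rightarrow>\<^sub>0 int) set"
  where "pure m n = coset (frag_of (m, n))"

lemma pure_closed [simp]: "m \<in> carrier M \<Longrightarrow> n \<in> carrier N \<Longrightarrow> pure m n \<in> carrier T"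
  by (simp add: pure_def tensor_carrier)

lemma coset_relator: "z \<in> relators \<Longrightarrow> coset z = \<one>\<^bsub>T\<^esub>"
  using F.coset_join2[OF _ subgroup_Rel, of z] relators_closed generate.incl[of z relators Free]
  by (auto simp: Rel_eq tensor_group_def)

lemma pure_add_left:
  assumes "m \<in> carrier M" "m' \<in> carrier M" "n \<in> carrier N"
  shows "pure (m \<otimes>\<^bsub>M\<^esub> m') n = pure m n \<otimes>\<^bsub>T\<^esub> pure m' n"
proof -
  let ?z = "frag_of (m \<otimes>\<^bsub>M\<^esub> m', n) - frag_of (m, n) - frag_of (m', n)"
  have "coset ?z = \<one>\<^bsub>T\<^esub>" using assms by (intro coset_relator) (auto simp: relators_def)
  moreover have "coset ?z = pure (m \<otimes>\<^bsub>M\<^esub> m') n \<otimes>\<^bsub>T\<^esub> inv\<^bsub>T\<^esub> pure m n \<otimes>\<^bsub>T\<^esub> inv\<^bsub>T\<^esub> pure m' n"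
    using assms unfolding pure_def
    by (simp add: hom_diff_free_Abelian_group[OF T.is_group coset_hom])
  ultimately show ?thesis using assms by (intro T.eq_mult_of_diff_one) auto
qed

lemma pure_add_right:
  assumes "m \<in> carrier M" "n \<in> carrier N" "n' \<in> carrier N"
  shows "pure m (n \<otimes>\<^bsub>N\<^esub> n') = pure m n \<otimes>\<^bsub>T\<^esub> pure m n'"
proof -
  let ?z = "frag_of (m, n \<otimes>\<^bsub>N\<^esub> n') - frag_of (m, n) - frag_of (m, n')"
  have "coset ?z = \<one>\<^bsub>T\<^esub>" using assms by (intro coset_relator) (auto simp: relators_def)
  moreover have "coset ?z = pure m (n \<otimes>\<^bsub>N\<^esub> n') \<otimes>\<^bsub>T\<^esub> inv\<^bsub>T\<^esub> pure m n \<otimes>\<^bsub>T\<^esub> inv\<^bsub>T\<^esub> pure m n'"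
    using assms unfolding pure_def
    by (simp add: hom_diff_free_Abelian_group[OF T.is_group coset_hom])
  ultimately show ?thesis using assms by (intro T.eq_mult_of_diff_one) auto
qed

lemma pure_balanced:
  assumes "m \<in> carrier M" "b \<in> carrier B" "n \<in> carrier N"
  shows "pure (ract M m b) n = pure m (lact N b n)"
proof -
  let ?z = "frag_of (ract M m b, n) - frag_of (m, lact N b n)"
  have "coset ?z = \<one>\<^bsub>T\<^esub>" using assms by (intro coset_relator) (auto simp: relators_def)
  moreover have "coset ?z = pure (ract M m b) n \<otimes>\<^bsub>T\<^esub> inv\<^bsub>T\<^esub> pure m (lact N b n)"
    using assms unfolding pure_def
    by (simp add: hom_diff_free_Abelian_group[OF T.is_group coset_hom] ract_closed lact_closed)
  ultimately have "pure (ract M m b) n \<otimes>\<^bsub>T\<^esub> inv\<^bsub>T\<^esub> pure m (lact N b n) = \<one>\<^bsub>T\<^esub>" by simp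
  then show ?thesis
    by (rule T.eq_of_diff_one[rotated 2]) (use assms in \<open>simp_all add: ract_closed lact_closed\<close>)
qed

lemma tensor_hom_eq:
  assumes "group H" "f \<in> hom T H" "f' \<in> hom T H"
    "\<And>m n. m \<in> carrier M \<Longrightarrow> n \<in> carrier N \<Longrightarrow> f (pure m n) = f' (pure m n)"
    "U \<in> carrier T"
  shows "f U = f' U"
proof -
  obtain z where z: "z \<in> carrier Free" "U = coset z" using assms(5) tensor_carrier by auto
  have "(f \<circ> coset) z = (f' \<circ> coset) z"
  proof (rule hom_eq_on_free_Abelian_group[OF assms(1) _ _ _ z(1)])
    show "f \<circ> coset \<in> hom Free H" by (rule Group.hom_compose[OF coset_hom assms(2)])
    show "f' \<circ> coset \<in> hom Free H" by (rule Group.hom_compose[OF coset_hom assms(3)])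
  qed (use assms(4) in \<open>auto simp: pure_def\<close>)
  then show ?thesis using z by simp
qed

text \<open>A biadditive balanced map extends to the free abelian group and kills the relators.\<close>

lemma tensor_universal:
  assumes P: "comm_group P"
    and closed: "\<And>m n. \<lbrakk>m \<in> carrier M; n \<in> carrier N\<rbrakk> \<Longrightarrow> \<beta> m n \<in> carrier P"
    and add_left: "\<And>m m' n. \<lbrakk>m \<in> carrier M; m' \<in> carrier M; n \<in> carrier N\<rbrakk> \<Longrightarrow>
      \<beta> (m \<otimes>\<^bsub>M\<^esub> m') n = \<beta> m n \<otimes>\<^bsub>P\<^esub> \<beta> m' n"
    and add_right: "\<And>m n n'. \<lbrakk>m \<in> carrier M; n \<in> carrier N; n' \<in> carrier N\<rbrakk> \<Longrightarrow>
      \<beta> m (n \<otimes>\<^bsub>N\<^esub> n') = \<beta> m n \<otimes>\<^bsub>P\<^esub> \<beta> m n'"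
    and balanced: "\<And>m b n. \<lbrakk>m \<in> carrier M; b \<in> carrier B; n \<in> carrier N\<rbrakk> \<Longrightarrow>
      \<beta> (ract M m b) n = \<beta> m (lact N b n)"
  obtains f where "f \<in> hom T P" "\<And>m n. \<lbrakk>m \<in> carrier M; n \<in> carrier N\<rbrakk> \<Longrightarrow> f (pure m n) = \<beta> m n"
proof -
  interpret P: comm_group P by (rule P)
  obtain h where h: "h \<in> hom Free P"
    and h_of: "\<And>x. x \<in> carrier M \<times> carrier N \<Longrightarrow> h (frag_of x) = (\<lambda>(m, n). \<beta> m n) x"
    using P.free_Abelian_group_universal[of "\<lambda>(m, n). \<beta> m n" "carrier M \<times> carrier N"] closed
    by (auto simp: image_subset_iff)
  have diff: "h (a - b) = h a \<otimes>\<^bsub>P\<^esub> inv\<^bsub>P\<^esub> (h b)" if "a \<in> carrier Free" "b \<in> carrier Free" for a b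
    using hom_diff_free_Abelian_group[OF P.is_group h] that by simp
  interpret h: group_hom Free P h using h by unfold_locales
  have cancel: "x \<otimes>\<^bsub>P\<^esub> y \<otimes>\<^bsub>P\<^esub> inv\<^bsub>P\<^esub> x \<otimes>\<^bsub>P\<^esub> inv\<^bsub>P\<^esub> y = \<one>\<^bsub>P\<^esub>"
    if "x \<in> carrier P" "y \<in> carrier P" for x y
  proof -
    have "x \<otimes>\<^bsub>P\<^esub> y \<otimes>\<^bsub>P\<^esub> inv\<^bsub>P\<^esub> x \<otimes>\<^bsub>P\<^esub> inv\<^bsub>P\<^esub> y = (x \<otimes>\<^bsub>P\<^esub> y) \<otimes>\<^bsub>P\<^esub> inv\<^bsub>P\<^esub> (x \<otimes>\<^bsub>P\<^esub> y)"
      using that by (simp add: P.inv_mult P.m_assoc)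
    then show ?thesis using that by simp
  qed
  have rel1: "h (frag_of (m \<otimes>\<^bsub>M\<^esub> m', n) - frag_of (m, n) - frag_of (m', n)) = \<one>\<^bsub>P\<^esub>"
    if "m \<in> carrier M" "m' \<in> carrier M" "n \<in> carrier N" for m m' n
    using that by (simp add: diff h_of add_left closed cancel)
  have rel2: "h (frag_of (m, n \<otimes>\<^bsub>N\<^esub> n') - frag_of (m, n) - frag_of (m, n')) = \<one>\<^bsub>P\<^esub>"
    if "m \<in> carrier M" "n \<in> carrier N" "n' \<in> carrier N" for m n n'
    using that by (simp add: diff h_of add_right closed cancel)
  have rel3: "h (frag_of (ract M m b, n) - frag_of (m, lact N b n)) = \<one>\<^bsub>P\<^esub>"
    if "m \<in> carrier M" "b \<in> carrier B" "n \<in> carrier N" for m b n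
    using that by (simp add: diff h_of balanced closed ract_closed lact_closed)
  have "h z = \<one>\<^bsub>P\<^esub>" if "z \<in> relators" for z
    using that unfolding relators_def by (auto simp: rel1 rel2 rel3)
  then have "relators \<subseteq> kernel Free P h" using relators_closed by (auto simp: kernel_def)
  then have "Rel \<subseteq> kernel Free P h"
    unfolding Rel_eq by (rule F.generate_subgroup_incl[OF _ h.subgroup_kernel])
  then obtain f where f: "f \<in> hom (Free Mod Rel) P" "\<And>x. x \<in> carrier Free \<Longrightarrow> f (coset x) = h x"
    using h.FactGroup_universal_kernel[OF normal_Rel] by metis
  then show thesis
    by (intro that[of f]) (auto simp: tensor_group_def pure_def h_of)
qed

text \<open>The coset-wise definition of \<^const>\<open>tensor_map\<close> agrees with the homomorphism that the
  universal property yields.\<close>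

lemma tensor_map_hom:
  assumes f: "f \<in> hom M M" and g: "g \<in> hom N N"
    and f_ract: "\<And>m b. \<lbrakk>m \<in> carrier M; b \<in> carrier B\<rbrakk> \<Longrightarrow> f (ract M m b) = ract M (f m) b"
    and g_lact: "\<And>n b. \<lbrakk>n \<in> carrier N; b \<in> carrier B\<rbrakk> \<Longrightarrow> g (lact N b n) = lact N b (g n)"
  shows "tensor_map B M N f g \<in> hom T T"
    "\<And>m n. \<lbrakk>m \<in> carrier M; n \<in> carrier N\<rbrakk> \<Longrightarrow> tensor_map B M N f g (pure m n) = pure (f m) (g n)"
proof -
  have fg: "f m \<in> carrier M" "g n \<in> carrier N" if "m \<in> carrier M" "n \<in> carrier N" for m n
    using f g that by (auto simp: hom_def)
  obtain H where H: "H \<in> hom T T"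
    and H_pure: "\<And>m n. \<lbrakk>m \<in> carrier M; n \<in> carrier N\<rbrakk> \<Longrightarrow> H (pure m n) = pure (f m) (g n)"
  proof (rule tensor_universal[OF T.comm_group_axioms, of "\<lambda>m n. pure (f m) (g n)"])
    fix m b n assume "m \<in> carrier M" "b \<in> carrier B" "n \<in> carrier N"
    then show "pure (f (ract M m b)) (g n) = pure (f m) (g (lact N b n))"
      using fg by (simp add: f_ract g_lact pure_balanced)
  qed (use fg f g in \<open>auto simp: hom_mult pure_add_left pure_add_right\<close>)
  define E where "E = frag_extend (\<lambda>(m, n). frag_of (f m, g n))"
  have E: "E z \<in> carrier Free \<and> coset (E z) = H (coset z)" if "z \<in> carrier Free" for z
    using that
  proof (induction z rule: free_Abelian_group_carrier_induct)
    case zero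
    then show ?case
      using hom_one[OF coset_hom F.is_group T.is_group] hom_one[OF H T.is_group T.is_group] F.one_closed
      by (simp add: E_def)
  next
    case (diff x y)
    have cl: "coset x \<in> carrier T" "coset y \<in> carrier T"
      using diff by (auto simp: tensor_carrier)
    interpret H: group_hom T T H using H by unfold_locales
    have "E (x - y) = E x - E y" by (simp add: E_def frag_extend_diff)
    moreover have "coset (E x - E y) = coset (E x) \<otimes>\<^bsub>T\<^esub> inv\<^bsub>T\<^esub> coset (E y)"
      "coset (x - y) = coset x \<otimes>\<^bsub>T\<^esub> inv\<^bsub>T\<^esub> coset y"
      using diff by (simp_all add: hom_diff_free_Abelian_group[OF T.is_group coset_hom])
    ultimately show ?case using diff cl by (simp)
  next
    case (generator a)
    then show ?case using H_pure fg by (auto simp: E_def pure_def)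
  qed
  have eq: "tensor_map B M N f g U = H U" if U: "U \<in> carrier T" for U
  proof -
    obtain z where z: "z \<in> carrier Free" "U = coset z" using U tensor_carrier by auto
    have sub: "U \<subseteq> carrier Free"
      using z F.r_coset_subset_G[OF subgroup.subset[OF subgroup_Rel]] by simp
    have "coset (E y) = H U" if y: "y \<in> U" for y
    proof -
      have "coset z = coset y" using y z by (intro F.repr_independence[OF _ z(1) subgroup_Rel]) simp
      moreover have "y \<in> carrier Free" using y sub by blast
      ultimately show ?thesis using E[of y] z(2) by simp
    qed
    moreover have "z \<in> U" using F.rcos_self[OF z(1) subgroup_Rel] z by simp
    ultimately have "U \<noteq> {}" "(\<Union>y\<in>U. coset (E y)) = (\<Union>y\<in>U. H U)" by (blast, simp only: cong: SUP_cong)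
    then show ?thesis unfolding tensor_map_def E_def[symmetric] by simp
  qed
  show "tensor_map B M N f g \<in> hom T T"
  proof (rule homI)
    fix U V assume UV: "U \<in> carrier T" "V \<in> carrier T"
    show "tensor_map B M N f g U \<in> carrier T" using hom_in_carrier[OF H UV(1)] UV by (simp add: eq)
    show "tensor_map B M N f g (U \<otimes>\<^bsub>T\<^esub> V) = tensor_map B M N f g U \<otimes>\<^bsub>T\<^esub> tensor_map B M N f g V"
      using hom_mult[OF H UV] UV by (simp add: eq)
  qed
  show "tensor_map B M N f g (pure m n) = pure (f m) (g n)" if "m \<in> carrier M" "n \<in> carrier N" for m n
    using that by (simp add: eq H_pure)
qed

text \<open>By uniqueness of homomorphisms out of \<open>T\<close>, a left inverse has to be checked on pure tensors
  only.\<close>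

lemma tensor_iso:
  assumes P: "comm_group P" and f: "f \<in> hom T P" and \<theta>: "\<theta> \<in> hom P T"
    and left_inverse: "\<And>m n. \<lbrakk>m \<in> carrier M; n \<in> carrier N\<rbrakk> \<Longrightarrow> \<theta> (f (pure m n)) = pure m n"
    and right_inverse: "\<And>x. x \<in> carrier P \<Longrightarrow> f (\<theta> x) = x"
  shows "f \<in> iso T P"
proof -
  have "\<theta> (f U) = U" if "U \<in> carrier T" for U
  proof -
    have "id \<in> hom T T" by (rule homI) simp_all
    then have "(\<theta> \<circ> f) U = id U"
      by (rule tensor_hom_eq[OF T.is_group Group.hom_compose[OF f \<theta>] _ _ that]) (simp_all add: left_inverse)
    then show ?thesis by simp
  qed
  then have "bij_betw f (carrier T) (carrier P)"
    using f \<theta> right_inverse by (intro bij_betw_byWitness[where f' = \<theta>]) (auto simp: hom_def)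
  then show ?thesis using f by (simp add: iso_def)
qed

end

section \<open>Twisted bimodules and the Picard group\<close>

lemma hom_finprod:
  assumes "comm_group G" "comm_group H" "f \<in> hom G H" "a \<in> I \<rightarrow> carrier G"
  shows "f (finprod G a I) = finprod H (\<lambda>i. f (a i)) I"
proof -
  interpret G: comm_group G by (rule assms(1))
  interpret H: comm_group H by (rule assms(2))
  interpret f: group_hom G H f using assms(3) by unfold_locales
  show ?thesis using assms(4)
    by (induction I rule: infinite_finite_induct) (auto simp: Pi_iff)
qed

lemma (in left_module) lact_hom: "a \<in> carrier A \<Longrightarrow> lact M a \<in> hom M M"
  by (intro homI) (auto simp: lact_closed lact_distr)

lemma (in left_module) lact_hom_scalar: "m \<in> carrier M \<Longrightarrow> (\<lambda>a. lact M a m) \<in> hom (add_monoid A) M"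
  by (intro homI) (auto simp: lact_closed lact_add)

text \<open>Here \<open>M\<close> is free of rank one as a right module on \<open>m0\<close>, and \<open>c\<close> reads off the coordinate. The
  isomorphism \<open>M \<otimes>\<^sub>B N \<rightarrow> N\<close> sends \<open>m \<otimes> n\<close> to \<open>c(m) n\<close>, with inverse \<open>n \<mapsto> m0 \<otimes> n\<close>. Twisted
  bimodules take the role of \<open>M\<close>.\<close>

lemma (in tensor_factors) tensor_free_rank_one:
  assumes N: "left_module B N" and c: "c \<in> hom M (add_monoid B)"
    and c_ract: "\<And>m b. \<lbrakk>m \<in> carrier M; b \<in> carrier B\<rbrakk> \<Longrightarrow> c (ract M m b) = c m \<otimes>\<^bsub>B\<^esub> b"
    and m0: "m0 \<in> carrier M" "c m0 = \<one>\<^bsub>B\<^esub>" "\<And>m. m \<in> carrier M \<Longrightarrow> ract M m0 (c m) = m"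
  obtains f where "f \<in> iso T N"
    "\<And>m n. \<lbrakk>m \<in> carrier M; n \<in> carrier N\<rbrakk> \<Longrightarrow> f (pure m n) = lact N (c m) n"
    "\<And>n. n \<in> carrier N \<Longrightarrow> f (pure m0 n) = n"
    "\<And>U. U \<in> carrier T \<Longrightarrow> pure m0 (f U) = U"
proof -
  interpret L: left_module B N by (rule N)
  have cc: "c m \<in> carrier B" if "m \<in> carrier M" for m using hom_in_carrier[OF c that] by simp
  have c_add: "c (m \<otimes>\<^bsub>M\<^esub> m') = c m \<oplus>\<^bsub>B\<^esub> c m'" if "m \<in> carrier M" "m' \<in> carrier M" for m m'
    using hom_mult[OF c that] by simp
  obtain f where f: "f \<in> hom T N"
    and f_pure: "\<And>m n. \<lbrakk>m \<in> carrier M; n \<in> carrier N\<rbrakk> \<Longrightarrow> f (pure m n) = lact N (c m) n"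
    by (rule tensor_universal[OF N.comm_group_axioms, of "\<lambda>m n. lact N (c m) n"])
      (simp_all add: cc c_add c_ract L.lact_closed L.lact_add L.lact_distr L.lact_mult)
  have hom: "pure m0 \<in> hom N T"
    by (intro homI) (simp_all add: m0 pure_add_right)
  have left: "pure m0 (f (pure m n)) = pure m n" if "m \<in> carrier M" "n \<in> carrier N" for m n
  proof -
    have "pure m n = pure m0 (lact N (c m) n)"
      using that m0 pure_balanced[of m0 "c m" n] by (simp add: cc)
    then show ?thesis using f_pure[OF that] by simp
  qed
  have right: "f (pure m0 n) = n" if "n \<in> carrier N" for n
    using that m0 by (simp add: f_pure L.lact_one)
  have iso: "f \<in> iso T N"
    by (rule tensor_iso[OF N.comm_group_axioms f hom left right])
  have "pure m0 (f U) = U" if "U \<in> carrier T" for U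
  proof -
    have "f (pure m0 (f U)) = f U" using hom_in_carrier[OF f that] right by simp
    moreover have "pure m0 (f U) \<in> carrier T" using hom_in_carrier[OF f that] m0 by simp
    ultimately show ?thesis using iso that by (auto simp: iso_def bij_betw_def inj_on_def)
  qed
  then show thesis using that iso f_pure right by blast
qed

lemma comm_group_cong:
  assumes "comm_group H" "carrier H' = carrier H" "monoid.mult H' = monoid.mult H" "one H' = one H"
  shows "comm_group H'"
proof -
  interpret H: comm_group H by (rule assms(1))
  show ?thesis
  proof (rule comm_groupI)
    show "\<exists>y\<in>carrier H'. y \<otimes>\<^bsub>H'\<^esub> x = \<one>\<^bsub>H'\<^esub>" if "x \<in> carrier H'" for x
      using that H.l_inv_ex by (simp add: assms)
  qed (simp_all add: assms H.m_ac)
qed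

lemma comm_group_regular_bimod: "ring A \<Longrightarrow> comm_group (regular_bimod A)"
  by (rule comm_group_cong[OF abelian_group.a_comm_group[OF ring.is_abelian_group]])
    (simp_all add: regular_bimod_def)

locale ring_endomorphism = ring A for A :: "('a, 'r) ring_scheme" (structure) +
  fixes \<alpha> :: "'a \<Rightarrow> 'a"
  assumes endo: "\<alpha> \<in> ring_hom A A"
begin

lemma endo_simps [simp]:
  "x \<in> carrier A \<Longrightarrow> \<alpha> x \<in> carrier A"
  "\<lbrakk>x \<in> carrier A; y \<in> carrier A\<rbrakk> \<Longrightarrow> \<alpha> (x \<otimes> y) = \<alpha> x \<otimes> \<alpha> y"
  "\<lbrakk>x \<in> carrier A; y \<in> carrier A\<rbrakk> \<Longrightarrow> \<alpha> (x \<oplus> y) = \<alpha> x \<oplus> \<alpha> y"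
  "\<alpha> \<one> = \<one>"
  using endo by (auto simp: ring_hom_def)

lemma twisted_simps [simp]:
  "carrier (twisted_bimod \<alpha> A) = carrier A" "x \<otimes>\<^bsub>twisted_bimod \<alpha> A\<^esub> y = x \<oplus> y"
  "\<one>\<^bsub>twisted_bimod \<alpha> A\<^esub> = \<zero>" "lact (twisted_bimod \<alpha> A) a x = \<alpha> a \<otimes> x"
  "ract (twisted_bimod \<alpha> A) x a = x \<otimes> a"
  by (simp_all add: twisted_bimod_def regular_bimod_def)

lemma comm_group_twisted: "comm_group (twisted_bimod \<alpha> A)"
  by (rule comm_group_cong[OF comm_group_regular_bimod[OF ring_axioms]])
    (simp_all add: twisted_bimod_def)

lemma bimodule_twisted: "bimodule A A (twisted_bimod \<alpha> A)"
proof -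
  interpret M: comm_group "twisted_bimod \<alpha> A" by (rule comm_group_twisted)
  show ?thesis
    by unfold_locales (simp_all add: l_distr r_distr m_assoc)
qed

end

lemma (in ring) bimodule_regular: "bimodule R R (regular_bimod R)"
proof -
  interpret ring_endomorphism R "\<lambda>x. x" by unfold_locales (auto simp: ring_hom_def)
  have "twisted_bimod (\<lambda>x. x) R = regular_bimod R" by (simp add: twisted_bimod_def regular_bimod_def)
  then show ?thesis using bimodule_twisted by simp
qed

lemma bimod_iso_refl: "bimod_iso A B M M"
  unfolding bimod_iso_def by (rule bexI[of _ id]) (auto simp: iso_def hom_def bij_betw_def)

text \<open>The isomorphism is \<open>m \<otimes> n \<mapsto> \<beta>(m) n\<close>; left multiplication by \<open>\<alpha>(a)\<close> becomes left multiplication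
  by \<open>\<beta>(\<alpha>(a)) = a\<close>.\<close>

lemma (in ring) tensor_twisted_inverse:
  assumes \<alpha>: "ring_endomorphism R \<alpha>" and \<beta>: "ring_endomorphism R \<beta>"
    and inverse: "\<And>x. x \<in> carrier R \<Longrightarrow> \<beta> (\<alpha> x) = x"
  shows "bimod_iso R R (tensor_bimod R (twisted_bimod \<alpha> R) (twisted_bimod \<beta> R)) (regular_bimod R)"
proof -
  interpret \<alpha>: ring_endomorphism R \<alpha> by (rule \<alpha>)
  interpret \<beta>: ring_endomorphism R \<beta> by (rule \<beta>)
  let ?M = "twisted_bimod \<alpha> R" and ?N = "twisted_bimod \<beta> R"
  interpret tf: tensor_factors R ?M ?N
    using \<alpha>.comm_group_twisted \<beta>.comm_group_twisted by (intro tensor_factors.intro) simp_all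
  have N: "left_module R ?N" using \<beta>.bimodule_twisted by (simp add: bimodule_def)
  obtain f where f: "f \<in> iso (tensor_group R ?M ?N) ?N"
    and f_pure: "\<And>m n. \<lbrakk>m \<in> carrier R; n \<in> carrier R\<rbrakk> \<Longrightarrow> f (tf.pure m n) = \<beta> m \<otimes> n"
    and f_one: "\<And>U. U \<in> carrier (tensor_group R ?M ?N) \<Longrightarrow> tf.pure \<one> (f U) = U"
    using tf.tensor_free_rank_one[OF N, of "\<lambda>x. x" \<one>] by (auto simp: hom_def)
  have fU: "f U \<in> carrier R" if "U \<in> carrier (tensor_group R ?M ?N)" for U
    using f that by (auto simp: iso_def hom_def)
  have lact: "f (tensor_map R ?M ?N (lact ?M a) (\<lambda>n. n) U) = a \<otimes> f U"
    if "a \<in> carrier R" "U \<in> carrier (tensor_group R ?M ?N)" for a U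
  proof -
    have "tensor_map R ?M ?N (lact ?M a) (\<lambda>n. n) (tf.pure \<one> (f U)) = tf.pure (lact ?M a \<one>) (f U)"
      using that fU by (intro tf.tensor_map_hom(2)) (auto simp: hom_def r_distr m_assoc)
    then show ?thesis using that fU f_one by (simp add: f_pure inverse)
  qed
  have ract: "f (tensor_map R ?M ?N (\<lambda>m. m) (\<lambda>n. ract ?N n b) U) = f U \<otimes> b"
    if "b \<in> carrier R" "U \<in> carrier (tensor_group R ?M ?N)" for b U
  proof -
    have "tensor_map R ?M ?N (\<lambda>m. m) (\<lambda>n. ract ?N n b) (tf.pure \<one> (f U)) = tf.pure \<one> (ract ?N (f U) b)"
      using that fU by (intro tf.tensor_map_hom(2)) (auto simp: hom_def l_distr m_assoc)
    then show ?thesis using that fU f_one by (simp add: f_pure)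
  qed
  have "f \<in> iso (tensor_bimod R ?M ?N) (regular_bimod R)"
    using f by (simp add: tensor_bimod_def regular_bimod_def iso_def hom_def)
  then show ?thesis
    unfolding bimod_iso_def
    by (rule bexI[rotated]) (simp add: tensor_bimod_def regular_bimod_def lact[simplified] ract[simplified])
qed

lemma (in ring) morita_bimod_twisted:
  assumes \<alpha>: "ring_endomorphism R \<alpha>" and \<beta>: "ring_endomorphism R \<beta>"
    and inverse: "\<And>x. x \<in> carrier R \<Longrightarrow> \<beta> (\<alpha> x) = x" "\<And>x. x \<in> carrier R \<Longrightarrow> \<alpha> (\<beta> x) = x"
    and scalars: "\<And>r. r \<in> S \<Longrightarrow> r \<in> carrier R \<and> \<alpha> r = r" "\<And>r x. r \<in> S \<Longrightarrow> x \<in> carrier R \<Longrightarrow> r \<otimes> x = x \<otimes> r"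
  shows "morita_bimod S R (twisted_bimod \<alpha> R)"
proof -
  interpret \<alpha>: ring_endomorphism R \<alpha> by (rule \<alpha>)
  interpret \<beta>: ring_endomorphism R \<beta> by (rule \<beta>)
  have "\<beta> r = r" if "r \<in> S" for r using inverse(1)[of r] scalars(1)[OF that] by simp
  then show ?thesis
    unfolding morita_bimod_def Let_def
    using \<alpha>.bimodule_twisted \<beta>.bimodule_twisted scalars tensor_twisted_inverse[OF \<alpha> \<beta> inverse(1)]
      tensor_twisted_inverse[OF \<beta> \<alpha> inverse(2)]
    by (intro conjI exI[of _ "twisted_bimod \<beta> R"]) auto
qed

text \<open>A right linear map is left multiplication by the image \<open>u\<close> of \<open>1\<close>, and comparing the two left
  actions at \<open>1\<close> gives the relation between \<open>u\<close> and \<open>\<alpha>\<close>. The preimage of \<open>1\<close> serves as \<open>v\<close>.\<close>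

lemma (in ring) twisted_iso_regular_imp_inner:
  assumes \<alpha>: "ring_endomorphism R \<alpha>" and iso: "bimod_iso R R (twisted_bimod \<alpha> R) (regular_bimod R)"
  obtains u v where "u \<in> carrier R" "v \<in> carrier R" "u \<otimes> v = \<one>"
    "\<And>x. x \<in> carrier R \<Longrightarrow> x \<otimes> u = u \<otimes> \<alpha> x"
proof -
  interpret \<alpha>: ring_endomorphism R \<alpha> by (rule \<alpha>)
  obtain f where f: "bij_betw f (carrier R) (carrier R)"
    and f_lact: "\<And>a m. \<lbrakk>a \<in> carrier R; m \<in> carrier R\<rbrakk> \<Longrightarrow> f (\<alpha> a \<otimes> m) = a \<otimes> f m"
    and f_ract: "\<And>b m. \<lbrakk>b \<in> carrier R; m \<in> carrier R\<rbrakk> \<Longrightarrow> f (m \<otimes> b) = f m \<otimes> b"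
  proof -
    obtain f where f: "f \<in> iso (twisted_bimod \<alpha> R) (regular_bimod R)" "\<forall>m \<in> carrier R.
        (\<forall>a \<in> carrier R. f (\<alpha> a \<otimes> m) = a \<otimes> f m) \<and> (\<forall>b \<in> carrier R. f (m \<otimes> b) = f m \<otimes> b)"
      using iso by (auto simp: bimod_iso_def regular_bimod_def)
    moreover have "bij_betw f (carrier R) (carrier R)"
      using f(1) by (simp add: iso_def regular_bimod_def)
    ultimately show thesis using that by blast
  qed
  have u: "f \<one> \<in> carrier R" using f by (auto simp: bij_betw_def)
  obtain v where v: "v \<in> carrier R" "f v = \<one>" using f by (metis bij_betw_def imageE one_closed)
  have "f \<one> \<otimes> v = \<one>" using f_ract[of v \<one>] v by simp
  moreover have "x \<otimes> f \<one> = f \<one> \<otimes> \<alpha> x" if "x \<in> carrier R" for x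
    using f_lact[of x \<one>] f_ract[of "\<alpha> x" \<one>] that by simp
  ultimately show thesis using that u v by blast
qed

section \<open>Characters of group algebra modules\<close>

lemma (in left_module) lact_comb:
  assumes "a \<in> carrier A" "f \<in> I \<rightarrow> carrier M"
  shows "lact M a (\<Otimes>\<^bsub>M\<^esub>i\<in>I. f i) = (\<Otimes>\<^bsub>M\<^esub>i\<in>I. lact M a (f i))"
  using hom_finprod[OF M.comm_group_axioms M.comm_group_axioms lact_hom[OF assms(1)] assms(2)] .

lemma (in left_module) lact_finsum:
  assumes "m \<in> carrier M" "f \<in> I \<rightarrow> carrier A"
  shows "lact M (\<Oplus>i\<in>I. f i) m = (\<Otimes>\<^bsub>M\<^esub>i\<in>I. lact M (f i) m)"
  using hom_finprod[OF A.a_comm_group M.comm_group_axioms lact_hom_scalar[OF assms(1)], of f I] assms(2)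
  by (simp add: finsum_def)

lemma ga_single_add:
  "ga_single R G (ring.add R c d) g = ring.add (group_algebra R G) (ga_single R G c g) (ga_single R G d g)"
  if "cring R" "c \<in> carrier R" "d \<in> carrier R"
proof -
  interpret cring R by (rule that(1))
  show ?thesis using that by (auto simp: ga_single_def group_algebra_def)
qed

lemma (in finite_group_algebra) single_finsum:
  assumes "f \<in> I \<rightarrow> carrier R"
  shows "ga_single R G (\<Oplus>\<^bsub>R\<^esub>i\<in>I. f i) g = (\<Oplus>\<^bsub>RG\<^esub>i\<in>I. ga_single R G (f i) g)"
proof -
  have "(\<lambda>c. ga_single R G c g) \<in> hom (add_monoid R) (add_monoid RG)"
    by (intro homI) (simp_all add: ga_single_add[OF R.is_cring])
  from hom_finprod[OF R.a_comm_group A.a_comm_group this, of f I] assms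
  show ?thesis by (simp add: finsum_def)
qed

text \<open>The data hidden in \<^const>\<open>affords\<close>: a basis \<open>v\<close> and matrices \<open>a g\<close> whose trace is \<open>\<chi> g\<close>.\<close>

locale afforded_module = finite_group_algebra K G + V: left_module "group_algebra K G" V
  for K :: "('k, 'r) ring_scheme" (structure) and G :: "('g, 'm) monoid_scheme" (structure)
    and V :: "('g \<Rightarrow> 'k, 'v, 'z) lmod_scheme" +
  fixes \<chi> :: "'g \<Rightarrow> 'k" and d :: nat and v :: "nat \<Rightarrow> 'v" and a :: "'g \<Rightarrow> nat \<Rightarrow> nat \<Rightarrow> 'k"
  assumes \<chi>: "\<chi> \<in> carrier G \<rightarrow>\<^sub>E carrier K"
    and v: "v \<in> {..<d} \<rightarrow> carrier V"
    and basis: "x \<in> carrier V \<Longrightarrow> \<exists>!c. c \<in> {..<d} \<rightarrow>\<^sub>E carrier K \<and>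
      x = (\<Otimes>\<^bsub>V\<^esub>i \<in> {..<d}. lact V (ga_single K G (c i) \<one>\<^bsub>G\<^esub>) (v i))"
    and a: "\<lbrakk>g \<in> carrier G; i < d; j < d\<rbrakk> \<Longrightarrow> a g i j \<in> carrier K"
    and matrix: "\<lbrakk>g \<in> carrier G; j < d\<rbrakk> \<Longrightarrow> lact V (ga_single K G \<one>\<^bsub>K\<^esub> g) (v j) =
      (\<Otimes>\<^bsub>V\<^esub>i \<in> {..<d}. lact V (ga_single K G (a g i j) \<one>\<^bsub>G\<^esub>) (v i))"
    and trace: "g \<in> carrier G \<Longrightarrow> \<chi> g = (\<Oplus>\<^bsub>K\<^esub>i \<in> {..<d}. a g i i)"
begin

definition comb :: "(nat \<Rightarrow> 'k) \<Rightarrow> 'v"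
  where "comb c = (\<Otimes>\<^bsub>V\<^esub>i \<in> {..<d}. lact V (ga_single K G (c i) \<one>\<^bsub>G\<^esub>) (v i))"

lemma v_closed [simp]: "i < d \<Longrightarrow> v i \<in> carrier V"
  using v by auto

lemma comb_closed: "c \<in> {..<d} \<rightarrow> carrier K \<Longrightarrow> comb c \<in> carrier V"
  unfolding comb_def by (auto intro!: V.M.finprod_closed V.lact_closed ga_single_closed simp: Pi_iff)

lemma comb_cong: "\<lbrakk>\<And>i. i < d \<Longrightarrow> c i = c' i; c' \<in> {..<d} \<rightarrow> carrier K\<rbrakk> \<Longrightarrow> comb c = comb c'"
  unfolding comb_def by (intro V.M.finprod_cong') (auto intro!: V.lact_closed ga_single_closed simp: Pi_iff)

lemma comb_inj:
  assumes "c \<in> {..<d} \<rightarrow> carrier K" "c' \<in> {..<d} \<rightarrow> carrier K" "comb c = comb c'" "i < d"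
  shows "c i = c' i"
proof -
  let ?r = "\<lambda>c. restrict c {..<d}"
  have r: "comb (?r c) = comb c" "comb (?r c') = comb c'"
    by (rule comb_cong; use assms in simp)+
  have "\<exists>!b. b \<in> {..<d} \<rightarrow>\<^sub>E carrier K \<and> comb c = comb b"
    using basis[OF comb_closed[OF assms(1)]] by (simp add: comb_def)
  moreover have "?r c \<in> {..<d} \<rightarrow>\<^sub>E carrier K" "?r c' \<in> {..<d} \<rightarrow>\<^sub>E carrier K"
    using assms by auto
  ultimately have "?r c = ?r c'" using r assms(3) by metis
  then show ?thesis using assms(4) by (metis lessThan_iff restrict_apply)
qed

lemma lact_group_comb:
  assumes "x \<in> carrier G" "c \<in> {..<d} \<rightarrow> carrier K"
  shows "lact V (ga_single K G \<one>\<^bsub>K\<^esub> x) (comb c) = comb (\<lambda>i. \<Oplus>\<^bsub>K\<^esub>k \<in> {..<d}. a x i k \<otimes>\<^bsub>K\<^esub> c k)"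
proof -
  have cK: "c k \<in> carrier K" if "k < d" for k using assms that by auto
  have "lact V (ga_single K G \<one>\<^bsub>K\<^esub> x) (comb c) =
      (\<Otimes>\<^bsub>V\<^esub>k \<in> {..<d}. lact V (ga_single K G \<one>\<^bsub>K\<^esub> x) (lact V (ga_single K G (c k) \<one>\<^bsub>G\<^esub>) (v k)))"
    unfolding comb_def using cK by (intro V.lact_comb) (auto intro!: V.lact_closed)
  also have "\<dots> = (\<Otimes>\<^bsub>V\<^esub>k \<in> {..<d}. lact V (ga_single K G (c k) \<one>\<^bsub>G\<^esub>) (comb (\<lambda>i. a x i k)))"
  proof (rule V.M.finprod_cong'[OF refl])
    fix k assume "k \<in> {..<d}"
    then have k: "k < d" by simp
    have "lact V (ga_single K G \<one>\<^bsub>K\<^esub> x) (lact V (ga_single K G (c k) \<one>\<^bsub>G\<^esub>) (v k)) =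
        lact V (ga_single K G (c k) \<one>\<^bsub>G\<^esub>) (lact V (ga_single K G \<one>\<^bsub>K\<^esub> x) (v k))"
      using assms(1) k cK[OF k] by (simp add: V.lact_mult[symmetric] single_mult_single)
    then show "lact V (ga_single K G \<one>\<^bsub>K\<^esub> x) (lact V (ga_single K G (c k) \<one>\<^bsub>G\<^esub>) (v k)) =
        lact V (ga_single K G (c k) \<one>\<^bsub>G\<^esub>) (comb (\<lambda>i. a x i k))"
      using matrix[OF assms(1) k] by (simp add: comb_def)
  qed (use cK assms a in \<open>auto intro!: V.lact_closed comb_closed\<close>)
  also have "\<dots> = (\<Otimes>\<^bsub>V\<^esub>k \<in> {..<d}. \<Otimes>\<^bsub>V\<^esub>i \<in> {..<d}.
      lact V (ga_single K G (a x i k \<otimes>\<^bsub>K\<^esub> c k) \<one>\<^bsub>G\<^esub>) (v i))"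
  proof (rule V.M.finprod_cong'[OF refl])
    fix k assume "k \<in> {..<d}"
    then have k: "k < d" by simp
    have "lact V (ga_single K G (c k) \<one>\<^bsub>G\<^esub>) (comb (\<lambda>i. a x i k)) = (\<Otimes>\<^bsub>V\<^esub>i \<in> {..<d}.
        lact V (ga_single K G (c k) \<one>\<^bsub>G\<^esub>) (lact V (ga_single K G (a x i k) \<one>\<^bsub>G\<^esub>) (v i)))"
      unfolding comb_def using cK k a assms by (intro V.lact_comb) (auto intro!: V.lact_closed)
    also have "\<dots> = (\<Otimes>\<^bsub>V\<^esub>i \<in> {..<d}. lact V (ga_single K G (a x i k \<otimes>\<^bsub>K\<^esub> c k) \<one>\<^bsub>G\<^esub>) (v i))"
      using cK k a assms
      by (intro V.M.finprod_cong')
        (auto intro!: V.lact_closed simp: V.lact_mult[symmetric] single_mult_single R.m_comm)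
    finally show "lact V (ga_single K G (c k) \<one>\<^bsub>G\<^esub>) (comb (\<lambda>i. a x i k)) =
        (\<Otimes>\<^bsub>V\<^esub>i \<in> {..<d}. lact V (ga_single K G (a x i k \<otimes>\<^bsub>K\<^esub> c k) \<one>\<^bsub>G\<^esub>) (v i))" .
  qed (use cK assms a in \<open>auto intro!: V.lact_closed V.M.finprod_closed\<close>)
  also have "\<dots> = (\<Otimes>\<^bsub>V\<^esub>i \<in> {..<d}. \<Otimes>\<^bsub>V\<^esub>k \<in> {..<d}.
      lact V (ga_single K G (a x i k \<otimes>\<^bsub>K\<^esub> c k) \<one>\<^bsub>G\<^esub>) (v i))"
    using cK a assms by (intro V.M.finprod_swap) (auto intro!: V.lact_closed)
  also have "\<dots> = comb (\<lambda>i. \<Oplus>\<^bsub>K\<^esub>k \<in> {..<d}. a x i k \<otimes>\<^bsub>K\<^esub> c k)"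
    unfolding comb_def
  proof (rule V.M.finprod_cong'[OF refl])
    fix i assume "i \<in> {..<d}"
    then show "(\<Otimes>\<^bsub>V\<^esub>k \<in> {..<d}. lact V (ga_single K G (a x i k \<otimes>\<^bsub>K\<^esub> c k) \<one>\<^bsub>G\<^esub>) (v i)) =
        lact V (ga_single K G (\<Oplus>\<^bsub>K\<^esub>k \<in> {..<d}. a x i k \<otimes>\<^bsub>K\<^esub> c k) \<one>\<^bsub>G\<^esub>) (v i)"
      using cK a assms by (subst single_finsum) (auto simp: V.lact_finsum)
  qed (use cK assms a in \<open>auto intro!: V.lact_closed ga_single_closed R.finsum_closed\<close>)
  finally show ?thesis .
qed

lemma matrix_mult:
  assumes "x \<in> carrier G" "y \<in> carrier G" "i < d" "j < d"
  shows "a (x \<otimes>\<^bsub>G\<^esub> y) i j = (\<Oplus>\<^bsub>K\<^esub>k \<in> {..<d}. a x i k \<otimes>\<^bsub>K\<^esub> a y k j)"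
proof -
  have "comb (\<lambda>i. a (x \<otimes>\<^bsub>G\<^esub> y) i j) = lact V (ga_single K G \<one>\<^bsub>K\<^esub> (x \<otimes>\<^bsub>G\<^esub> y)) (v j)"
    using matrix[of "x \<otimes>\<^bsub>G\<^esub> y" j] assms by (simp add: comb_def)
  also have "\<dots> = lact V (ga_single K G \<one>\<^bsub>K\<^esub> x) (lact V (ga_single K G \<one>\<^bsub>K\<^esub> y) (v j))"
    using assms by (simp add: V.lact_mult[symmetric] single_mult_single)
  also have "\<dots> = lact V (ga_single K G \<one>\<^bsub>K\<^esub> x) (comb (\<lambda>i. a y i j))"
    using matrix[of y j] assms by (simp add: comb_def)
  also have "\<dots> = comb (\<lambda>i. \<Oplus>\<^bsub>K\<^esub>k \<in> {..<d}. a x i k \<otimes>\<^bsub>K\<^esub> a y k j)"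
    using assms a by (intro lact_group_comb) auto
  finally show ?thesis
    using assms a by (intro comb_inj[where c = "\<lambda>i. a (x \<otimes>\<^bsub>G\<^esub> y) i j"]) (auto intro!: R.finsum_closed)
qed

lemma character_comm:
  assumes "x \<in> carrier G" "y \<in> carrier G"
  shows "\<chi> (x \<otimes>\<^bsub>G\<^esub> y) = \<chi> (y \<otimes>\<^bsub>G\<^esub> x)"
proof -
  have 1: "\<chi> (x \<otimes>\<^bsub>G\<^esub> y) = (\<Oplus>\<^bsub>K\<^esub>i \<in> {..<d}. \<Oplus>\<^bsub>K\<^esub>k \<in> {..<d}. a x i k \<otimes>\<^bsub>K\<^esub> a y k i)"
    if "x \<in> carrier G" "y \<in> carrier G" for x y
    using that a by (auto simp: trace matrix_mult intro!: R.finsum_cong' R.finsum_closed)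
  have "\<chi> (x \<otimes>\<^bsub>G\<^esub> y) = (\<Oplus>\<^bsub>K\<^esub>k \<in> {..<d}. \<Oplus>\<^bsub>K\<^esub>i \<in> {..<d}. a x i k \<otimes>\<^bsub>K\<^esub> a y k i)"
    unfolding 1[OF assms] using a assms by (intro R.finsum_swap) auto
  also have "\<dots> = (\<Oplus>\<^bsub>K\<^esub>k \<in> {..<d}. \<Oplus>\<^bsub>K\<^esub>i \<in> {..<d}. a y k i \<otimes>\<^bsub>K\<^esub> a x i k)"
  proof (rule R.finsum_cong'[OF refl])
    fix k assume "k \<in> {..<d}"
    then show "(\<Oplus>\<^bsub>K\<^esub>i \<in> {..<d}. a x i k \<otimes>\<^bsub>K\<^esub> a y k i) = (\<Oplus>\<^bsub>K\<^esub>i \<in> {..<d}. a y k i \<otimes>\<^bsub>K\<^esub> a x i k)"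
      using a assms by (intro R.finsum_cong') (auto simp: R.m_comm)
  qed (use a assms in \<open>auto intro!: R.finsum_closed\<close>)
  also have "\<dots> = \<chi> (y \<otimes>\<^bsub>G\<^esub> x)" using 1[OF assms(2,1)] by simp
  finally show ?thesis .
qed

lemma character_conj_class:
  assumes "x \<in> carrier G" "y \<in> conj_class G x" shows "\<chi> y = \<chi> x"
proof -
  obtain z where z: "z \<in> carrier G" "y = z \<otimes>\<^bsub>G\<^esub> x \<otimes>\<^bsub>G\<^esub> inv\<^bsub>G\<^esub> z"
    using assms(2) by (auto simp: conj_class_def)
  have "\<chi> y = \<chi> (inv\<^bsub>G\<^esub> z \<otimes>\<^bsub>G\<^esub> (z \<otimes>\<^bsub>G\<^esub> x))"
    using z assms(1) character_comm[of "z \<otimes>\<^bsub>G\<^esub> x" "inv\<^bsub>G\<^esub> z"] by simp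
  then show ?thesis using z(1) assms(1) by (simp add: G.m_assoc[symmetric])
qed

end

lemma (in finite_group_algebra) affordsE:
  assumes "affords R G V \<chi>" obtains d v a where "afforded_module R G V \<chi> d v a"
proof -
  obtain d :: nat and v and a :: "'g \<Rightarrow> nat \<Rightarrow> nat \<Rightarrow> 'k" where
    *: "v \<in> {..<d} \<rightarrow> carrier V"
    "\<forall>x\<in>carrier V. \<exists>!c. c \<in> {..<d} \<rightarrow>\<^sub>E carrier R \<and>
      x = (\<Otimes>\<^bsub>V\<^esub>i\<in>{..<d}. lact V (ga_single R G (c i) \<one>\<^bsub>G\<^esub>) (v i))"
    "\<forall>g\<in>carrier G. (\<forall>i<d. \<forall>j<d. a g i j \<in> carrier R) \<and>
      (\<forall>j<d. lact V (ga_single R G \<one>\<^bsub>R\<^esub> g) (v j) =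
        (\<Otimes>\<^bsub>V\<^esub>i\<in>{..<d}. lact V (ga_single R G (a g i j) \<one>\<^bsub>G\<^esub>) (v i))) \<and>
      \<chi> g = (\<Oplus>\<^bsub>R\<^esub>i\<in>{..<d}. a g i i)"
    using assms unfolding affords_def Let_def by (elim conjE exE) (rule that; assumption)
  interpret V: left_module RG V using assms by (simp add: affords_def)
  have "afforded_module R G V \<chi> d v a"
    using assms * by unfold_locales (simp_all add: affords_def)
  then show thesis by (rule that)
qed

lemma (in finite_group_algebra) affordsI:
  assumes "afforded_module R G V \<chi> d v a" shows "affords R G V \<chi>"
proof -
  interpret afforded_module R G V \<chi> d v a by (rule assms)
  show ?thesis
    unfolding affords_def Let_def
    using V.left_module_axioms \<chi> v basis a matrix trace
    by (intro conjI exI[of _ d] exI[of _ v] exI[of _ a] ballI allI impI) simp_all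
qed

text \<open>The map \<open>F\<close> identifies \<open>W\<close> with \<open>V\<close> twisted by \<open>\<psi>\<close>. On the transported basis \<open>g\<close> acts by the
  matrix of \<open>\<psi>(g)\<close>, whose trace is that of \<open>g\<close> because \<open>\<psi>(g)\<close> is conjugate to \<open>g\<close>.\<close>

lemma (in finite_group_algebra) affords_twist:
  fixes V :: "('g \<Rightarrow> 'k, 'v, 'z) lmod_scheme" and W :: "('g \<Rightarrow> 'k, 'w, 'y) lmod_scheme"
  assumes V: "affords R G V \<chi>" and \<psi>: "\<psi> \<in> Aut_c G" and W: "comm_group W"
    and F: "F \<in> iso W V"
    and lact_closed: "\<And>x w. \<lbrakk>x \<in> carrier RG; w \<in> carrier W\<rbrakk> \<Longrightarrow> lact W x w \<in> carrier W"
    and F_lact: "\<And>x w. \<lbrakk>x \<in> carrier RG; w \<in> carrier W\<rbrakk> \<Longrightarrow>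
      F (lact W x w) = lact V (ga_extend G \<psi> x) (F w)"
  shows "affords R G W \<chi>"
proof -
  have auto: "\<psi> \<in> auto G" and class_preserving: "\<And>x. x \<in> carrier G \<Longrightarrow> \<psi> ` conj_class G x = conj_class G x"
    using \<psi> by (auto simp: Aut_c_def)
  obtain d v a where "afforded_module R G V \<chi> d v a" using affordsE[OF V] .
  then interpret V: afforded_module R G V \<chi> d v a .
  interpret W: comm_group W by (rule W)
  have F_inj: "x = y" if "F x = F y" "x \<in> carrier W" "y \<in> carrier W" for x y
    using F that by (auto simp: iso_def bij_betw_def inj_on_def)
  have F_hom: "F \<in> hom W V" using F by (simp add: iso_def)
  have F_closed [simp]: "F w \<in> carrier V" if "w \<in> carrier W" for w
    using F_hom that by (rule hom_in_carrier)
  have F_mult: "F (x \<otimes>\<^bsub>W\<^esub> y) = F x \<otimes>\<^bsub>V\<^esub> F y" if "x \<in> carrier W" "y \<in> carrier W" for x y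
    using F_hom that by (rule hom_mult)
  interpret W: left_module RG W
  proof
    show "lact W x w \<in> carrier W" if "x \<in> carrier RG" "w \<in> carrier W" for x w
      using that by (rule lact_closed)
    show "lact W x (w \<otimes>\<^bsub>W\<^esub> w') = lact W x w \<otimes>\<^bsub>W\<^esub> lact W x w'"
      if "x \<in> carrier RG" "w \<in> carrier W" "w' \<in> carrier W" for x w w'
      by (rule F_inj) (simp_all add: that lact_closed F_lact F_mult V.V.lact_distr auto)
    show "lact W (x \<oplus>\<^bsub>RG\<^esub> y) w = lact W x w \<otimes>\<^bsub>W\<^esub> lact W y w"
      if "x \<in> carrier RG" "y \<in> carrier RG" "w \<in> carrier W" for x y w
      by (rule F_inj) (simp_all add: that lact_closed F_lact F_mult V.V.lact_add extend_add auto)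
    show "lact W (x \<otimes>\<^bsub>RG\<^esub> y) w = lact W x (lact W y w)"
      if "x \<in> carrier RG" "y \<in> carrier RG" "w \<in> carrier W" for x y w
      by (rule F_inj) (simp_all add: that lact_closed F_lact F_mult V.V.lact_mult extend_mult auto)
    show "lact W \<one>\<^bsub>RG\<^esub> w = w" if "w \<in> carrier W" for w
      by (rule F_inj) (simp_all add: that lact_closed F_lact V.V.lact_one extend_one auto)
  qed
  define w where "w i = inv_into (carrier W) F (v i)" for i
  have w: "w i \<in> carrier W" "F (w i) = v i" if "i < d" for i
  proof -
    have "v i \<in> F ` carrier W" using F that by (simp add: iso_def bij_betw_def)
    then show "w i \<in> carrier W" "F (w i) = v i" by (simp_all add: w_def inv_into_into f_inv_into_f)
  qed
  define comb where "comb c = (\<Otimes>\<^bsub>W\<^esub>i \<in> {..<d}. lact W (ga_single R G (c i) \<one>\<^bsub>G\<^esub>) (w i))" for c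
  have \<psi>_closed: "\<psi> g \<in> carrier G" if "g \<in> carrier G" for g
    using hom_in_carrier[OF autoE(2)[OF auto] that] .
  have \<psi>_one: "\<psi> \<one>\<^bsub>G\<^esub> = \<one>\<^bsub>G\<^esub>"
    using hom_one[of \<psi> G G, OF autoE(2)[OF auto] G.is_group G.is_group] .
  have comb_closed: "comb c \<in> carrier W" if "c \<in> {..<d} \<rightarrow> carrier R" for c
    unfolding comb_def using that w by (auto intro!: W.finprod_closed lact_closed ga_single_closed simp: Pi_iff)
  have F_comb: "F (comb c) = V.comb c" if c: "c \<in> {..<d} \<rightarrow> carrier R" for c
  proof -
    have "F (comb c) = (\<Otimes>\<^bsub>V\<^esub>i \<in> {..<d}. F (lact W (ga_single R G (c i) \<one>\<^bsub>G\<^esub>) (w i)))"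
      unfolding comb_def using c w
      by (intro hom_finprod[OF W V.V.M.comm_group_axioms F_hom]) (auto intro!: lact_closed ga_single_closed simp: Pi_iff)
    also have "\<dots> = V.comb c"
      unfolding V.comb_def using c w
      by (intro V.V.M.finprod_cong')
        (auto simp: Pi_iff F_lact extend_single[OF auto] \<psi>_one intro!: V.V.lact_closed ga_single_closed)
    finally show ?thesis .
  qed
  have "afforded_module R G W \<chi> d w (\<lambda>g. a (\<psi> g))"
  proof
    show "\<chi> \<in> carrier G \<rightarrow>\<^sub>E carrier R" by (rule V.\<chi>)
    show "w \<in> {..<d} \<rightarrow> carrier W" using w by auto
    show "\<exists>!c. c \<in> {..<d} \<rightarrow>\<^sub>E carrier R \<and> x = (\<Otimes>\<^bsub>W\<^esub>i \<in> {..<d}. lact W (ga_single R G (c i) \<one>\<^bsub>G\<^esub>) (w i))"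
      if x: "x \<in> carrier W" for x
    proof -
      have "x = comb c \<longleftrightarrow> F x = V.comb c" if "c \<in> {..<d} \<rightarrow>\<^sub>E carrier R" for c
        using F_comb[of c] F_inj[of x "comb c"] comb_closed[of c] that x by (auto simp: PiE_iff Pi_iff)
      then show ?thesis
        using V.basis[OF F_closed[OF x]] unfolding comb_def[symmetric] V.comb_def[symmetric] by metis
    qed
    fix g assume g: "g \<in> carrier G"
    show "a (\<psi> g) i j \<in> carrier R" if "i < d" "j < d" for i j
      using V.a \<psi>_closed[OF g] that by simp
    show "lact W (ga_single R G \<one>\<^bsub>R\<^esub> g) (w j) =
      (\<Otimes>\<^bsub>W\<^esub>i \<in> {..<d}. lact W (ga_single R G (a (\<psi> g) i j) \<one>\<^bsub>G\<^esub>) (w i))" if j: "j < d" for j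
    proof -
      have c: "(\<lambda>i. a (\<psi> g) i j) \<in> {..<d} \<rightarrow> carrier R" using V.a \<psi>_closed[OF g] j by simp
      have "F (lact W (ga_single R G \<one>\<^bsub>R\<^esub> g) (w j)) = F (comb (\<lambda>i. a (\<psi> g) i j))"
        using V.matrix[OF \<psi>_closed[OF g] j] F_comb[OF c] w[OF j] g
        by (simp add: F_lact extend_single[OF auto] V.comb_def)
      then show ?thesis
        unfolding comb_def[symmetric] using w[OF j] comb_closed[OF c] by (intro F_inj) (auto intro!: lact_closed)
    qed
    have "g \<in> conj_class G g"
      using g unfolding conj_class_def by (auto intro!: exI[of _ "\<one>\<^bsub>G\<^esub>"])
    then have "\<psi> g \<in> conj_class G g" using class_preserving[OF g] by blast
    then show "\<chi> g = (\<Oplus>\<^bsub>R\<^esub>i \<in> {..<d}. a (\<psi> g) i i)"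
      using V.character_conj_class[OF g] V.trace[OF \<psi>_closed[OF g]] by simp
  qed
  then show ?thesis by (rule affordsI)
qed

section \<open>Extension of scalars of twisted bimodules\<close>

locale scalar_extension = K?: finite_group_algebra K G
  for K :: "'k ring" (structure) and G :: "('g, 'm) monoid_scheme" (structure) +
  fixes S :: "'k set"
  assumes subring: "subring S K"
begin

abbreviation \<O> :: "'k ring" where "\<O> \<equiv> K\<lparr>carrier := S\<rparr>"
abbreviation OG :: "('g \<Rightarrow> 'k) ring" where "OG \<equiv> group_algebra \<O> G"

lemma cring_scalars: "cring \<O>"
  using R.subcringI'[OF subring] R.subcring_iff[OF subringE(1)[OF subring]] by simp

sublocale O: finite_group_algebra \<O> G
  by (intro finite_group_algebra.intro cring_scalars G.group_axioms finite_group_algebra_axioms.intro finite_carrier)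

lemma single_scalars [simp]: "ga_single \<O> G = ga_single K G"
  by (simp add: ga_single_def fun_eq_iff)

lemma S_closed [simp]: "r \<in> S \<Longrightarrow> r \<in> carrier K"
  using subringE(1)[OF subring] by auto

lemma one_S [simp]: "\<one>\<^bsub>K\<^esub> \<in> S"
  by (rule subringE(3)[OF subring])

lemma OG_closed [simp]: "x \<in> carrier OG \<Longrightarrow> x \<in> carrier RG"
  by (auto simp: O.ga_carrier ga_carrier PiE_iff)

lemma OG_coeff [simp]: "x \<in> carrier OG \<Longrightarrow> g \<in> carrier G \<Longrightarrow> x g \<in> S"
  by (auto simp: O.ga_carrier PiE_iff)

lemma single_OG [simp]: "r \<in> S \<Longrightarrow> ga_single K G r g \<in> carrier OG"
  using O.ga_single_closed[of r g] by simp

lemma ring_endomorphism_extend: "\<psi> \<in> auto G \<Longrightarrow> ring_endomorphism OG (ga_extend G \<psi>)"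
  by unfold_locales
    (auto simp: ring_hom_def O.extend_mult O.extend_add O.extend_one)

definition scale :: "'k \<Rightarrow> ('g \<Rightarrow> 'k) \<Rightarrow> 'g \<Rightarrow> 'k"
  where "scale c x = (\<lambda>g\<in>carrier G. c \<otimes>\<^bsub>K\<^esub> x g)"

lemma scale_closed [simp]: "c \<in> carrier K \<Longrightarrow> x \<in> carrier RG \<Longrightarrow> scale c x \<in> carrier RG"
  by (auto simp: scale_def ga_carrier PiE_iff)

lemma scale_coeff [simp]: "g \<in> carrier G \<Longrightarrow> scale c x g = c \<otimes>\<^bsub>K\<^esub> x g"
  by (simp add: scale_def)

text \<open>If \<open>M\<close> is \<open>\<O>G\<close> twisted by \<open>\<psi>\<close>, then \<open>K \<otimes>\<^sub>\<O> M\<close> is \<open>KG\<close> twisted by \<open>\<psi>\<close>. The statement is about any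
  \<open>M\<close> in the isomorphism class, since membership in \<open>Picent\<close> refers to all of them.\<close>

lemma base_change_twisted:
  assumes \<psi>: "\<psi> \<in> auto G" and M: "bimodule OG OG M"
    and iso: "bimod_iso OG OG (twisted_bimod (ga_extend G \<psi>) OG) M"
  obtains B where "comm_group (base_change K S G M)" "B \<in> iso (base_change K S G M) (add_monoid RG)"
    "\<And>x U. \<lbrakk>x \<in> carrier RG; U \<in> carrier (base_change K S G M)\<rbrakk> \<Longrightarrow>
      lact (base_change K S G M) x U \<in> carrier (base_change K S G M) \<and>
      B (lact (base_change K S G M) x U) = ga_extend G \<psi> x \<otimes>\<^bsub>RG\<^esub> B U"
    "\<And>x U. \<lbrakk>x \<in> carrier RG; U \<in> carrier (base_change K S G M)\<rbrakk> \<Longrightarrow>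
      ract (base_change K S G M) U x \<in> carrier (base_change K S G M) \<and>
      B (ract (base_change K S G M) U x) = B U \<otimes>\<^bsub>RG\<^esub> x"
proof -
  interpret M: bimodule OG OG M by (rule M)
  interpret \<psi>: ring_endomorphism OG "ga_extend G \<psi>" by (rule ring_endomorphism_extend[OF \<psi>])
  have \<psi>_closed: "\<psi> g \<in> carrier G" if "g \<in> carrier G" for g
    using hom_in_carrier[OF autoE(2)[OF \<psi>] that] .
  have \<psi>_one: "\<psi> \<one>\<^bsub>G\<^esub> = \<one>\<^bsub>G\<^esub>"
    using hom_one[of \<psi> G G, OF autoE(2)[OF \<psi>] G.is_group G.is_group] .
  obtain f where f: "f \<in> iso (twisted_bimod (ga_extend G \<psi>) OG) M"
    and f_lact: "\<And>a m. \<lbrakk>a \<in> carrier OG; m \<in> carrier OG\<rbrakk> \<Longrightarrow> f (ga_extend G \<psi> a \<otimes>\<^bsub>OG\<^esub> m) = lact M a (f m)"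
    and f_ract: "\<And>b m. \<lbrakk>b \<in> carrier OG; m \<in> carrier OG\<rbrakk> \<Longrightarrow> f (m \<otimes>\<^bsub>OG\<^esub> b) = ract M (f m) b"
    using iso unfolding bimod_iso_def \<psi>.twisted_simps by blast
  have f_bij: "bij_betw f (carrier OG) (carrier M)" and f_hom: "f \<in> hom (add_monoid OG) M"
    using f by (auto simp: iso_def hom_def)
  define \<phi> where "\<phi> = inv_into (carrier OG) f"
  have \<phi>: "\<phi> m \<in> carrier OG" "f (\<phi> m) = m" if "m \<in> carrier M" for m
    using f_bij that by (auto simp: \<phi>_def bij_betw_def inv_into_into f_inv_into_f)
  have \<phi>_f: "\<phi> (f x) = x" if "x \<in> carrier OG" for x
    using f_bij that by (auto simp: \<phi>_def bij_betw_def)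
  have f_closed: "f x \<in> carrier M" if "x \<in> carrier OG" for x
    using f_hom that by (auto simp: hom_def)
  have \<phi>_mult: "\<phi> (m \<otimes>\<^bsub>M\<^esub> m') = \<phi> m \<oplus>\<^bsub>OG\<^esub> \<phi> m'" if "m \<in> carrier M" "m' \<in> carrier M" for m m'
  proof -
    have "f (\<phi> m \<oplus>\<^bsub>OG\<^esub> \<phi> m') = m \<otimes>\<^bsub>M\<^esub> m'"
      using hom_mult[OF f_hom, of "\<phi> m" "\<phi> m'"] \<phi> that by simp
    then show ?thesis using \<phi>_f[of "\<phi> m \<oplus>\<^bsub>OG\<^esub> \<phi> m'"] \<phi> that by simp
  qed
  have \<phi>_lact: "\<phi> (lact M a m) = ga_extend G \<psi> a \<otimes>\<^bsub>OG\<^esub> \<phi> m" if "a \<in> carrier OG" "m \<in> carrier M" for a m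
    using f_lact[of a "\<phi> m"] \<phi>_f[of "ga_extend G \<psi> a \<otimes>\<^bsub>OG\<^esub> \<phi> m"] \<phi> that \<psi> by simp
  have \<phi>_ract: "\<phi> (ract M m b) = \<phi> m \<otimes>\<^bsub>OG\<^esub> b" if "b \<in> carrier OG" "m \<in> carrier M" for b m
    using f_ract[of b "\<phi> m"] \<phi>_f[of "\<phi> m \<otimes>\<^bsub>OG\<^esub> b"] \<phi> that by simp
  let ?K = "regular_bimod K" and ?M = "restrict_left (\<lambda>r. ga_single K G r \<one>\<^bsub>G\<^esub>) M"
  have K_simps [simp]: "carrier ?K = carrier K" "x \<otimes>\<^bsub>?K\<^esub> y = x \<oplus>\<^bsub>K\<^esub> y" "ract ?K x y = x \<otimes>\<^bsub>K\<^esub> y" for x y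
    by (simp_all add: regular_bimod_def)
  have M_simps [simp]: "carrier ?M = carrier M" "x \<otimes>\<^bsub>?M\<^esub> y = x \<otimes>\<^bsub>M\<^esub> y" "\<one>\<^bsub>?M\<^esub> = \<one>\<^bsub>M\<^esub>"
    "lact ?M r x = lact M (ga_single K G r \<one>\<^bsub>G\<^esub>) x" for x y r
    by (simp_all add: restrict_left_def)
  interpret tf: tensor_factors \<O> ?K ?M
  proof (rule tensor_factors.intro)
    show "comm_group ?K" by (rule comm_group_regular_bimod[OF R.ring_axioms])
    show "comm_group ?M" by (rule comm_group_cong[OF M.M.comm_group_axioms]) (simp_all add: restrict_left_def)
  qed (simp_all add: M.lact_closed)
  let ?T = "tensor_group \<O> ?K ?M" and ?BC = "base_change K S G M"
  have KG_group: "comm_group (add_monoid RG)" by (rule A.a_comm_group)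
  have \<phi>_scalar: "\<phi> (lact M (ga_single K G b \<one>\<^bsub>G\<^esub>) n) g = b \<otimes>\<^bsub>K\<^esub> \<phi> n g"
    if "b \<in> S" "n \<in> carrier M" "g \<in> carrier G" for b n g
    using that \<phi>(1)[OF that(2)] O.extend_single[OF \<psi>, of b "\<one>\<^bsub>G\<^esub>"] O.single_mult[of b "\<one>\<^bsub>G\<^esub>" "\<phi> n" g]
    by (simp add: \<phi>_lact \<psi>_one)
  \<comment> \<open>The isomorphism is \<open>c \<otimes> m \<mapsto> c\<cdot>\<phi>(m)\<close>; its inverse \<open>\<theta>\<close> below is \<open>x \<mapsto> \<Sum> x\<^sub>g \<otimes> e\<^sub>g\<close>.\<close>
  obtain B where B: "B \<in> hom ?T (add_monoid RG)"
    and B_pure: "\<And>c m. \<lbrakk>c \<in> carrier K; m \<in> carrier M\<rbrakk> \<Longrightarrow> B (tf.pure c m) = scale c (\<phi> m)"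
  proof (rule tf.tensor_universal[OF KG_group, of "\<lambda>c m. scale c (\<phi> m)"])
    show "scale m (\<phi> n) \<in> carrier (add_monoid RG)" if "m \<in> carrier ?K" "n \<in> carrier ?M" for m n
      using that \<phi> by simp
    show "scale (m \<otimes>\<^bsub>?K\<^esub> m') (\<phi> n) = scale m (\<phi> n) \<otimes>\<^bsub>add_monoid RG\<^esub> scale m' (\<phi> n)"
      if "m \<in> carrier ?K" "m' \<in> carrier ?K" "n \<in> carrier ?M" for m m' n
      using that \<phi>(1)[of n] by (auto simp: scale_def ga_add R.l_distr)
    show "scale m (\<phi> (n \<otimes>\<^bsub>?M\<^esub> n')) = scale m (\<phi> n) \<otimes>\<^bsub>add_monoid RG\<^esub> scale m (\<phi> n')"
      if "m \<in> carrier ?K" "n \<in> carrier ?M" "n' \<in> carrier ?M" for m n n'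
      using that \<phi>(1)[of n] \<phi>(1)[of n'] by (auto simp: scale_def ga_add R.r_distr \<phi>_mult)
    show "scale (ract ?K m b) (\<phi> n) = scale m (\<phi> (lact ?M b n))"
      if "m \<in> carrier ?K" "b \<in> carrier \<O>" "n \<in> carrier ?M" for m b n
      using that \<phi>(1)[of n] by (auto simp: scale_def \<phi>_scalar R.m_assoc)
  qed auto
  define e where "e g = f (ga_single K G \<one>\<^bsub>K\<^esub> g)" for g
  have e: "e g \<in> carrier M" for g by (simp add: e_def f_closed)
  have lact_e: "lact M (ga_single K G r \<one>\<^bsub>G\<^esub>) (e g) = f (ga_single K G r g)" if "r \<in> S" "g \<in> carrier G" for r g
  proof -
    have "ga_extend G \<psi> (ga_single K G r \<one>\<^bsub>G\<^esub>) \<otimes>\<^bsub>OG\<^esub> ga_single K G \<one>\<^bsub>K\<^esub> g = ga_single K G r g"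
      using that O.single_mult_single[of r "\<one>\<^bsub>K\<^esub>" "\<one>\<^bsub>G\<^esub>" g] extend_single[OF \<psi>, of r "\<one>\<^bsub>G\<^esub>"] by (simp add: \<psi>_one)
    then show ?thesis using f_lact[of "ga_single K G r \<one>\<^bsub>G\<^esub>" "ga_single K G \<one>\<^bsub>K\<^esub> g"] that by (simp add: e_def)
  qed
  define \<theta> where "\<theta> x = (\<Otimes>\<^bsub>?T\<^esub>g \<in> carrier G. tf.pure (x g) (e g))" for x
  have \<theta>: "\<theta> \<in> hom (add_monoid RG) ?T"
  proof (rule homI)
    show "\<theta> x \<in> carrier ?T" if "x \<in> carrier (add_monoid RG)" for x
      unfolding \<theta>_def using that e by (auto intro!: tf.T.finprod_closed)
    show "\<theta> (x \<otimes>\<^bsub>add_monoid RG\<^esub> y) = \<theta> x \<otimes>\<^bsub>?T\<^esub> \<theta> y"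
      if "x \<in> carrier (add_monoid RG)" "y \<in> carrier (add_monoid RG)" for x y
    proof -
      have "\<theta> (x \<otimes>\<^bsub>add_monoid RG\<^esub> y) =
          (\<Otimes>\<^bsub>?T\<^esub>g \<in> carrier G. tf.pure (x g) (e g) \<otimes>\<^bsub>?T\<^esub> tf.pure (y g) (e g))"
        unfolding \<theta>_def using that e tf.pure_add_left[of "x g" "y g" "e g" for g]
        by (intro tf.T.finprod_cong') (auto simp: ga_coeff)
      also have "\<dots> = \<theta> x \<otimes>\<^bsub>?T\<^esub> \<theta> y"
        unfolding \<theta>_def using that e by (intro tf.T.finprod_multf) auto
      finally show ?thesis .
    qed
  qed
  have \<theta>_B: "\<theta> (B (tf.pure c m)) = tf.pure c m" if c: "c \<in> carrier ?K" and m: "m \<in> carrier ?M" for c m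
  proof -
    have pure_hom: "tf.pure c \<in> hom M ?T"
      using c tf.pure_add_right[of c] by (intro homI) auto
    have "\<theta> (B (tf.pure c m)) = (\<Otimes>\<^bsub>?T\<^esub>g \<in> carrier G. tf.pure c (f (ga_single K G (\<phi> m g) g)))"
      unfolding \<theta>_def
    proof (rule tf.T.finprod_cong'[OF refl])
      fix g assume g: "g \<in> carrier G"
      then show "tf.pure (B (tf.pure c m) g) (e g) = tf.pure c (f (ga_single K G (\<phi> m g) g))"
        using c m \<phi>(1)[of m] tf.pure_balanced[of c "\<phi> m g" "e g"] e
        by (simp add: B_pure scale_def lact_e)
    qed (use c m \<phi> f_closed in auto)
    also have "\<dots> = tf.pure c (\<Otimes>\<^bsub>M\<^esub>g \<in> carrier G. f (ga_single K G (\<phi> m g) g))"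
      using m \<phi> f_closed by (intro hom_finprod[symmetric] M.M.comm_group_axioms tf.T.comm_group_axioms pure_hom) auto
    also have "(\<Otimes>\<^bsub>M\<^esub>g \<in> carrier G. f (ga_single K G (\<phi> m g) g)) =
        f (\<Oplus>\<^bsub>OG\<^esub>g \<in> carrier G. ga_single K G (\<phi> m g) g)"
      using m \<phi> hom_finprod[OF O.A.a_comm_group M.M.comm_group_axioms f_hom, of "\<lambda>g. ga_single K G (\<phi> m g) g" "carrier G"]
      by (auto simp: finsum_def)
    also have "(\<Oplus>\<^bsub>OG\<^esub>g \<in> carrier G. ga_single K G (\<phi> m g) g) = \<phi> m"
      using O.ga_expand[of "\<phi> m"] m \<phi> by simp
    finally show ?thesis using m \<phi> by simp
  qed
  have B_\<theta>: "B (\<theta> x) = x" if x: "x \<in> carrier (add_monoid RG)" for x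
  proof -
    have "B (\<theta> x) = (\<Oplus>\<^bsub>RG\<^esub>g \<in> carrier G. B (tf.pure (x g) (e g)))"
      unfolding \<theta>_def using x e
      by (subst hom_finprod[OF tf.T.comm_group_axioms KG_group B]) (auto simp: finsum_def)
    also have "\<dots> = (\<Oplus>\<^bsub>RG\<^esub>g \<in> carrier G. ga_single K G (x g) g)"
    proof (rule A.finsum_cong'[OF refl])
      fix g assume g: "g \<in> carrier G"
      have "scale (x g) (ga_single K G \<one>\<^bsub>K\<^esub> g) = ga_single K G (x g) g"
        using g x by (auto simp: scale_def ga_single_def)
      then show "B (tf.pure (x g) (e g)) = ga_single K G (x g) g"
        using g x e by (simp add: B_pure) (simp add: e_def \<phi>_f)
    qed (use x in auto)
    also have "\<dots> = x" using ga_expand[of x] x by simp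
    finally show ?thesis .
  qed
  have B_iso: "B \<in> iso ?T (add_monoid RG)"
    by (rule tf.tensor_iso[OF KG_group B \<theta> \<theta>_B B_\<theta>])
  have B_closed: "B U \<in> carrier RG" if "U \<in> carrier ?T" for U
    using hom_in_carrier[OF B that] by simp
  have BC_simps: "carrier ?BC = carrier ?T" "monoid.mult ?BC = monoid.mult ?T" "one ?BC = one ?T"
    "lact ?BC x U = (\<Otimes>\<^bsub>?T\<^esub>g \<in> carrier G.
        tensor_map \<O> ?K ?M (\<lambda>c. x g \<otimes>\<^bsub>K\<^esub> c) (lact M (ga_single K G \<one>\<^bsub>K\<^esub> g)) U)"
    "ract ?BC U x = (\<Otimes>\<^bsub>?T\<^esub>g \<in> carrier G.
        tensor_map \<O> ?K ?M (\<lambda>c. c \<otimes>\<^bsub>K\<^esub> x g) (\<lambda>m. ract M m (ga_single K G \<one>\<^bsub>K\<^esub> g)) U)" for x U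
    by (simp_all add: base_change_def Let_def)
  have l_hom: "(\<lambda>y. z \<otimes>\<^bsub>RG\<^esub> y) \<in> hom (add_monoid RG) (add_monoid RG)"
    and r_hom: "(\<lambda>y. y \<otimes>\<^bsub>RG\<^esub> z) \<in> hom (add_monoid RG) (add_monoid RG)" if "z \<in> carrier RG" for z
    using that by (auto intro!: homI simp: A.r_distr A.l_distr)
  have lact_BC: "lact ?BC x U \<in> carrier ?BC \<and> B (lact ?BC x U) = ga_extend G \<psi> x \<otimes>\<^bsub>RG\<^esub> B U"
    if x: "x \<in> carrier RG" and U: "U \<in> carrier ?BC" for x U
  proof -
    let ?t = "\<lambda>g. tensor_map \<O> ?K ?M (\<lambda>c. x g \<otimes>\<^bsub>K\<^esub> c) (lact M (ga_single K G \<one>\<^bsub>K\<^esub> g))"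
    have UT: "U \<in> carrier ?T" using U by (simp add: BC_simps)
    have t: "?t g \<in> hom ?T ?T" "\<And>c m. \<lbrakk>c \<in> carrier K; m \<in> carrier M\<rbrakk> \<Longrightarrow>
        ?t g (tf.pure c m) = tf.pure (x g \<otimes>\<^bsub>K\<^esub> c) (lact M (ga_single K G \<one>\<^bsub>K\<^esub> g) m)" if g: "g \<in> carrier G" for g
    proof -
      have 1: "(\<lambda>c. x g \<otimes>\<^bsub>K\<^esub> c) \<in> hom ?K ?K" using x g by (auto intro!: homI simp: R.r_distr)
      have 2: "lact M (ga_single K G \<one>\<^bsub>K\<^esub> g) \<in> hom ?M ?M"
        by (auto intro!: homI simp: M.lact_closed M.lact_distr)
      have 3: "x g \<otimes>\<^bsub>K\<^esub> ract ?K m b = ract ?K (x g \<otimes>\<^bsub>K\<^esub> m) b" if "m \<in> carrier ?K" "b \<in> carrier \<O>" for m b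
        using that x g by (simp add: R.m_assoc)
      have 4: "lact M (ga_single K G \<one>\<^bsub>K\<^esub> g) (lact ?M b n) = lact ?M b (lact M (ga_single K G \<one>\<^bsub>K\<^esub> g) n)"
        if "n \<in> carrier ?M" "b \<in> carrier \<O>" for n b
        using that g O.scalar_central[of b "ga_single K G \<one>\<^bsub>K\<^esub> g"] by (simp add: M.lact_mult[symmetric])
      show "?t g \<in> hom ?T ?T" by (rule tf.tensor_map_hom(1)[OF 1 2 3 4])
      show "?t g (tf.pure c m) = tf.pure (x g \<otimes>\<^bsub>K\<^esub> c) (lact M (ga_single K G \<one>\<^bsub>K\<^esub> g) m)"
        if "c \<in> carrier K" "m \<in> carrier M" for c m
        using tf.tensor_map_hom(2)[OF 1 2 3 4] that by simp
    qed
    have B_t: "B (?t g U) = ga_single K G (x g) (\<psi> g) \<otimes>\<^bsub>RG\<^esub> B U" if g: "g \<in> carrier G" for g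
    proof -
      have xg: "ga_single K G (x g) (\<psi> g) \<in> carrier RG" using x g by simp
      have "(B \<circ> ?t g) U = ((\<lambda>y. ga_single K G (x g) (\<psi> g) \<otimes>\<^bsub>RG\<^esub> y) \<circ> B) U"
      proof (rule tf.tensor_hom_eq[OF _ Group.hom_compose[OF t(1)[OF g] B] Group.hom_compose[OF B l_hom[OF xg]] _ UT])
        fix c m assume cm: "c \<in> carrier ?K" "m \<in> carrier ?M"
        have "scale (x g \<otimes>\<^bsub>K\<^esub> c) (\<phi> (lact M (ga_single K G \<one>\<^bsub>K\<^esub> g) m)) h =
            (ga_single K G (x g) (\<psi> g) \<otimes>\<^bsub>RG\<^esub> scale c (\<phi> m)) h" if h: "h \<in> carrier G" for h
        proof -
          have "\<phi> (lact M (ga_single K G \<one>\<^bsub>K\<^esub> g) m) h = \<phi> m (inv\<^bsub>G\<^esub> \<psi> g \<otimes>\<^bsub>G\<^esub> h)"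
            using cm g h \<phi>(1)[of m] \<psi>_closed[OF g] O.single_mult[of "\<one>\<^bsub>K\<^esub>" "\<psi> g" "\<phi> m" h] extend_single[OF \<psi>, of "\<one>\<^bsub>K\<^esub>" g]
            by (simp add: \<phi>_lact)
          then show ?thesis
            using cm g h x \<phi>(1)[of m] \<psi>_closed[OF g] by (simp add: single_mult R.m_assoc)
        qed
        then have "scale (x g \<otimes>\<^bsub>K\<^esub> c) (\<phi> (lact M (ga_single K G \<one>\<^bsub>K\<^esub> g) m)) =
            ga_single K G (x g) (\<psi> g) \<otimes>\<^bsub>RG\<^esub> scale c (\<phi> m)"
          using cm g x \<phi>(1) M.lact_closed by (intro ga_eqI) simp_all
        then show "(B \<circ> ?t g) (tf.pure c m) = ((\<lambda>y. ga_single K G (x g) (\<psi> g) \<otimes>\<^bsub>RG\<^esub> y) \<circ> B) (tf.pure c m)"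
          using cm g x by (simp add: t(2) B_pure M.lact_closed)
      qed (rule A.add.is_group)
      then show ?thesis by simp
    qed
    have t_closed: "(\<lambda>g. ?t g U) \<in> carrier G \<rightarrow> carrier ?T"
      using hom_in_carrier[OF t(1) UT] by blast
    have "B (lact ?BC x U) = (\<Oplus>\<^bsub>RG\<^esub>g\<in>carrier G. B (?t g U))"
      unfolding BC_simps using hom_finprod[OF tf.T.comm_group_axioms KG_group B t_closed] by (simp add: finsum_def)
    also have "\<dots> = (\<Oplus>\<^bsub>RG\<^esub>g\<in>carrier G. ga_single K G (x g) (\<psi> g) \<otimes>\<^bsub>RG\<^esub> B U)"
      using B_t x UT B_closed \<psi>_closed by (intro A.finsum_cong') auto
    also have "\<dots> = (\<Oplus>\<^bsub>RG\<^esub>g\<in>carrier G. ga_single K G (x g) (\<psi> g)) \<otimes>\<^bsub>RG\<^esub> B U"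
      using x UT B_closed \<psi>_closed finite_carrier by (intro A.finsum_ldistr[symmetric]) auto
    also have "(\<Oplus>\<^bsub>RG\<^esub>g\<in>carrier G. ga_single K G (x g) (\<psi> g)) =
        (\<Oplus>\<^bsub>RG\<^esub>g\<in>carrier G. ga_single K G (ga_extend G \<psi> x (\<psi> g)) (\<psi> g))"
      using x \<psi> \<psi>_closed by (intro A.finsum_cong') (auto simp: extend_coeff)
    also have "\<dots> = (\<Oplus>\<^bsub>RG\<^esub>g\<in>carrier G. ga_single K G (ga_extend G \<psi> x g) g)"
      using x \<psi> by (intro A.finsum_reindex_bij_betw[OF autoE(1)[OF \<psi>]]) auto
    also have "\<dots> = ga_extend G \<psi> x" using ga_expand[of "ga_extend G \<psi> x"] x \<psi> by simp
    finally have "B (lact ?BC x U) = ga_extend G \<psi> x \<otimes>\<^bsub>RG\<^esub> B U" .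
    moreover have "lact ?BC x U \<in> carrier ?BC"
      unfolding BC_simps using t_closed by (rule tf.T.finprod_closed)
    ultimately show ?thesis by simp
  qed
  have ract_BC: "ract ?BC U x \<in> carrier ?BC \<and> B (ract ?BC U x) = B U \<otimes>\<^bsub>RG\<^esub> x"
    if x: "x \<in> carrier RG" and U: "U \<in> carrier ?BC" for x U
  proof -
    let ?t = "\<lambda>g. tensor_map \<O> ?K ?M (\<lambda>c. c \<otimes>\<^bsub>K\<^esub> x g) (\<lambda>m. ract M m (ga_single K G \<one>\<^bsub>K\<^esub> g))"
    have UT: "U \<in> carrier ?T" using U by (simp add: BC_simps)
    have t: "?t g \<in> hom ?T ?T" "\<And>c m. \<lbrakk>c \<in> carrier K; m \<in> carrier M\<rbrakk> \<Longrightarrow>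
        ?t g (tf.pure c m) = tf.pure (c \<otimes>\<^bsub>K\<^esub> x g) (ract M m (ga_single K G \<one>\<^bsub>K\<^esub> g))" if g: "g \<in> carrier G" for g
    proof -
      have 1: "(\<lambda>c. c \<otimes>\<^bsub>K\<^esub> x g) \<in> hom ?K ?K" using x g by (auto intro!: homI simp: R.l_distr)
      have 2: "(\<lambda>m. ract M m (ga_single K G \<one>\<^bsub>K\<^esub> g)) \<in> hom ?M ?M"
        by (auto intro!: homI simp: M.ract_closed M.ract_distr)
      have 3: "ract ?K m b \<otimes>\<^bsub>K\<^esub> x g = ract ?K (m \<otimes>\<^bsub>K\<^esub> x g) b" if "m \<in> carrier ?K" "b \<in> carrier \<O>" for m b
        using that x g by (simp add: R.m_ac)
      have 4: "ract M (lact ?M b n) (ga_single K G \<one>\<^bsub>K\<^esub> g) = lact ?M b (ract M n (ga_single K G \<one>\<^bsub>K\<^esub> g))"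
        if "n \<in> carrier ?M" "b \<in> carrier \<O>" for n b
        using that by (simp add: M.lact_ract)
      show "?t g \<in> hom ?T ?T" by (rule tf.tensor_map_hom(1)[OF 1 2 3 4])
      show "?t g (tf.pure c m) = tf.pure (c \<otimes>\<^bsub>K\<^esub> x g) (ract M m (ga_single K G \<one>\<^bsub>K\<^esub> g))"
        if "c \<in> carrier K" "m \<in> carrier M" for c m
        using tf.tensor_map_hom(2)[OF 1 2 3 4] that by simp
    qed
    have B_t: "B (?t g U) = B U \<otimes>\<^bsub>RG\<^esub> ga_single K G (x g) g" if g: "g \<in> carrier G" for g
    proof -
      have xg: "ga_single K G (x g) g \<in> carrier RG" using x g by simp
      have "(B \<circ> ?t g) U = ((\<lambda>y. y \<otimes>\<^bsub>RG\<^esub> ga_single K G (x g) g) \<circ> B) U"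
      proof (rule tf.tensor_hom_eq[OF _ Group.hom_compose[OF t(1)[OF g] B] Group.hom_compose[OF B r_hom[OF xg]] _ UT])
        fix c m assume cm: "c \<in> carrier ?K" "m \<in> carrier ?M"
        have "scale (c \<otimes>\<^bsub>K\<^esub> x g) (\<phi> (ract M m (ga_single K G \<one>\<^bsub>K\<^esub> g))) h =
            (scale c (\<phi> m) \<otimes>\<^bsub>RG\<^esub> ga_single K G (x g) g) h" if h: "h \<in> carrier G" for h
        proof -
          have "\<phi> (ract M m (ga_single K G \<one>\<^bsub>K\<^esub> g)) h = \<phi> m (h \<otimes>\<^bsub>G\<^esub> inv\<^bsub>G\<^esub> g)"
            using cm g h \<phi>(1)[of m] O.mult_single[of "\<one>\<^bsub>K\<^esub>" g "\<phi> m" h] by (simp add: \<phi>_ract)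
          then show ?thesis
            using cm g h x \<phi>(1)[of m] by (simp add: mult_single R.m_ac)
        qed
        then have "scale (c \<otimes>\<^bsub>K\<^esub> x g) (\<phi> (ract M m (ga_single K G \<one>\<^bsub>K\<^esub> g))) =
            scale c (\<phi> m) \<otimes>\<^bsub>RG\<^esub> ga_single K G (x g) g"
          using cm g x \<phi>(1) M.ract_closed by (intro ga_eqI) simp_all
        then show "(B \<circ> ?t g) (tf.pure c m) = ((\<lambda>y. y \<otimes>\<^bsub>RG\<^esub> ga_single K G (x g) g) \<circ> B) (tf.pure c m)"
          using cm g x by (simp add: t(2) B_pure M.ract_closed)
      qed (rule A.add.is_group)
      then show ?thesis by simp
    qed
    have t_closed: "(\<lambda>g. ?t g U) \<in> carrier G \<rightarrow> carrier ?T"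
      using hom_in_carrier[OF t(1) UT] by blast
    have "B (ract ?BC U x) = (\<Oplus>\<^bsub>RG\<^esub>g\<in>carrier G. B (?t g U))"
      unfolding BC_simps using hom_finprod[OF tf.T.comm_group_axioms KG_group B t_closed] by (simp add: finsum_def)
    also have "\<dots> = (\<Oplus>\<^bsub>RG\<^esub>g\<in>carrier G. B U \<otimes>\<^bsub>RG\<^esub> ga_single K G (x g) g)"
      using B_t x UT B_closed by (intro A.finsum_cong') auto
    also have "\<dots> = B U \<otimes>\<^bsub>RG\<^esub> (\<Oplus>\<^bsub>RG\<^esub>g\<in>carrier G. ga_single K G (x g) g)"
      using x UT B_closed finite_carrier by (intro A.finsum_rdistr[symmetric]) auto
    also have "\<dots> = B U \<otimes>\<^bsub>RG\<^esub> x" using ga_expand[OF x] by simp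
    finally have "B (ract ?BC U x) = B U \<otimes>\<^bsub>RG\<^esub> x" .
    moreover have "ract ?BC U x \<in> carrier ?BC"
      unfolding BC_simps using t_closed by (rule tf.T.finprod_closed)
    ultimately show ?thesis by simp
  qed
  have "comm_group ?BC"
    by (rule comm_group_cong[OF tf.T.comm_group_axioms]) (simp_all add: BC_simps)
  moreover have "B \<in> iso ?BC (add_monoid RG)"
    using B_iso by (simp add: iso_def hom_def BC_simps)
  ultimately show thesis using that lact_BC ract_BC by blast
qed

text \<open>The bimodule \<open>K \<otimes>\<^sub>\<O> M\<close> is \<open>KG\<close> twisted by \<open>\<psi>\<close>, which is free of rank one on the right; so its
  tensor product with \<open>V\<close> is \<open>V\<close> twisted by \<open>\<psi>\<close>.\<close>

lemma trivial_on_Irr_twisted: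
  assumes \<psi>: "\<psi> \<in> Aut_c G" and M: "bimodule OG OG M"
    and iso: "bimod_iso OG OG (twisted_bimod (ga_extend G \<psi>) OG) M"
  shows "trivial_on_Irr K S G M"
  unfolding trivial_on_Irr_def
proof (intro ballI allI impI; elim conjE)
  fix \<chi> and V :: "('g \<Rightarrow> 'k, 'g \<Rightarrow> 'k) lmod"
  assume V: "affords K G V \<chi>"
  have auto: "\<psi> \<in> auto G" using \<psi> by (simp add: Aut_c_def)
  let ?BC = "base_change K S G M"
  obtain B where BC: "comm_group ?BC" and B: "B \<in> iso ?BC (add_monoid RG)"
    and lact: "\<And>x U. \<lbrakk>x \<in> carrier RG; U \<in> carrier ?BC\<rbrakk> \<Longrightarrow>
      lact ?BC x U \<in> carrier ?BC \<and> B (lact ?BC x U) = ga_extend G \<psi> x \<otimes>\<^bsub>RG\<^esub> B U"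
    and ract: "\<And>x U. \<lbrakk>x \<in> carrier RG; U \<in> carrier ?BC\<rbrakk> \<Longrightarrow>
      ract ?BC U x \<in> carrier ?BC \<and> B (ract ?BC U x) = B U \<otimes>\<^bsub>RG\<^esub> x"
    using base_change_twisted[OF auto M iso] by blast
  have B_hom: "B \<in> hom ?BC (add_monoid RG)" using B by (simp add: iso_def)
  have B_closed: "B U \<in> carrier RG" if "U \<in> carrier ?BC" for U
    using hom_in_carrier[OF B_hom that] by simp
  have B_inj: "U = U'" if "B U = B U'" "U \<in> carrier ?BC" "U' \<in> carrier ?BC" for U U'
    using B that by (auto simp: iso_def bij_betw_def inj_on_def)
  interpret BC: comm_group ?BC by (rule BC)
  interpret V: left_module RG V using V by (simp add: affords_def)
  interpret tf: tensor_factors RG ?BC V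
    by (rule tensor_factors.intro) (simp_all add: BC V.M.comm_group_axioms ract V.lact_closed)
  obtain m0 where m0: "m0 \<in> carrier ?BC" "B m0 = \<one>\<^bsub>RG\<^esub>"
  proof -
    have "\<one>\<^bsub>RG\<^esub> \<in> B ` carrier ?BC" using B by (simp add: iso_def bij_betw_def)
    then show thesis using that by auto
  qed
  have "ract ?BC m0 (B m) = m" if "m \<in> carrier ?BC" for m
    using that m0 ract[of "B m" m0] B_closed by (intro B_inj) auto
  then obtain F where F: "F \<in> iso tf.T V"
    and F_pure: "\<And>m n. \<lbrakk>m \<in> carrier ?BC; n \<in> carrier V\<rbrakk> \<Longrightarrow> F (tf.pure m n) = lact V (B m) n"
    and F_m0: "\<And>U. U \<in> carrier tf.T \<Longrightarrow> tf.pure m0 (F U) = U"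
    using tf.tensor_free_rank_one[OF V.left_module_axioms B_hom _ m0] ract by metis
  have F_closed: "F U \<in> carrier V" if "U \<in> carrier tf.T" for U
    using F that hom_in_carrier[of F tf.T V] by (simp add: iso_def)
  let ?W = "tensor_lmod RG ?BC V"
  have W: "carrier ?W = carrier tf.T" "monoid.mult ?W = monoid.mult tf.T" "one ?W = one tf.T"
    "lact ?W x w = tensor_map RG ?BC V (lact ?BC x) (\<lambda>n. n) w" for x w
    by (simp_all add: tensor_lmod_def)
  have lact_W: "lact ?W x w \<in> carrier ?W \<and> F (lact ?W x w) = lact V (ga_extend G \<psi> x) (F w)"
    if x: "x \<in> carrier RG" and w: "w \<in> carrier ?W" for x w
  proof -
    have 1: "lact ?BC x \<in> hom ?BC ?BC"
    proof (rule homI)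
      fix U U' assume U: "U \<in> carrier ?BC" "U' \<in> carrier ?BC"
      show "lact ?BC x U \<in> carrier ?BC" using lact x U by blast
      have "B (lact ?BC x (U \<otimes>\<^bsub>?BC\<^esub> U')) = B (lact ?BC x U \<otimes>\<^bsub>?BC\<^esub> lact ?BC x U')"
        using U x lact hom_mult[OF B_hom] B_closed auto by (simp add: A.r_distr)
      then show "lact ?BC x (U \<otimes>\<^bsub>?BC\<^esub> U') = lact ?BC x U \<otimes>\<^bsub>?BC\<^esub> lact ?BC x U'"
        using U x lact by (intro B_inj) auto
    qed
    have 2: "(\<lambda>n. n) \<in> hom V V" by (rule homI) auto
    have 3: "lact ?BC x (ract ?BC m b) = ract ?BC (lact ?BC x m) b"
      if "m \<in> carrier ?BC" "b \<in> carrier RG" for m b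
      using that x lact ract B_closed auto by (intro B_inj) (auto simp: A.m_assoc)
    note t = tf.tensor_map_hom[OF 1 2 3 refl]
    have wT: "w \<in> carrier tf.T" using w by (simp add: W)
    have "lact ?W x w = lact ?W x (tf.pure m0 (F w))" using F_m0[OF wT] by simp
    also have "\<dots> = tf.pure (lact ?BC x m0) (F w)"
      unfolding W using m0 F_closed[OF wT] by (intro t(2))
    finally have "F (lact ?W x w) = lact V (ga_extend G \<psi> x) (F w)"
      using m0 F_closed[OF wT] lact[OF x m0(1)] x auto by (simp add: F_pure)
    moreover have "lact ?W x w \<in> carrier ?W" unfolding W using hom_in_carrier[OF t(1) wT] .
    ultimately show ?thesis by simp
  qed
  show "affords K G ?W \<chi>"
  proof (rule affords_twist[OF V \<psi>])
    show "comm_group ?W" by (rule comm_group_cong[OF tf.T.comm_group_axioms]) (simp_all add: W)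
    show "F \<in> iso ?W V" using F by (simp add: iso_def hom_def W)
  qed (use lact_W in auto)
qed

end

section \<open>Class-preserving automorphisms\<close>

context group begin

lemma inv_mult_cancel [simp]:
  assumes "x \<in> carrier G" "y \<in> carrier G"
  shows "x \<otimes> (inv x \<otimes> y) = y" "inv x \<otimes> (x \<otimes> y) = y"
  using assms by (simp_all add: m_assoc[symmetric])

definition inner :: "'a \<Rightarrow> 'a \<Rightarrow> 'a"
  where "inner y = (\<lambda>x \<in> carrier G. y \<otimes> x \<otimes> inv y)"

lemma Inn_eq: "Inn G = inner ` carrier G"
  by (auto simp: Inn_def inner_def)

lemma inner_auto: "y \<in> carrier G \<Longrightarrow> inner y \<in> auto G"
proof -
  assume y: "y \<in> carrier G"
  have "bij_betw (inner y) (carrier G) (carrier G)"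
    using y by (intro bij_betw_byWitness[where f' = "\<lambda>x. inv y \<otimes> x \<otimes> y"])
      (auto simp: inner_def m_assoc)
  moreover have "inner y \<in> hom G G"
    using y by (intro homI) (auto simp: inner_def m_assoc)
  ultimately show ?thesis by (simp add: auto_def Bij_def inner_def)
qed

lemma inner_conj_class:
  assumes "y \<in> carrier G" "x \<in> carrier G" shows "inner y ` conj_class G x = conj_class G x"
proof
  show "inner y ` conj_class G x \<subseteq> conj_class G x"
  proof clarify
    fix z assume "z \<in> conj_class G x"
    then obtain w where w: "w \<in> carrier G" "z = w \<otimes> x \<otimes> inv w" by (auto simp: conj_class_def)
    then have "inner y z = (y \<otimes> w) \<otimes> x \<otimes> inv (y \<otimes> w)"
      using assms by (simp add: inner_def inv_mult_group m_assoc)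
    then show "inner y z \<in> conj_class G x" using w assms by (auto simp: conj_class_def)
  qed
  show "conj_class G x \<subseteq> inner y ` conj_class G x"
  proof
    fix z assume "z \<in> conj_class G x"
    then obtain w where w: "w \<in> carrier G" "z = w \<otimes> x \<otimes> inv w" by (auto simp: conj_class_def)
    let ?w = "inv y \<otimes> w"
    have "z = inner y (?w \<otimes> x \<otimes> inv ?w)"
      using assms w by (simp add: inner_def inv_mult_group m_assoc)
    moreover have "?w \<otimes> x \<otimes> inv ?w \<in> conj_class G x" using assms w unfolding conj_class_def by blast
    ultimately show "z \<in> inner y ` conj_class G x" by blast
  qed
qed

lemma Inn_subset_Aut_c: "Inn G \<subseteq> Aut_c G"
proof
  fix \<phi> assume "\<phi> \<in> Inn G"
  then obtain y where "y \<in> carrier G" "\<phi> = inner y" by (auto simp: Inn_eq)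
  then show "\<phi> \<in> Aut_c G" by (simp add: Aut_c_def inner_auto inner_conj_class)
qed

lemma AutoGroup_mult: "\<lbrakk>\<phi> \<in> auto G; \<psi> \<in> auto G\<rbrakk> \<Longrightarrow> \<phi> \<otimes>\<^bsub>AutoGroup G\<^esub> \<psi> = compose (carrier G) \<phi> \<psi>"
  by (simp add: AutoGroup_def BijGroup_def auto_def)

lemma auto_compose: "\<lbrakk>\<phi> \<in> auto G; \<psi> \<in> auto G\<rbrakk> \<Longrightarrow> compose (carrier G) \<phi> \<psi> \<in> auto G"
  using monoid.m_closed[OF group.is_monoid[OF AutoGroup], of \<phi> \<psi>] AutoGroup_mult[of \<phi> \<psi>]
  by (simp add: AutoGroup_def)

lemma Aut_c_compose: "\<lbrakk>\<phi> \<in> Aut_c G; \<psi> \<in> Aut_c G\<rbrakk> \<Longrightarrow> compose (carrier G) \<phi> \<psi> \<in> Aut_c G"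
proof -
  assume a: "\<phi> \<in> Aut_c G" "\<psi> \<in> Aut_c G"
  have "compose (carrier G) \<phi> \<psi> ` conj_class G x = conj_class G x" if x: "x \<in> carrier G" for x
  proof -
    have "conj_class G x \<subseteq> carrier G" using x by (auto simp: conj_class_def)
    then have "compose (carrier G) \<phi> \<psi> ` conj_class G x = \<phi> ` \<psi> ` conj_class G x"
      by (force simp: compose_def image_iff)
    then show ?thesis using a x by (simp add: Aut_c_def)
  qed
  then show ?thesis using a auto_compose by (simp add: Aut_c_def)
qed

lemma Out_c_coset:
  assumes "\<psi> \<in> Aut_c G"
  shows "r_coset ((AutoGroup G)\<lparr>carrier := Aut_c G\<rparr>) (Inn G) \<psi> =
    (\<lambda>y. compose (carrier G) (inner y) \<psi>) ` carrier G"
  using assms inner_auto by (auto simp: r_coset_def Inn_eq AutoGroup_mult Aut_c_def)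

lemma Out_c_carrier:
  "carrier (Out_c G) = (\<lambda>\<psi>. (\<lambda>y. compose (carrier G) (inner y) \<psi>) ` carrier G) ` Aut_c G"
  unfolding Out_c_def carrier_FactGroup using Out_c_coset by auto

lemma one_Out_c: "\<one>\<^bsub>Out_c G\<^esub> = Inn G"
  by (simp add: Out_c_def)

lemma some_in_Out_c:
  assumes "C \<in> carrier (Out_c G)" shows "(SOME \<psi>. \<psi> \<in> C) \<in> C" "C \<subseteq> Aut_c G"
proof -
  obtain \<psi> where \<psi>: "\<psi> \<in> Aut_c G" "C = (\<lambda>y. compose (carrier G) (inner y) \<psi>) ` carrier G"
    using assms Out_c_carrier by auto
  then show "(SOME \<psi>. \<psi> \<in> C) \<in> C" by (metis imageI one_closed someI_ex)
  show "C \<subseteq> Aut_c G"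
    unfolding \<psi>(2) using Aut_c_compose[OF _ \<psi>(1)] Inn_subset_Aut_c Inn_eq by blast
qed

lemma Aut_c_in_class: "\<psi> \<in> Aut_c G \<Longrightarrow> \<psi> \<in> (\<lambda>y. compose (carrier G) (inner y) \<psi>) ` carrier G"
proof -
  assume \<psi>: "\<psi> \<in> Aut_c G"
  have "\<psi> = compose (carrier G) (inner \<one>) \<psi>"
    using \<psi> by (auto simp: compose_def inner_def Aut_c_def auto_def Bij_def bij_betw_def extensional_def fun_eq_iff)
  then show ?thesis by blast
qed

end

context scalar_extension begin

lemma auto_inverse:
  assumes "\<psi> \<in> auto G"
  obtains \<psi>' where "\<psi>' \<in> auto G" "\<And>x. x \<in> carrier G \<Longrightarrow> \<psi>' (\<psi> x) = x" "\<And>x. x \<in> carrier G \<Longrightarrow> \<psi> (\<psi>' x) = x"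
proof (rule that)
  let ?\<psi>' = "\<lambda>x\<in>carrier G. inv_into (carrier G) \<psi> x"
  have "\<psi> \<in> hom G G" "\<psi> \<in> Bij (carrier G)" using assms by (auto simp: auto_def)
  then show "?\<psi>' \<in> auto G"
    using G.restrict_inv_into_hom restrict_inv_into_Bij by (auto simp: auto_def)
  show "?\<psi>' (\<psi> x) = x" "\<psi> (?\<psi>' x) = x" if "x \<in> carrier G" for x
    using autoE(1)[OF assms] that by (auto simp: bij_betw_def f_inv_into_f)
qed

lemma extend_inverse:
  assumes "\<psi> \<in> auto G" "\<psi>' \<in> auto G" "\<And>x. x \<in> carrier G \<Longrightarrow> \<psi>' (\<psi> x) = x" "x \<in> carrier OG"
  shows "ga_extend G \<psi>' (ga_extend G \<psi> x) = x"
proof (rule ga_eqI)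
  fix g assume g: "g \<in> carrier G"
  have "ga_extend G \<psi>' (ga_extend G \<psi> x) (\<psi>' (\<psi> g)) = ga_extend G \<psi> x (\<psi> g)"
    using assms g hom_in_carrier[OF autoE(2)[OF assms(1)] g] by (intro extend_coeff)
  then show "ga_extend G \<psi>' (ga_extend G \<psi> x) g = x g"
    using assms g by (simp add: extend_coeff)
qed (use assms in auto)

lemma morita_bimod_extend:
  assumes "\<psi> \<in> auto G"
  shows "morita_bimod ((\<lambda>r. ga_single K G r \<one>\<^bsub>G\<^esub>) ` S) OG (twisted_bimod (ga_extend G \<psi>) OG)"
proof -
  obtain \<psi>' where \<psi>': "\<psi>' \<in> auto G" "\<And>x. x \<in> carrier G \<Longrightarrow> \<psi>' (\<psi> x) = x"
    "\<And>x. x \<in> carrier G \<Longrightarrow> \<psi> (\<psi>' x) = x" using auto_inverse[OF assms] by blast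
  have one: "\<psi> \<one>\<^bsub>G\<^esub> = \<one>\<^bsub>G\<^esub>"
    using hom_one[of \<psi> G G, OF autoE(2)[OF assms] G.is_group G.is_group] .
  show ?thesis
  proof (rule O.A.morita_bimod_twisted[OF ring_endomorphism_extend[OF assms] ring_endomorphism_extend[OF \<psi>'(1)]])
    show "ga_extend G \<psi>' (ga_extend G \<psi> x) = x" "ga_extend G \<psi> (ga_extend G \<psi>' x) = x"
      if "x \<in> carrier OG" for x
      using that assms \<psi>' by (auto intro: extend_inverse)
    show "r \<in> carrier OG \<and> ga_extend G \<psi> r = r" if "r \<in> (\<lambda>r. ga_single K G r \<one>\<^bsub>G\<^esub>) ` S" for r
      using that assms one by (auto simp: extend_single)
    show "r \<otimes>\<^bsub>OG\<^esub> x = x \<otimes>\<^bsub>OG\<^esub> r" if "r \<in> (\<lambda>r. ga_single K G r \<one>\<^bsub>G\<^esub>) ` S" "x \<in> carrier OG" for r x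
      using that O.scalar_central[of _ x] by auto
  qed
qed

lemma Out_c_to_Picent_closed:
  "Out_c_to_Picent K S G ` carrier (Out_c G) \<subseteq> carrier (Picent_group_algebra K S G)"
proof clarify
  fix C assume C: "C \<in> carrier (Out_c G)"
  define \<psi> where "\<psi> = (SOME \<psi>. \<psi> \<in> C)"
  have \<psi>: "\<psi> \<in> Aut_c G" using G.some_in_Out_c[OF C] by (auto simp: \<psi>_def)
  then have auto: "\<psi> \<in> auto G" by (simp add: Aut_c_def)
  show "Out_c_to_Picent K S G C \<in> carrier (Picent_group_algebra K S G)"
    unfolding Out_c_to_Picent_def Let_def Picent_group_algebra_def Pic_group_algebra_def Pic_def \<psi>_def[symmetric]
    using morita_bimod_extend[OF auto] trivial_on_Irr_twisted[OF \<psi>]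
    by (auto simp: bimod_class_def)
qed

text \<open>The representative that \<^const>\<open>Out_c_to_Picent\<close> picks from the class of \<open>\<psi>\<close> is \<open>\<psi>\<close> followed by
  conjugation by some \<open>y\<close>. If its bimodule were trivial, a unit \<open>u\<close> of \<open>\<O>G\<close> would realize this
  automorphism. The case \<open>u = 1\<close> of the hypothesis says that \<open>\<psi>\<close> is not inner in \<open>G\<close>.\<close>

lemma Out_c_to_Picent_nontrivial:
  assumes \<psi>: "\<psi> \<in> Aut_c G"
    and not_inner: "\<And>y u v. \<lbrakk>y \<in> carrier G; u \<in> carrier OG; v \<in> carrier OG; u \<otimes>\<^bsub>OG\<^esub> v = \<one>\<^bsub>OG\<^esub>;
      \<And>g. g \<in> carrier G \<Longrightarrow> ga_single K G \<one>\<^bsub>K\<^esub> g \<otimes>\<^bsub>OG\<^esub> u =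
        u \<otimes>\<^bsub>OG\<^esub> ga_single K G \<one>\<^bsub>K\<^esub> (y \<otimes>\<^bsub>G\<^esub> \<psi> g \<otimes>\<^bsub>G\<^esub> inv\<^bsub>G\<^esub> y)\<rbrakk> \<Longrightarrow> False"
  shows "Out_c_to_Picent K S G ` carrier (Out_c G) \<noteq> {\<one>\<^bsub>Picent_group_algebra K S G\<^esub>}"
    and "carrier (Out_c G) \<noteq> {\<one>\<^bsub>Out_c G\<^esub>}"
proof -
  define C where "C = (\<lambda>y. compose (carrier G) (G.inner y) \<psi>) ` carrier G"
  have C: "C \<in> carrier (Out_c G)" using \<psi> by (auto simp: C_def G.Out_c_carrier)
  define \<psi>' where "\<psi>' = (SOME \<psi>. \<psi> \<in> C)"
  have \<psi>'_C: "\<psi>' \<in> C" and \<psi>': "\<psi>' \<in> auto G"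
    using G.some_in_Out_c[OF C] by (auto simp: \<psi>'_def Aut_c_def)
  obtain y where y: "y \<in> carrier G" "\<psi>' = compose (carrier G) (G.inner y) \<psi>"
    using \<psi>'_C by (auto simp: C_def)
  have \<psi>_closed: "\<psi> g \<in> carrier G" if "g \<in> carrier G" for g
    using \<psi> hom_in_carrier[OF autoE(2) that] by (auto simp: Aut_c_def)
  have "Out_c_to_Picent K S G C \<noteq> \<one>\<^bsub>Picent_group_algebra K S G\<^esub>"
  proof
    assume "Out_c_to_Picent K S G C = \<one>\<^bsub>Picent_group_algebra K S G\<^esub>"
    then have "bimod_class OG (twisted_bimod (ga_extend G \<psi>') OG) = bimod_class OG (regular_bimod OG)"
      by (simp add: Out_c_to_Picent_def Let_def \<psi>'_def Picent_group_algebra_def Pic_group_algebra_def Pic_def)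
    moreover have "regular_bimod OG \<in> bimod_class OG (regular_bimod OG)"
      using O.A.bimodule_regular bimod_iso_refl by (auto simp: bimod_class_def)
    ultimately have "bimod_iso OG OG (twisted_bimod (ga_extend G \<psi>') OG) (regular_bimod OG)"
      by (auto simp: bimod_class_def)
    then obtain u v where uv: "u \<in> carrier OG" "v \<in> carrier OG" "u \<otimes>\<^bsub>OG\<^esub> v = \<one>\<^bsub>OG\<^esub>"
      "\<And>x. x \<in> carrier OG \<Longrightarrow> x \<otimes>\<^bsub>OG\<^esub> u = u \<otimes>\<^bsub>OG\<^esub> ga_extend G \<psi>' x"
      using O.A.twisted_iso_regular_imp_inner[OF ring_endomorphism_extend[OF \<psi>']] by blast
    show False
    proof (rule not_inner[OF y(1) uv(1-3)])
      fix g assume g: "g \<in> carrier G"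
      then show "ga_single K G \<one>\<^bsub>K\<^esub> g \<otimes>\<^bsub>OG\<^esub> u =
        u \<otimes>\<^bsub>OG\<^esub> ga_single K G \<one>\<^bsub>K\<^esub> (y \<otimes>\<^bsub>G\<^esub> \<psi> g \<otimes>\<^bsub>G\<^esub> inv\<^bsub>G\<^esub> y)"
      proof -
        have "\<psi>' g = y \<otimes>\<^bsub>G\<^esub> \<psi> g \<otimes>\<^bsub>G\<^esub> inv\<^bsub>G\<^esub> y"
          using y g \<psi>_closed[OF g] by (simp add: compose_def G.inner_def)
        then show ?thesis
          using uv(4)[of "ga_single K G \<one>\<^bsub>K\<^esub> g"] g by (simp add: extend_single[OF \<psi>'])
      qed
    qed
  qed
  then show "Out_c_to_Picent K S G ` carrier (Out_c G) \<noteq> {\<one>\<^bsub>Picent_group_algebra K S G\<^esub>}"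
    using C by blast
  have "\<psi> \<notin> Inn G"
  proof
    assume "\<psi> \<in> Inn G"
    then obtain x where x: "x \<in> carrier G" "\<psi> = G.inner x" by (auto simp: G.Inn_eq)
    show False
    proof (rule not_inner[of "inv\<^bsub>G\<^esub> x" "\<one>\<^bsub>OG\<^esub>" "\<one>\<^bsub>OG\<^esub>"])
      fix g assume g: "g \<in> carrier G"
      have "inv\<^bsub>G\<^esub> x \<otimes>\<^bsub>G\<^esub> \<psi> g \<otimes>\<^bsub>G\<^esub> inv\<^bsub>G\<^esub> (inv\<^bsub>G\<^esub> x) = g"
        using x g by (simp add: G.inner_def G.m_assoc)
      then show "ga_single K G \<one>\<^bsub>K\<^esub> g \<otimes>\<^bsub>OG\<^esub> \<one>\<^bsub>OG\<^esub> =
        \<one>\<^bsub>OG\<^esub> \<otimes>\<^bsub>OG\<^esub> ga_single K G \<one>\<^bsub>K\<^esub> (inv\<^bsub>G\<^esub> x \<otimes>\<^bsub>G\<^esub> \<psi> g \<otimes>\<^bsub>G\<^esub> inv\<^bsub>G\<^esub> (inv\<^bsub>G\<^esub> x))"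
        by simp
    qed (use x in auto)
  qed
  moreover have "\<psi> \<in> C" using G.Aut_c_in_class[OF \<psi>] by (simp add: C_def)
  ultimately show "carrier (Out_c G) \<noteq> {\<one>\<^bsub>Out_c G\<^esub>}"
    using C G.one_Out_c by auto
qed

end

section \<open>Group algebras with a normal elementary abelian p-subgroup\<close>

lemma (in ring) binomial_commuting:
  assumes x: "x \<in> carrier R" and y: "y \<in> carrier R" and xy: "x \<otimes> y = y \<otimes> x"
  shows "(x \<oplus> y) [^] (n::nat) = (\<Oplus>k\<in>{..n}. [(n choose k)] \<cdot>\<^bsub>R\<^esub> (x [^] k \<otimes> y [^] (n - k)))"
proof (induction n)
  case 0
  then show ?case by simp
next
  case (Suc n)
  define t where "t i j = x [^] (i::nat) \<otimes> y [^] (j::nat)" for i j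
  have t [simp]: "t i j \<in> carrier R" for i j using x y by (simp add: t_def)
  have yt: "y \<otimes> t i j = t i (Suc j)" for i j
  proof -
    have "y \<otimes> x [^] i = x [^] i \<otimes> y" using group_commutes_pow[OF xy x y] by simp
    then have "y \<otimes> t i j = x [^] i \<otimes> (y \<otimes> y [^] j)"
      using x y by (simp add: t_def m_assoc[symmetric])
    then show ?thesis using nat_pow_Suc2[OF y, of j] by (simp add: t_def)
  qed
  have xt: "x \<otimes> t i j = t (Suc i) j" for i j
    using x y nat_pow_Suc2[OF x, of i] by (simp add: t_def m_assoc)
  have S: "(\<Oplus>k\<in>{..n}. [(n choose k)] \<cdot>\<^bsub>R\<^esub> t k (n - k)) \<in> carrier R"
    by (auto intro!: finsum_closed)
  have "(x \<oplus> y) [^] Suc n = (x \<oplus> y) \<otimes> (\<Oplus>k\<in>{..n}. [(n choose k)] \<cdot>\<^bsub>R\<^esub> t k (n - k))"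
    using x y nat_pow_Suc2[of "x \<oplus> y" n] Suc by (simp add: t_def)
  also have "\<dots> = x \<otimes> (\<Oplus>k\<in>{..n}. [(n choose k)] \<cdot>\<^bsub>R\<^esub> t k (n - k)) \<oplus> y \<otimes> (\<Oplus>k\<in>{..n}. [(n choose k)] \<cdot>\<^bsub>R\<^esub> t k (n - k))"
    using x y S by (simp add: l_distr)
  also have "x \<otimes> (\<Oplus>k\<in>{..n}. [(n choose k)] \<cdot>\<^bsub>R\<^esub> t k (n - k)) = (\<Oplus>k\<in>{..n}. [(n choose k)] \<cdot>\<^bsub>R\<^esub> t (Suc k) (n - k))"
    using x by (subst finsum_rdistr) (auto simp: add_pow_rdistr xt)
  also have "y \<otimes> (\<Oplus>k\<in>{..n}. [(n choose k)] \<cdot>\<^bsub>R\<^esub> t k (n - k)) = (\<Oplus>k\<in>{..n}. [(n choose k)] \<cdot>\<^bsub>R\<^esub> t k (Suc n - k))"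
    using y by (subst finsum_rdistr) (auto simp: add_pow_rdistr yt Suc_diff_le intro!: finsum_cong')
  also have "\<dots> = (\<Oplus>k\<in>{..Suc n}. [(n choose k)] \<cdot>\<^bsub>R\<^esub> t k (Suc n - k))"
    by (subst finsum_Suc) (auto intro!: finsum_closed simp: binomial_eq_0)
  also have "\<dots> = (\<Oplus>k\<in>{..n}. [(n choose Suc k)] \<cdot>\<^bsub>R\<^esub> t (Suc k) (n - k)) \<oplus> t 0 (Suc n)"
    by (subst finsum_Suc2) auto
  also have "(\<Oplus>k\<in>{..n}. [(n choose k)] \<cdot>\<^bsub>R\<^esub> t (Suc k) (n - k)) \<oplus>
      ((\<Oplus>k\<in>{..n}. [(n choose Suc k)] \<cdot>\<^bsub>R\<^esub> t (Suc k) (n - k)) \<oplus> t 0 (Suc n)) =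
      (\<Oplus>k\<in>{..n}. [(n choose k)] \<cdot>\<^bsub>R\<^esub> t (Suc k) (n - k) \<oplus> [(n choose Suc k)] \<cdot>\<^bsub>R\<^esub> t (Suc k) (n - k)) \<oplus> t 0 (Suc n)"
    by (subst finsum_addf) (auto simp: a_assoc intro!: finsum_closed)
  also have "(\<Oplus>k\<in>{..n}. [(n choose k)] \<cdot>\<^bsub>R\<^esub> t (Suc k) (n - k) \<oplus> [(n choose Suc k)] \<cdot>\<^bsub>R\<^esub> t (Suc k) (n - k)) =
      (\<Oplus>k\<in>{..n}. [(Suc n choose Suc k)] \<cdot>\<^bsub>R\<^esub> t (Suc k) (Suc n - Suc k))"
    by (intro finsum_cong') (auto simp: add.nat_pow_mult)
  also have "\<dots> \<oplus> t 0 (Suc n) = (\<Oplus>k\<in>{..Suc n}. [(Suc n choose k)] \<cdot>\<^bsub>R\<^esub> t k (Suc n - k))"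
    by (subst finsum_Suc2) auto
  finally show ?case by (simp add: t_def)
qed

lemma (in ring) prime_power_commuting:
  assumes p: "Factorial_Ring.prime (p::nat)"
    and x: "x \<in> carrier R" and y: "y \<in> carrier R" and xy: "x \<otimes> y = y \<otimes> x"
  obtains z where "z \<in> carrier R" "(x \<oplus> y) [^] p = x [^] p \<oplus> y [^] p \<oplus> [p] \<cdot>\<^bsub>R\<^esub> z"
proof -
  obtain q where q: "p = Suc q" "q > 0" using prime_gt_1_nat[OF p] by (cases p) auto
  define t where "t k = [(p choose k)] \<cdot>\<^bsub>R\<^esub> (x [^] k \<otimes> y [^] (p - k))" for k
  define z where "z = (\<Oplus>k\<in>{1..q}. [((p choose k) div p)] \<cdot>\<^bsub>R\<^esub> (x [^] k \<otimes> y [^] (p - k)))"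
  have t_closed [simp]: "t k \<in> carrier R" for k using x y by (simp add: t_def)
  have z: "z \<in> carrier R" unfolding z_def using x y by (auto intro!: finsum_closed)
  have "(\<lambda>a. [p] \<cdot>\<^bsub>R\<^esub> a) \<in> hom (add_monoid R) (add_monoid R)"
    by (intro homI) (auto simp: add.nat_pow_distrib)
  then have "[p] \<cdot>\<^bsub>R\<^esub> z = (\<Oplus>k\<in>{1..q}. [p] \<cdot>\<^bsub>R\<^esub> ([((p choose k) div p)] \<cdot>\<^bsub>R\<^esub> (x [^] k \<otimes> y [^] (p - k))))"
    unfolding z_def using hom_finprod[OF a_comm_group a_comm_group, of "\<lambda>a. [p] \<cdot>\<^bsub>R\<^esub> a"
        "\<lambda>k. [((p choose k) div p)] \<cdot>\<^bsub>R\<^esub> (x [^] k \<otimes> y [^] (p - k))" "{1..q}"] x y by (simp add: finsum_def)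
  also have "\<dots> = (\<Oplus>k\<in>{1..q}. t k)"
  proof (rule finsum_cong'[OF refl])
    fix k assume k: "k \<in> {1..q}"
    then have "p dvd p choose k" using p q by (intro dvd_choose_prime) auto
    then show "[p] \<cdot>\<^bsub>R\<^esub> ([((p choose k) div p)] \<cdot>\<^bsub>R\<^esub> (x [^] k \<otimes> y [^] (p - k))) = t k"
      using x y by (simp add: t_def add.nat_pow_pow mult.commute)
  qed auto
  finally have pz: "[p] \<cdot>\<^bsub>R\<^esub> z = (\<Oplus>k\<in>{1..q}. t k)" .
  have "{..p} = insert 0 (insert p {1..q})" using q by auto
  then have "(\<Oplus>k\<in>{..p}. t k) = t 0 \<oplus> (t p \<oplus> (\<Oplus>k\<in>{1..q}. t k))"
    using q by simp
  also have "\<dots> = x [^] p \<oplus> y [^] p \<oplus> [p] \<cdot>\<^bsub>R\<^esub> z"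
    using x y z pz[symmetric] by (simp add: t_def a_ac)
  finally have "(x \<oplus> y) [^] p = x [^] p \<oplus> y [^] p \<oplus> [p] \<cdot>\<^bsub>R\<^esub> z"
    using binomial_commuting[OF x y xy, of p] by (simp add: t_def)
  then show thesis using that z by blast
qed

locale p_group_algebra = finite_group_algebra R G
  for R :: "('k, 'r) ring_scheme" (structure) and G :: "('g, 'm) monoid_scheme" (structure) +
  fixes D :: "'g set" and p :: nat and J :: "'k set"
  assumes p: "Factorial_Ring.prime p"
    and D_normal: "D \<lhd> G"
    and D_comm: "\<lbrakk>c \<in> D; d \<in> D\<rbrakk> \<Longrightarrow> c \<otimes>\<^bsub>G\<^esub> d = d \<otimes>\<^bsub>G\<^esub> c"
    and D_exponent: "d \<in> D \<Longrightarrow> d [^]\<^bsub>G\<^esub> p = \<one>\<^bsub>G\<^esub>"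
    and J: "ideal J R" "\<one>\<^bsub>R\<^esub> \<notin> J" "[p] \<cdot>\<^bsub>R\<^esub> \<one>\<^bsub>R\<^esub> \<in> J"
begin

sublocale D: normal D G by (rule D_normal)
sublocale J: ideal J R by (rule J(1))

lemma D_finite: "finite D"
  using finite_subset[OF D.subset finite_carrier] .

lemma conj_in_D: "\<lbrakk>g \<in> carrier G; d \<in> D\<rbrakk> \<Longrightarrow> g \<otimes>\<^bsub>G\<^esub> d \<otimes>\<^bsub>G\<^esub> inv\<^bsub>G\<^esub> g \<in> D"
  "\<lbrakk>g \<in> carrier G; d \<in> D\<rbrakk> \<Longrightarrow> inv\<^bsub>G\<^esub> g \<otimes>\<^bsub>G\<^esub> d \<otimes>\<^bsub>G\<^esub> g \<in> D"
  using D.inv_op_closed2 D.inv_op_closed1 by auto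

lemma J_finsum: "\<lbrakk>\<And>i. i \<in> I \<Longrightarrow> f i \<in> J\<rbrakk> \<Longrightarrow> (\<Oplus>\<^bsub>R\<^esub>i\<in>I. f i) \<in> J"
proof (induction I rule: infinite_finite_induct)
  case (insert i I)
  then have "f \<in> I \<rightarrow> carrier R" "f i \<in> carrier R" using J.Icarr by auto
  then show ?case using insert by simp
qed auto

lemma p_multiple_in_J: "x \<in> carrier R \<Longrightarrow> [p] \<cdot>\<^bsub>R\<^esub> x \<in> J"
  using R.add_pow_ldistr[of "\<one>\<^bsub>R\<^esub>" x p] J.I_r_closed[OF J(3), of x] by simp

text \<open>The powers of \<open>w\<close> permute \<open>D\<close> with orbits of length \<open>p\<close>, on each of which \<open>f\<close> is constant.\<close>

lemma invariant_sum_in_J: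
  assumes w: "w \<in> D" "w \<noteq> \<one>\<^bsub>G\<^esub>" and f: "f \<in> D \<rightarrow> carrier R"
    and invariant: "\<And>c. c \<in> D \<Longrightarrow> f (w \<otimes>\<^bsub>G\<^esub> c) = f c"
  shows "(\<Oplus>\<^bsub>R\<^esub>c\<in>D. f c) \<in> J"
proof -
  have wG: "w \<in> carrier G" using w D.subset by auto
  have pow_D: "w [^]\<^bsub>G\<^esub> (n::nat) \<in> D" for n
    using w by (induction n) auto
  have ord: "G.ord w = p"
  proof -
    have "G.ord w dvd p" using G.pow_eq_id[OF wG] D_exponent[OF w(1)] by simp
    moreover have "G.ord w \<noteq> 1" using G.ord_eq_1[OF wG] w by simp
    ultimately show ?thesis using p by (metis prime_nat_iff)
  qed
  have "(\<Oplus>\<^bsub>R\<^esub>c\<in>Y. f c) \<in> J" if "Y \<subseteq> D" "\<And>c. c \<in> Y \<Longrightarrow> w \<otimes>\<^bsub>G\<^esub> c \<in> Y" for Y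
    using finite_subset[OF that(1) D_finite] that
  proof (induction Y rule: finite_psubset_induct)
    case (psubset Y)
    note Y = psubset.hyps psubset.prems
    show ?case
    proof (cases "Y = {}")
      case False
      then obtain c where c: "c \<in> Y" by auto
      have cD: "c \<in> D" using c Y(2) by auto
      have cG: "c \<in> carrier G" using cD D.subset by auto
      define Q where "Q = (\<lambda>n. w [^]\<^bsub>G\<^esub> n \<otimes>\<^bsub>G\<^esub> c) ` {0..p - 1}"
      have pow: "w [^]\<^bsub>G\<^esub> n \<otimes>\<^bsub>G\<^esub> c \<in> Y \<and> f (w [^]\<^bsub>G\<^esub> n \<otimes>\<^bsub>G\<^esub> c) = f c" for n :: nat
      proof (induction n)
        case (Suc n)
        have "w [^]\<^bsub>G\<^esub> Suc n \<otimes>\<^bsub>G\<^esub> c = w \<otimes>\<^bsub>G\<^esub> (w [^]\<^bsub>G\<^esub> n \<otimes>\<^bsub>G\<^esub> c)"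
          using G.nat_pow_Suc2[OF wG, of n] wG cG by (simp add: G.m_assoc)
        then show ?case using Suc Y(3)[of "w [^]\<^bsub>G\<^esub> n \<otimes>\<^bsub>G\<^esub> c"] Y(2) invariant[of "w [^]\<^bsub>G\<^esub> n \<otimes>\<^bsub>G\<^esub> c"] by auto
      qed (use c cG in simp)
      have mem: "w [^]\<^bsub>G\<^esub> n \<otimes>\<^bsub>G\<^esub> c \<in> Q" for n :: nat
      proof -
        have "w [^]\<^bsub>G\<^esub> n = w [^]\<^bsub>G\<^esub> (n mod p)"
        proof -
          have "w [^]\<^bsub>G\<^esub> n = w [^]\<^bsub>G\<^esub> (p * (n div p) + n mod p)" by simp
          also have "\<dots> = w [^]\<^bsub>G\<^esub> (p * (n div p)) \<otimes>\<^bsub>G\<^esub> w [^]\<^bsub>G\<^esub> (n mod p)"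
            using wG by (simp only: G.nat_pow_mult)
          also have "w [^]\<^bsub>G\<^esub> (p * (n div p)) = \<one>\<^bsub>G\<^esub>"
            using G.nat_pow_pow[OF wG, of p "n div p"] D_exponent[OF w(1)] by simp
          finally show ?thesis using wG by simp
        qed
        moreover have "n mod p \<in> {0..p - 1}" using prime_gt_0_nat[OF p] by (simp add: less_Suc_eq_le[symmetric])
        ultimately show ?thesis unfolding Q_def by (auto intro!: image_eqI)
      qed
      have inj: "inj_on (\<lambda>n. w [^]\<^bsub>G\<^esub> n \<otimes>\<^bsub>G\<^esub> c) {0..p - 1}"
        using G.ord_inj[OF wG] cG wG unfolding ord by (auto simp: inj_on_def)
      have Q_sub: "Q \<subseteq> Y" using pow by (auto simp: Q_def)
      have "(\<Oplus>\<^bsub>R\<^esub>c\<in>Q. f c) = (\<Oplus>\<^bsub>R\<^esub>n\<in>{0..p - 1}. f c)"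
        unfolding Q_def using f Q_sub Y(2) pow cD
        by (subst R.add.finprod_reindex[OF _ inj]) (auto intro!: R.finsum_cong' simp: Q_def)
      also have "\<dots> = [p] \<cdot>\<^bsub>R\<^esub> f c"
        using R.add.finprod_const[of "f c" "{0..p - 1}"] f cD prime_gt_0_nat[OF p] by auto
      finally have sum_Q: "(\<Oplus>\<^bsub>R\<^esub>c\<in>Q. f c) \<in> J" using p_multiple_in_J f cD by auto
      have closed: "w \<otimes>\<^bsub>G\<^esub> a \<in> Y - Q" if a: "a \<in> Y - Q" for a
      proof -
        have aG: "a \<in> carrier G" using a Y(2) D.subset by auto
        have "a \<in> Q" if wa: "w \<otimes>\<^bsub>G\<^esub> a \<in> Q"
        proof -
          obtain n where "w \<otimes>\<^bsub>G\<^esub> a = w [^]\<^bsub>G\<^esub> (n::nat) \<otimes>\<^bsub>G\<^esub> c" using wa by (auto simp: Q_def)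
          then have "w [^]\<^bsub>G\<^esub> (p - 1) \<otimes>\<^bsub>G\<^esub> (w \<otimes>\<^bsub>G\<^esub> a) = w [^]\<^bsub>G\<^esub> (p - 1 + n) \<otimes>\<^bsub>G\<^esub> c"
            using wG cG by (simp add: G.nat_pow_mult[symmetric] G.m_assoc)
          moreover have "w [^]\<^bsub>G\<^esub> (p - 1) \<otimes>\<^bsub>G\<^esub> (w \<otimes>\<^bsub>G\<^esub> a) = a"
          proof -
            have "w [^]\<^bsub>G\<^esub> (p - 1) \<otimes>\<^bsub>G\<^esub> (w \<otimes>\<^bsub>G\<^esub> a) = w [^]\<^bsub>G\<^esub> Suc (p - 1) \<otimes>\<^bsub>G\<^esub> a"
              using wG aG by (simp add: G.m_assoc)
            then show ?thesis using D_exponent[OF w(1)] prime_gt_0_nat[OF p] aG by simp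
          qed
          ultimately show ?thesis using mem[of "p - 1 + n"] by simp
        qed
        then show ?thesis using a Y(3) by auto
      qed
      have "(\<Oplus>\<^bsub>R\<^esub>c\<in>Y. f c) = (\<Oplus>\<^bsub>R\<^esub>c\<in>Q \<union> (Y - Q). f c)" using Q_sub by (simp add: Un_absorb1)
      also have "\<dots> = (\<Oplus>\<^bsub>R\<^esub>c\<in>Q. f c) \<oplus>\<^bsub>R\<^esub> (\<Oplus>\<^bsub>R\<^esub>c\<in>Y - Q. f c)"
        using f Y(1,2) Q_sub by (intro R.finsum_Un_disjoint) (auto intro: finite_subset)
      also have "\<dots> \<in> J"
      proof -
        have "Y - Q \<subset> Y" using mem[of 0] c cG by auto
        then have "(\<Oplus>\<^bsub>R\<^esub>c\<in>Y - Q. f c) \<in> J" using psubset.IH[of "Y - Q"] Y(2) closed by blast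
        then show ?thesis using sum_Q by simp
      qed
      finally show ?thesis .
    qed simp
  qed
  from this[of D] show ?thesis using w by auto
qed

definition coset_sum :: "('g \<Rightarrow> 'k) \<Rightarrow> 'g \<Rightarrow> 'k"
  where "coset_sum u x = (\<Oplus>\<^bsub>R\<^esub>c\<in>D. u (c \<otimes>\<^bsub>G\<^esub> x))"

lemma sum_r_coset:
  assumes "h \<in> carrier G \<rightarrow> carrier R" "x \<in> carrier G"
  shows "(\<Oplus>\<^bsub>R\<^esub>g\<in>D #>\<^bsub>G\<^esub> x. h g) = (\<Oplus>\<^bsub>R\<^esub>c\<in>D. h (c \<otimes>\<^bsub>G\<^esub> x))"
proof -
  have "D #>\<^bsub>G\<^esub> x = (\<lambda>c. c \<otimes>\<^bsub>G\<^esub> x) ` D" by (auto simp: r_coset_def)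
  moreover have "inj_on (\<lambda>c. c \<otimes>\<^bsub>G\<^esub> x) D" using assms D.subset by (auto simp: inj_on_def subset_iff)
  ultimately show ?thesis
    using assms D.subset by (simp add: R.add.finprod_reindex subset_iff Pi_iff)
qed

lemma sum_by_cosets:
  assumes "h \<in> carrier G \<rightarrow> carrier R"
  shows "(\<Oplus>\<^bsub>R\<^esub>g\<in>carrier G. h g) = (\<Oplus>\<^bsub>R\<^esub>Y\<in>rcosets\<^bsub>G\<^esub> D. \<Oplus>\<^bsub>R\<^esub>g\<in>Y. h g)"
proof -
  have part: "\<Union>(rcosets\<^bsub>G\<^esub> D) = carrier G" by (rule G.rcosets_part_G[OF D.subgroup_axioms])
  then have "finite (\<Union>(rcosets\<^bsub>G\<^esub> D))" using finite_carrier by simp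
  then have "finite (rcosets\<^bsub>G\<^esub> D)" "\<And>Y. Y \<in> rcosets\<^bsub>G\<^esub> D \<Longrightarrow> finite Y"
    using finite_UnionD by (blast, meson Union_upper finite_subset)
  then show ?thesis
    using R.add.finprod_Union_disjoint[of "rcosets\<^bsub>G\<^esub> D" h] G.rcos_disjoint[OF D.subgroup_axioms] part assms
    by (metis PiE UnionI)
qed

lemma sum_in_J_by_cosets:
  assumes h: "h \<in> carrier G \<rightarrow> carrier R"
    and "\<And>x. x \<in> carrier G \<Longrightarrow> (\<Oplus>\<^bsub>R\<^esub>c\<in>D. h (c \<otimes>\<^bsub>G\<^esub> x)) \<in> J"
  shows "(\<Oplus>\<^bsub>R\<^esub>g\<in>carrier G. h g) \<in> J"
  unfolding sum_by_cosets[OF h]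
  by (rule J_finsum) (auto simp: RCOSETS_def sum_r_coset[OF h] assms(2))

text \<open>Comparing coefficients in the intertwining relation, \<open>u\<close> is invariant under left translation of
  \<open>Dx\<close> by \<open>d b\<close>, where \<open>b = x d'\<^sup>-\<^sup>1 x\<^sup>-\<^sup>1\<close> again lies in the abelian group \<open>D\<close>. This translation
  is nontrivial exactly when \<open>d'\<close> is different from \<open>x\<^sup>-\<^sup>1 d x\<close>.\<close>

lemma coset_sum_in_J:
  assumes u: "u \<in> carrier RG" and x: "x \<in> carrier G" and d: "d \<in> D" "d' \<in> D"
    and intertwine: "ga_single R G \<one>\<^bsub>R\<^esub> d \<otimes>\<^bsub>RG\<^esub> u = u \<otimes>\<^bsub>RG\<^esub> ga_single R G \<one>\<^bsub>R\<^esub> d'"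
    and ne: "d' \<noteq> inv\<^bsub>G\<^esub> x \<otimes>\<^bsub>G\<^esub> d \<otimes>\<^bsub>G\<^esub> x"
  shows "coset_sum u x \<in> J"
proof -
  have dG: "d \<in> carrier G" "d' \<in> carrier G" using d D.subset by auto
  define b where "b = x \<otimes>\<^bsub>G\<^esub> inv\<^bsub>G\<^esub> d' \<otimes>\<^bsub>G\<^esub> inv\<^bsub>G\<^esub> x"
  have b: "b \<in> D" using conj_in_D(1)[OF x, of "inv\<^bsub>G\<^esub> d'"] d by (simp add: b_def)
  have bG: "b \<in> carrier G" using b D.subset by auto
  have u_eq: "u (inv\<^bsub>G\<^esub> d \<otimes>\<^bsub>G\<^esub> g) = u (g \<otimes>\<^bsub>G\<^esub> inv\<^bsub>G\<^esub> d')" if g: "g \<in> carrier G" for g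
    using single_mult[OF R.one_closed dG(1) u g] mult_single[OF R.one_closed dG(2) u g] intertwine u g dG
    by simp
  show ?thesis
    unfolding coset_sum_def
  proof (rule invariant_sum_in_J[of "d \<otimes>\<^bsub>G\<^esub> b"])
    show "d \<otimes>\<^bsub>G\<^esub> b \<in> D" using d b by simp
    show "d \<otimes>\<^bsub>G\<^esub> b \<noteq> \<one>\<^bsub>G\<^esub>"
    proof
      assume "d \<otimes>\<^bsub>G\<^esub> b = \<one>\<^bsub>G\<^esub>"
      then have "d = inv\<^bsub>G\<^esub> b" using G.inv_equality[of d b] dG bG by simp
      also have "\<dots> = x \<otimes>\<^bsub>G\<^esub> d' \<otimes>\<^bsub>G\<^esub> inv\<^bsub>G\<^esub> x"
        using x dG by (simp add: b_def G.inv_mult_group G.m_assoc)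
      finally have "inv\<^bsub>G\<^esub> x \<otimes>\<^bsub>G\<^esub> d \<otimes>\<^bsub>G\<^esub> x = d'" using x dG by (simp add: G.m_assoc)
      then show False using ne by simp
    qed
    show "(\<lambda>c. u (c \<otimes>\<^bsub>G\<^esub> x)) \<in> D \<rightarrow> carrier R" using u x D.subset by auto
    fix c assume c: "c \<in> D"
    then have cG: "c \<in> carrier G" using D.subset by auto
    have "u (c \<otimes>\<^bsub>G\<^esub> x) = u (inv\<^bsub>G\<^esub> d \<otimes>\<^bsub>G\<^esub> (d \<otimes>\<^bsub>G\<^esub> c \<otimes>\<^bsub>G\<^esub> x))"
      using dG cG x by (simp add: G.m_assoc)
    also have "\<dots> = u (d \<otimes>\<^bsub>G\<^esub> c \<otimes>\<^bsub>G\<^esub> x \<otimes>\<^bsub>G\<^esub> inv\<^bsub>G\<^esub> d')"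
      using dG cG x by (intro u_eq) simp
    also have "d \<otimes>\<^bsub>G\<^esub> c \<otimes>\<^bsub>G\<^esub> x \<otimes>\<^bsub>G\<^esub> inv\<^bsub>G\<^esub> d' = d \<otimes>\<^bsub>G\<^esub> (c \<otimes>\<^bsub>G\<^esub> b) \<otimes>\<^bsub>G\<^esub> x"
      using dG cG x by (simp add: b_def G.m_assoc)
    also have "\<dots> = d \<otimes>\<^bsub>G\<^esub> b \<otimes>\<^bsub>G\<^esub> c \<otimes>\<^bsub>G\<^esub> x"
      using D_comm[OF c b] dG cG bG x by (simp add: G.m_assoc)
    finally show "u (d \<otimes>\<^bsub>G\<^esub> b \<otimes>\<^bsub>G\<^esub> c \<otimes>\<^bsub>G\<^esub> x) = u (c \<otimes>\<^bsub>G\<^esub> x)" ..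
  qed
qed

text \<open>Otherwise every coset sum of \<open>u\<close> lies in \<open>J\<close>, and so does their sum, the augmentation.\<close>

theorem intertwiner_imp_conjugation:
  assumes u: "u \<in> carrier RG" and aug: "augmentation u \<notin> J" and \<nu>: "\<And>d. d \<in> D \<Longrightarrow> \<nu> d \<in> D"
    and intertwine: "\<And>d. d \<in> D \<Longrightarrow>
      ga_single R G \<one>\<^bsub>R\<^esub> d \<otimes>\<^bsub>RG\<^esub> u = u \<otimes>\<^bsub>RG\<^esub> ga_single R G \<one>\<^bsub>R\<^esub> (\<nu> d)"
  shows "\<exists>x\<in>carrier G. \<forall>d\<in>D. \<nu> d = inv\<^bsub>G\<^esub> x \<otimes>\<^bsub>G\<^esub> d \<otimes>\<^bsub>G\<^esub> x"
proof (rule ccontr)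
  assume "\<not> ?thesis"
  then have "coset_sum u x \<in> J" if "x \<in> carrier G" for x
    using coset_sum_in_J[OF u that _ \<nu> intertwine] that by blast
  then have "augmentation u \<in> J"
    unfolding augmentation_def using u by (intro sum_in_J_by_cosets) (auto simp: coset_sum_def)
  then show False using aug by simp
qed

text \<open>The kernel of reduction modulo \<open>J\<close>.\<close>

definition JG :: "('g \<Rightarrow> 'k) set"
  where "JG = {x \<in> carrier RG. \<forall>g \<in> carrier G. x g \<in> J}"

lemma JG_left: "a \<in> carrier RG \<Longrightarrow> x \<in> JG \<Longrightarrow> a \<otimes>\<^bsub>RG\<^esub> x \<in> JG"
  unfolding JG_def by (auto simp: ga_mult intro!: J_finsum J.I_l_closed intro: ga_mult_closed[unfolded ga_mult])

lemma JG_p_multiple: "x \<in> carrier RG \<Longrightarrow> [p] \<cdot>\<^bsub>RG\<^esub> x \<in> JG"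
proof -
  assume x: "x \<in> carrier RG"
  have "([n] \<cdot>\<^bsub>RG\<^esub> x) g = [n] \<cdot>\<^bsub>R\<^esub> (x g)" if "g \<in> carrier G" for n :: nat and g
    using that x by (induction n) auto
  then show ?thesis using x p_multiple_in_J by (auto simp: JG_def)
qed

text \<open>Modulo \<open>p\<close>, the \<open>p\<close>-th power of \<open>d = (d - 1) + 1\<close> is \<open>(d - 1)\<^sup>p + 1\<close>, while \<open>d\<^sup>p = 1\<close>.\<close>

lemma difference_power_in_JG:
  assumes d: "d \<in> D"
  shows "(ga_single R G \<one>\<^bsub>R\<^esub> d \<ominus>\<^bsub>RG\<^esub> \<one>\<^bsub>RG\<^esub>) [^]\<^bsub>RG\<^esub> p \<in> JG"
proof -
  let ?d = "ga_single R G \<one>\<^bsub>R\<^esub> d" and ?\<delta> = "ga_single R G \<one>\<^bsub>R\<^esub> d \<ominus>\<^bsub>RG\<^esub> \<one>\<^bsub>RG\<^esub>"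
  have dG: "d \<in> carrier G" using d D.subset by auto
  have pow: "?d [^]\<^bsub>RG\<^esub> n = ga_single R G \<one>\<^bsub>R\<^esub> (d [^]\<^bsub>G\<^esub> n)" for n :: nat
    using dG by (induction n) (simp_all add: ga_one single_mult_single)
  have "?d [^]\<^bsub>RG\<^esub> p = \<one>\<^bsub>RG\<^esub>" using pow[of p] D_exponent[OF d] by (simp add: ga_one)
  moreover have "?\<delta> \<oplus>\<^bsub>RG\<^esub> \<one>\<^bsub>RG\<^esub> = ?d" by (simp add: A.minus_eq A.a_assoc A.l_neg)
  moreover obtain z where z: "z \<in> carrier RG"
    "(?\<delta> \<oplus>\<^bsub>RG\<^esub> \<one>\<^bsub>RG\<^esub>) [^]\<^bsub>RG\<^esub> p = ?\<delta> [^]\<^bsub>RG\<^esub> p \<oplus>\<^bsub>RG\<^esub> \<one>\<^bsub>RG\<^esub> [^]\<^bsub>RG\<^esub> p \<oplus>\<^bsub>RG\<^esub> [p] \<cdot>\<^bsub>RG\<^esub> z"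
    using A.prime_power_commuting[OF p, of ?\<delta> "\<one>\<^bsub>RG\<^esub>"] by auto
  ultimately have "\<one>\<^bsub>RG\<^esub> = ?\<delta> [^]\<^bsub>RG\<^esub> p \<oplus>\<^bsub>RG\<^esub> \<one>\<^bsub>RG\<^esub> \<oplus>\<^bsub>RG\<^esub> [p] \<cdot>\<^bsub>RG\<^esub> z" by simp
  then have "\<zero>\<^bsub>RG\<^esub> \<oplus>\<^bsub>RG\<^esub> \<one>\<^bsub>RG\<^esub> = (?\<delta> [^]\<^bsub>RG\<^esub> p \<oplus>\<^bsub>RG\<^esub> [p] \<cdot>\<^bsub>RG\<^esub> z) \<oplus>\<^bsub>RG\<^esub> \<one>\<^bsub>RG\<^esub>"
    using z(1) by (simp add: A.a_ac)
  then have "?\<delta> [^]\<^bsub>RG\<^esub> p \<oplus>\<^bsub>RG\<^esub> [p] \<cdot>\<^bsub>RG\<^esub> z = \<zero>\<^bsub>RG\<^esub>"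
    using z(1) by (subst (asm) A.add.right_cancel) simp_all
  then have "\<ominus>\<^bsub>RG\<^esub> ([p] \<cdot>\<^bsub>RG\<^esub> z) = ?\<delta> [^]\<^bsub>RG\<^esub> p"
    using z(1) by (intro A.minus_equality) simp_all
  moreover have "\<ominus>\<^bsub>RG\<^esub> y \<in> JG" if "y \<in> JG" for y using that by (auto simp: JG_def)
  ultimately show ?thesis using JG_p_multiple[OF z(1)] by metis
qed

lemma JG_iff: "x \<in> JG \<longleftrightarrow> x \<in> carrier RG \<and> (\<forall>g \<in> carrier G. x g \<in> J)"
  by (simp add: JG_def)

text \<open>Modulo \<open>J\<close>, all elements of a coset \<open>Dy = yD\<close> act on \<open>v\<close> in the same way, so that the coefficients
  of \<open>e\<close> on this coset enter \<open>ev\<close> only through their sum.\<close>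

lemma coset_sums_annihilate_fixed:
  assumes e: "e \<in> carrier RG" "\<And>x. x \<in> carrier G \<Longrightarrow> coset_sum e x \<in> J"
    and v: "v \<in> carrier RG" "\<And>d. d \<in> D \<Longrightarrow> ga_single R G \<one>\<^bsub>R\<^esub> d \<otimes>\<^bsub>RG\<^esub> v \<ominus>\<^bsub>RG\<^esub> v \<in> JG"
  shows "e \<otimes>\<^bsub>RG\<^esub> v \<in> JG"
  unfolding JG_iff
proof (intro conjI ballI)
  fix x assume x: "x \<in> carrier G"
  have fixed: "v (inv\<^bsub>G\<^esub> d \<otimes>\<^bsub>G\<^esub> z) \<ominus>\<^bsub>R\<^esub> v z \<in> J" if d: "d \<in> D" and z: "z \<in> carrier G" for d z
  proof -
    have "(ga_single R G \<one>\<^bsub>R\<^esub> d \<otimes>\<^bsub>RG\<^esub> v \<ominus>\<^bsub>RG\<^esub> v) z \<in> J" using v(2)[OF d] z by (simp add: JG_iff)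
    moreover have "d \<in> carrier G" using d D.subset by auto
    ultimately show ?thesis using z v(1) by (simp add: A.minus_eq R.minus_eq single_mult)
  qed
  have "(\<Oplus>\<^bsub>R\<^esub>g\<in>carrier G. e g \<otimes>\<^bsub>R\<^esub> v (inv\<^bsub>G\<^esub> g \<otimes>\<^bsub>G\<^esub> x)) \<in> J"
  proof (rule sum_in_J_by_cosets)
    fix y assume y: "y \<in> carrier G"
    define z where "z = inv\<^bsub>G\<^esub> y \<otimes>\<^bsub>G\<^esub> x"
    define j where "j c = v (inv\<^bsub>G\<^esub> (c \<otimes>\<^bsub>G\<^esub> y) \<otimes>\<^bsub>G\<^esub> x) \<ominus>\<^bsub>R\<^esub> v z" for c
    have z: "z \<in> carrier G" using x y by (simp add: z_def)
    have DG: "c \<in> carrier G" if "c \<in> D" for c using that D.subset by auto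
    have j: "j c \<in> J" if c: "c \<in> D" for c
    proof -
      have "inv\<^bsub>G\<^esub> (c \<otimes>\<^bsub>G\<^esub> y) \<otimes>\<^bsub>G\<^esub> x = inv\<^bsub>G\<^esub> (inv\<^bsub>G\<^esub> y \<otimes>\<^bsub>G\<^esub> c \<otimes>\<^bsub>G\<^esub> y) \<otimes>\<^bsub>G\<^esub> z"
        using DG[OF c] x y by (simp add: z_def G.inv_mult_group G.m_assoc)
      then show ?thesis using fixed[OF conj_in_D(2)[OF y c] z] by (simp add: j_def)
    qed
    have jR: "j c \<in> carrier R" if "c \<in> D" for c using j[OF that] J.Icarr by simp
    have "(\<Oplus>\<^bsub>R\<^esub>c\<in>D. e (c \<otimes>\<^bsub>G\<^esub> y) \<otimes>\<^bsub>R\<^esub> v (inv\<^bsub>G\<^esub> (c \<otimes>\<^bsub>G\<^esub> y) \<otimes>\<^bsub>G\<^esub> x)) =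
        (\<Oplus>\<^bsub>R\<^esub>c\<in>D. e (c \<otimes>\<^bsub>G\<^esub> y) \<otimes>\<^bsub>R\<^esub> v z \<oplus>\<^bsub>R\<^esub> e (c \<otimes>\<^bsub>G\<^esub> y) \<otimes>\<^bsub>R\<^esub> j c)"
    proof (rule R.finsum_cong'[OF refl])
      fix c assume c: "c \<in> D"
      have "v (inv\<^bsub>G\<^esub> (c \<otimes>\<^bsub>G\<^esub> y) \<otimes>\<^bsub>G\<^esub> x) = v z \<oplus>\<^bsub>R\<^esub> j c"
        using v(1) DG[OF c] x y z
        by (simp add: j_def R.minus_eq R.a_lcomm[of "v z"] R.r_neg)
      then show "e (c \<otimes>\<^bsub>G\<^esub> y) \<otimes>\<^bsub>R\<^esub> v (inv\<^bsub>G\<^esub> (c \<otimes>\<^bsub>G\<^esub> y) \<otimes>\<^bsub>G\<^esub> x) =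
          e (c \<otimes>\<^bsub>G\<^esub> y) \<otimes>\<^bsub>R\<^esub> v z \<oplus>\<^bsub>R\<^esub> e (c \<otimes>\<^bsub>G\<^esub> y) \<otimes>\<^bsub>R\<^esub> j c"
        using e(1) v(1) DG[OF c] jR[OF c] y z by (simp add: R.r_distr)
    qed (use e(1) v(1) DG jR y z in auto)
    also have "\<dots> = coset_sum e y \<otimes>\<^bsub>R\<^esub> v z \<oplus>\<^bsub>R\<^esub> (\<Oplus>\<^bsub>R\<^esub>c\<in>D. e (c \<otimes>\<^bsub>G\<^esub> y) \<otimes>\<^bsub>R\<^esub> j c)"
      unfolding coset_sum_def using e(1) v(1) DG jR y z D_finite
      by (subst R.finsum_addf) (auto simp: R.finsum_ldistr)
    also have "\<dots> \<in> J"
      using e(1) e(2)[OF y] v(1) z DG y j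
      by (intro J.a_closed J.I_r_closed J_finsum J.I_l_closed) auto
    finally show "(\<Oplus>\<^bsub>R\<^esub>c\<in>D. e (c \<otimes>\<^bsub>G\<^esub> y) \<otimes>\<^bsub>R\<^esub> v (inv\<^bsub>G\<^esub> (c \<otimes>\<^bsub>G\<^esub> y) \<otimes>\<^bsub>G\<^esub> x)) \<in> J" .
  qed (use e(1) v(1) x in auto)
  then show "(e \<otimes>\<^bsub>RG\<^esub> v) x \<in> J" using x by (simp add: ga_mult)
qed (use e v in simp)

text \<open>If \<open>e\<close> does not vanish modulo \<open>J\<close>, then \<open>e\<close> fixes a vector that is nonzero modulo \<open>J\<close>, for
  instance \<open>e\<close> itself. Among those vectors, take one that is fixed modulo \<open>J\<close> by as many elements of
  \<open>D\<close> as possible. If \<open>d\<close> is not among these elements, the last power of the nilpotent \<open>d - 1\<close>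
  that does not kill the vector yields one that \<open>d\<close> fixes too. So there is one that all of \<open>D\<close>
  fixes, and \<open>e\<close> annihilates it modulo \<open>J\<close>.\<close>

lemma idempotent_in_JG:
  assumes e: "e \<in> carrier RG" "\<And>x. x \<in> carrier G \<Longrightarrow> coset_sum e x \<in> J"
    and idem: "e \<otimes>\<^bsub>RG\<^esub> e = e"
    and central: "\<And>x. x \<in> carrier RG \<Longrightarrow> e \<otimes>\<^bsub>RG\<^esub> x = x \<otimes>\<^bsub>RG\<^esub> e"
  shows "e \<in> JG"
proof (rule ccontr)
  assume "e \<notin> JG"
  define Fix where "Fix v = {d \<in> D. ga_single R G \<one>\<^bsub>R\<^esub> d \<otimes>\<^bsub>RG\<^esub> v \<ominus>\<^bsub>RG\<^esub> v \<in> JG}" for v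
  define P where "P v \<longleftrightarrow> v \<in> carrier RG \<and> e \<otimes>\<^bsub>RG\<^esub> v = v \<and> v \<notin> JG" for v
  have "P e" using e idem \<open>e \<notin> JG\<close> by (simp add: P_def)
  moreover have "card (Fix v) < Suc (card D)" for v
    using card_mono[OF D_finite, of "Fix v"] by (auto simp: Fix_def less_Suc_eq_le)
  ultimately obtain v where v: "P v" and max: "\<And>w. P w \<Longrightarrow> card (Fix w) \<le> card (Fix v)"
    using ex_has_greatest_nat[of P e "\<lambda>v. card (Fix v)" "Suc (card D)"] by blast
  have v': "v \<in> carrier RG" "e \<otimes>\<^bsub>RG\<^esub> v = v" "v \<notin> JG" using v by (auto simp: P_def)
  have DG: "d \<in> carrier G" if "d \<in> D" for d using that D.subset by auto
  have "d \<in> Fix v" if d: "d \<in> D" for d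
  proof (rule ccontr)
    assume nfix: "d \<notin> Fix v"
    let ?\<delta> = "ga_single R G \<one>\<^bsub>R\<^esub> d \<ominus>\<^bsub>RG\<^esub> \<one>\<^bsub>RG\<^esub>"
    have \<delta>: "?\<delta> \<in> carrier RG" by simp
    define w where "w j = ?\<delta> [^]\<^bsub>RG\<^esub> (j::nat) \<otimes>\<^bsub>RG\<^esub> v" for j
    have w_closed: "w j \<in> carrier RG" for j using v' by (simp add: w_def)
    have "v \<otimes>\<^bsub>RG\<^esub> z \<in> JG" if "v \<in> JG" "z \<in> carrier RG" for v z
      using that by (auto simp: JG_iff ga_mult intro!: J_finsum J.I_r_closed intro: ga_mult_closed[unfolded ga_mult])
    then have "w p \<in> JG" using difference_power_in_JG[OF d] v' by (simp add: w_def)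
    moreover have "w 0 \<notin> JG" using v' by (simp add: w_def)
    ultimately obtain j where j: "w j \<notin> JG" "w (Suc j) \<in> JG"
      using nat_induct[of "\<lambda>j. w j \<notin> JG" p] by blast
    have "P (w j)"
    proof -
      have "e \<otimes>\<^bsub>RG\<^esub> w j = (e \<otimes>\<^bsub>RG\<^esub> ?\<delta> [^]\<^bsub>RG\<^esub> j) \<otimes>\<^bsub>RG\<^esub> v"
        using e(1) v'(1) by (simp add: w_def A.m_assoc)
      also have "\<dots> = ?\<delta> [^]\<^bsub>RG\<^esub> j \<otimes>\<^bsub>RG\<^esub> (e \<otimes>\<^bsub>RG\<^esub> v)"
        using central[of "?\<delta> [^]\<^bsub>RG\<^esub> j"] e(1) v'(1) by (simp add: A.m_assoc)
      finally have "e \<otimes>\<^bsub>RG\<^esub> w j = ?\<delta> [^]\<^bsub>RG\<^esub> j \<otimes>\<^bsub>RG\<^esub> (e \<otimes>\<^bsub>RG\<^esub> v)" .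
      then show ?thesis using v' j(1) w_closed by (simp add: P_def w_def)
    qed
    moreover have "Fix v \<subset> Fix (w j)"
    proof
      show "Fix v \<subseteq> Fix (w j)"
      proof
        fix c assume c: "c \<in> Fix v"
        let ?c = "ga_single R G \<one>\<^bsub>R\<^esub> c"
        have cD: "c \<in> D" using c by (simp add: Fix_def)
        have "?\<delta> \<otimes>\<^bsub>RG\<^esub> ?c = ?c \<otimes>\<^bsub>RG\<^esub> ?\<delta>"
          using DG[OF cD] DG[OF d] D_comm[OF cD d] by (simp add: A.minus_eq A.l_distr A.r_distr A.l_minus A.r_minus single_mult_single)
        then have comm: "?\<delta> [^]\<^bsub>RG\<^esub> j \<otimes>\<^bsub>RG\<^esub> ?c = ?c \<otimes>\<^bsub>RG\<^esub> ?\<delta> [^]\<^bsub>RG\<^esub> j"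
          by (intro A.group_commutes_pow) simp_all
        have "?c \<otimes>\<^bsub>RG\<^esub> w j \<ominus>\<^bsub>RG\<^esub> w j = ?\<delta> [^]\<^bsub>RG\<^esub> j \<otimes>\<^bsub>RG\<^esub> (?c \<otimes>\<^bsub>RG\<^esub> v \<ominus>\<^bsub>RG\<^esub> v)"
          using comm v' by (simp add: w_def A.minus_eq A.r_distr A.r_minus A.m_assoc[symmetric])
        also have "\<dots> \<in> JG" using c by (intro JG_left) (simp_all add: Fix_def)
        finally show "c \<in> Fix (w j)" using cD by (simp add: Fix_def)
      qed
      have "w (Suc j) = ?\<delta> \<otimes>\<^bsub>RG\<^esub> w j"
        using A.nat_pow_Suc2[OF \<delta>, of j] v' by (simp add: w_def A.m_assoc)
      also have "\<dots> = ga_single R G \<one>\<^bsub>R\<^esub> d \<otimes>\<^bsub>RG\<^esub> w j \<ominus>\<^bsub>RG\<^esub> w j"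
        using w_closed[of j] by (simp add: A.minus_eq A.l_distr A.l_minus)
      finally have "d \<in> Fix (w j)" using j(2) d by (simp add: Fix_def)
      then show "Fix v \<noteq> Fix (w j)" using nfix by blast
    qed
    moreover have "finite (Fix (w j))" using D_finite by (simp add: Fix_def)
    ultimately show False using max psubset_card_mono by (metis linorder_not_less)
  qed
  then have "e \<otimes>\<^bsub>RG\<^esub> v \<in> JG"
    using v' by (intro coset_sums_annihilate_fixed e) (auto simp: Fix_def)
  then show False using v' by simp
qed

text \<open>The ideal generated by the coefficients of an idempotent equals its square. It is principal, and a
  generator \<open>c \<in> J\<close> with \<open>c = r c\<^sup>2\<close> must be \<open>0\<close>, since otherwise \<open>1 = rc \<in> J\<close>.\<close>

lemma idempotent_in_JG_eq_zero:
  assumes "principal_domain R" and e: "e \<in> JG" and idem: "e \<otimes>\<^bsub>RG\<^esub> e = e"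
  shows "e = \<zero>\<^bsub>RG\<^esub>"
proof -
  interpret pd: principal_domain R by (rule assms(1))
  have e': "e \<in> carrier RG" "\<And>g. g \<in> carrier G \<Longrightarrow> e g \<in> J" using e by (auto simp: JG_iff)
  have sub: "e ` carrier G \<subseteq> carrier R" using e' by auto
  obtain c where c: "c \<in> carrier R" "Idl\<^bsub>R\<^esub> (e ` carrier G) = PIdl\<^bsub>R\<^esub> c"
    using pd.exists_gen[OF R.genideal_ideal[OF sub]] by auto
  have cJ: "c \<in> J"
  proof -
    have "Idl\<^bsub>R\<^esub> (e ` carrier G) \<subseteq> J" using e' by (intro R.genideal_minimal J(1)) auto
    then show ?thesis using c R.cgenideal_self[OF c(1)] by auto
  qed
  have coeff: "\<exists>r\<in>carrier R. e g = r \<otimes>\<^bsub>R\<^esub> c" if "g \<in> carrier G" for g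
    using R.genideal_self[OF sub] that unfolding c(2) by (auto simp: cgenideal_def)
  have cc: "c \<otimes>\<^bsub>R\<^esub> c \<in> carrier R" using c by simp
  interpret I: ideal "PIdl\<^bsub>R\<^esub> (c \<otimes>\<^bsub>R\<^esub> c)" R using R.cgenideal_ideal[OF cc] .
  have "e g \<in> PIdl\<^bsub>R\<^esub> (c \<otimes>\<^bsub>R\<^esub> c)" if g: "g \<in> carrier G" for g
  proof -
    have summand: "e h \<otimes>\<^bsub>R\<^esub> e (inv\<^bsub>G\<^esub> h \<otimes>\<^bsub>G\<^esub> g) \<in> PIdl\<^bsub>R\<^esub> (c \<otimes>\<^bsub>R\<^esub> c)" if h: "h \<in> carrier G" for h
    proof -
      obtain r r' where r: "r \<in> carrier R" "r' \<in> carrier R" "e h = r \<otimes>\<^bsub>R\<^esub> c" "e (inv\<^bsub>G\<^esub> h \<otimes>\<^bsub>G\<^esub> g) = r' \<otimes>\<^bsub>R\<^esub> c"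
        using coeff[OF h] coeff[of "inv\<^bsub>G\<^esub> h \<otimes>\<^bsub>G\<^esub> g"] g h by auto
      then have "e h \<otimes>\<^bsub>R\<^esub> e (inv\<^bsub>G\<^esub> h \<otimes>\<^bsub>G\<^esub> g) = (r \<otimes>\<^bsub>R\<^esub> r') \<otimes>\<^bsub>R\<^esub> (c \<otimes>\<^bsub>R\<^esub> c)"
        using c by (simp add: R.m_ac)
      then show ?thesis using r unfolding cgenideal_def by blast
    qed
    have "(\<Oplus>\<^bsub>R\<^esub>h\<in>Y. e h \<otimes>\<^bsub>R\<^esub> e (inv\<^bsub>G\<^esub> h \<otimes>\<^bsub>G\<^esub> g)) \<in> PIdl\<^bsub>R\<^esub> (c \<otimes>\<^bsub>R\<^esub> c)" if "Y \<subseteq> carrier G" for Y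
      using finite_subset[OF that finite_carrier] that
    proof (induction Y rule: finite_induct)
      case (insert h Y)
      then have "(\<lambda>h. e h \<otimes>\<^bsub>R\<^esub> e (inv\<^bsub>G\<^esub> h \<otimes>\<^bsub>G\<^esub> g)) \<in> Y \<rightarrow> carrier R"
        "e h \<otimes>\<^bsub>R\<^esub> e (inv\<^bsub>G\<^esub> h \<otimes>\<^bsub>G\<^esub> g) \<in> carrier R" using e' g by auto
      then show ?case using insert summand by simp
    qed simp
    then have "(e \<otimes>\<^bsub>RG\<^esub> e) g \<in> PIdl\<^bsub>R\<^esub> (c \<otimes>\<^bsub>R\<^esub> c)" using g by (simp add: ga_mult)
    then show ?thesis using idem by simp
  qed
  then have "Idl\<^bsub>R\<^esub> (e ` carrier G) \<subseteq> PIdl\<^bsub>R\<^esub> (c \<otimes>\<^bsub>R\<^esub> c)"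
    by (intro R.genideal_minimal I.ideal_axioms) auto
  then obtain r where r: "r \<in> carrier R" "c = r \<otimes>\<^bsub>R\<^esub> (c \<otimes>\<^bsub>R\<^esub> c)"
  proof -
    assume "Idl\<^bsub>R\<^esub> (e ` carrier G) \<subseteq> PIdl\<^bsub>R\<^esub> (c \<otimes>\<^bsub>R\<^esub> c)"
    then have "c \<in> PIdl\<^bsub>R\<^esub> (c \<otimes>\<^bsub>R\<^esub> c)" using c(2) R.cgenideal_self[OF c(1)] by blast
    then show thesis using that unfolding cgenideal_def by blast
  qed
  have "c = \<zero>\<^bsub>R\<^esub>"
  proof (rule ccontr)
    assume "c \<noteq> \<zero>\<^bsub>R\<^esub>"
    moreover have "\<one>\<^bsub>R\<^esub> \<otimes>\<^bsub>R\<^esub> c = (r \<otimes>\<^bsub>R\<^esub> c) \<otimes>\<^bsub>R\<^esub> c"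
      using R.m_assoc[OF r(1) c(1) c(1)] r(2) R.l_one[OF c(1)] by metis
    ultimately have "\<one>\<^bsub>R\<^esub> = r \<otimes>\<^bsub>R\<^esub> c" using pd.m_rcancel[of c "\<one>\<^bsub>R\<^esub>" "r \<otimes>\<^bsub>R\<^esub> c"] r(1) c(1) by simp
    then show False using J.I_l_closed[OF cJ r(1)] J(2) by simp
  qed
  then show ?thesis using coeff e' by (intro ga_eqI) auto
qed

text \<open>A decomposition of \<open>1\<close> into orthogonal central idempotents has a member of augmentation \<open>0\<close>. For
  such an \<open>e\<close> all coset sums lie in \<open>J\<close>: off \<open>D\<close> because \<open>e\<close> commutes with an element of \<open>D\<close> that
  does not commute with \<open>x\<close>, and on \<open>D\<close> because the total is \<open>0\<close>.\<close>

theorem block_idempotent_one: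
  assumes pd: "principal_domain R"
    and self_centralizing: "\<And>x. \<lbrakk>x \<in> carrier G; \<And>d. d \<in> D \<Longrightarrow> x \<otimes>\<^bsub>G\<^esub> d = d \<otimes>\<^bsub>G\<^esub> x\<rbrakk> \<Longrightarrow> x \<in> D"
  shows "block_idempotent RG \<one>\<^bsub>RG\<^esub>"
proof -
  interpret pd: principal_domain R by (rule pd)
  have zero: "e = \<zero>\<^bsub>RG\<^esub>" if "e \<in> central_idempotents RG" and aug: "augmentation e = \<zero>\<^bsub>R\<^esub>" for e
  proof -
    have e: "e \<in> carrier RG" "e \<otimes>\<^bsub>RG\<^esub> e = e" "\<And>x. x \<in> carrier RG \<Longrightarrow> e \<otimes>\<^bsub>RG\<^esub> x = x \<otimes>\<^bsub>RG\<^esub> e"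
      using that by (auto simp: central_idempotents_def)
    have outside: "coset_sum e x \<in> J" if x: "x \<in> carrier G" "x \<notin> D" for x
    proof -
      obtain d where d: "d \<in> D" "x \<otimes>\<^bsub>G\<^esub> d \<noteq> d \<otimes>\<^bsub>G\<^esub> x" using self_centralizing x by blast
      have dG: "d \<in> carrier G" using d D.subset by auto
      have "d \<noteq> inv\<^bsub>G\<^esub> x \<otimes>\<^bsub>G\<^esub> d \<otimes>\<^bsub>G\<^esub> x"
        using d(2) dG x G.inv_solve_left[of "d" x "d \<otimes>\<^bsub>G\<^esub> x"] by (auto simp: G.m_assoc)
      then show ?thesis using coset_sum_in_J[OF e(1) x(1) d(1) d(1) _] e(3)[of "ga_single R G \<one>\<^bsub>R\<^esub> d"] by simp
    qed
    have DG: "d \<in> carrier G" if "d \<in> D" for d using that D.subset by auto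
    have sum_D: "(\<Oplus>\<^bsub>R\<^esub>c\<in>D. e c) \<in> J"
    proof -
      have D_coset: "D \<in> rcosets\<^bsub>G\<^esub> D" by (rule D.subgroup_in_rcosets[OF G.is_group])
      have part: "\<Union>(rcosets\<^bsub>G\<^esub> D) = carrier G" by (rule G.rcosets_part_G[OF D.subgroup_axioms])
      then have fin: "finite (rcosets\<^bsub>G\<^esub> D)" using finite_carrier finite_UnionD by metis
      have cl: "(\<Oplus>\<^bsub>R\<^esub>g\<in>Y. e g) \<in> carrier R" if "Y \<in> rcosets\<^bsub>G\<^esub> D" for Y
        using that e(1) part by (intro R.finsum_closed) auto
      have others: "(\<Oplus>\<^bsub>R\<^esub>Y\<in>rcosets\<^bsub>G\<^esub> D - {D}. \<Oplus>\<^bsub>R\<^esub>g\<in>Y. e g) \<in> J"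
      proof (rule J_finsum)
        fix Y assume Y: "Y \<in> rcosets\<^bsub>G\<^esub> D - {D}"
        then obtain x where x: "x \<in> carrier G" "Y = D #>\<^bsub>G\<^esub> x" by (auto simp: RCOSETS_def)
        have "x \<notin> D" using Y x G.coset_join2[OF x(1) D.subgroup_axioms] by auto
        then have "coset_sum e x \<in> J" using outside x by simp
        moreover have "(\<Oplus>\<^bsub>R\<^esub>g\<in>Y. e g) = coset_sum e x"
          unfolding coset_sum_def x(2) using e(1) by (intro sum_r_coset x(1)) auto
        ultimately show "(\<Oplus>\<^bsub>R\<^esub>g\<in>Y. e g) \<in> J" by simp
      qed
      have "\<zero>\<^bsub>R\<^esub> = (\<Oplus>\<^bsub>R\<^esub>Y\<in>insert D (rcosets\<^bsub>G\<^esub> D - {D}). \<Oplus>\<^bsub>R\<^esub>g\<in>Y. e g)"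
        using aug e(1) D_coset by (simp add: augmentation_def sum_by_cosets insert_absorb)
      also have "\<dots> = (\<Oplus>\<^bsub>R\<^esub>c\<in>D. e c) \<oplus>\<^bsub>R\<^esub> (\<Oplus>\<^bsub>R\<^esub>Y\<in>rcosets\<^bsub>G\<^esub> D - {D}. \<Oplus>\<^bsub>R\<^esub>g\<in>Y. e g)"
        using fin cl D_coset by (intro R.finsum_insert) auto
      finally have "\<ominus>\<^bsub>R\<^esub> (\<Oplus>\<^bsub>R\<^esub>Y\<in>rcosets\<^bsub>G\<^esub> D - {D}. \<Oplus>\<^bsub>R\<^esub>g\<in>Y. e g) = (\<Oplus>\<^bsub>R\<^esub>c\<in>D. e c)"
        using cl[OF D_coset] J.Icarr[OF others] by (intro R.minus_equality) simp_all
      then show ?thesis using others by (metis J.a_inv_closed)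
    qed
    have inside: "coset_sum e x \<in> J" if x: "x \<in> D" for x
    proof -
      have xG: "x \<in> carrier G" using x DG by simp
      have "coset_sum e x = (\<Oplus>\<^bsub>R\<^esub>g\<in>D #>\<^bsub>G\<^esub> x. e g)"
        unfolding coset_sum_def using e(1) xG by (intro sum_r_coset[symmetric]) auto
      also have "D #>\<^bsub>G\<^esub> x = D" by (rule G.coset_join2[OF xG D.subgroup_axioms x])
      finally show ?thesis using sum_D by simp
    qed
    have "e \<in> JG" using inside outside by (intro idempotent_in_JG[OF e(1) _ e(2) e(3)]) blast+
    then show ?thesis by (rule idempotent_in_JG_eq_zero[OF pd _ e(2)])
  qed
  have one_ne: "\<one>\<^bsub>RG\<^esub> \<noteq> \<zero>\<^bsub>RG\<^esub>"
  proof
    assume "\<one>\<^bsub>RG\<^esub> = \<zero>\<^bsub>RG\<^esub>"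
    then have "\<one>\<^bsub>RG\<^esub> \<one>\<^bsub>G\<^esub> = \<zero>\<^bsub>RG\<^esub> \<one>\<^bsub>G\<^esub>" by simp
    then show False by (simp add: ga_one single_coeff)
  qed
  have "e1 = \<zero>\<^bsub>RG\<^esub> \<or> e2 = \<zero>\<^bsub>RG\<^esub>"
    if e: "e1 \<in> central_idempotents RG" "e2 \<in> central_idempotents RG" and sum: "\<one>\<^bsub>RG\<^esub> = e1 \<oplus>\<^bsub>RG\<^esub> e2" for e1 e2
  proof -
    have ec: "e1 \<in> carrier RG" "e2 \<in> carrier RG" "e1 \<otimes>\<^bsub>RG\<^esub> e1 = e1"
      using e by (auto simp: central_idempotents_def)
    let ?a = "augmentation e1"
    have a: "?a \<otimes>\<^bsub>R\<^esub> ?a = ?a" using augmentation_mult[OF ec(1) ec(1)] ec(3) by simp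
    have ab: "\<one>\<^bsub>R\<^esub> = ?a \<oplus>\<^bsub>R\<^esub> augmentation e2"
      using augmentation_add[OF ec(1,2)] sum augmentation_one by simp
    show ?thesis
    proof (cases "?a = \<zero>\<^bsub>R\<^esub>")
      case True then show ?thesis using zero[OF e(1)] by simp
    next
      case False
      then have "?a = \<one>\<^bsub>R\<^esub>" using pd.m_lcancel[of ?a ?a "\<one>\<^bsub>R\<^esub>"] a ec by simp
      then have "augmentation e2 = \<zero>\<^bsub>R\<^esub>" using ab ec by simp
      then show ?thesis using zero[OF e(2)] by simp
    qed
  qed
  moreover have "\<one>\<^bsub>RG\<^esub> \<in> central_idempotents RG" by (simp add: central_idempotents_def)
  ultimately show ?thesis using one_ne by (auto simp: block_idempotent_def)
qed

end

section \<open>Finite subfields and roots of unity\<close>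

context field begin

lemma card_roots_of_unity:
  assumes d: "0 < (d::nat)"
  shows "finite {x \<in> carrier R. x [^] d = \<one>} \<and> card {x \<in> carrier R. x [^] d = \<one>} \<le> d"
proof -
  define P where "P = poly_add (monom \<one> d) [\<ominus> \<one>]"
  have mono: "polynomial (carrier R) (monom \<one> d)" "polynomial (carrier R) [\<ominus> \<one>]"
    by (auto simp: polynomial_def monom_def)
  then have P: "P \<in> carrier (poly_ring R)"
    unfolding P_def by (metis carrier_is_subring poly_add_closed univ_poly_carrier)
  have eval: "eval P x = x [^] d \<ominus> \<one>" if "x \<in> carrier R" for x
    unfolding P_def using that by (subst eval_poly_add) (auto simp: eval_monom monom_in_carrier minus_eq)
  have "P \<noteq> []"
  proof
    assume "P = []"
    then have "\<zero> = \<zero> [^] d \<ominus> \<one>" using eval[of \<zero>] by simp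
    then have "\<ominus> \<one> = \<zero>" using d by (simp add: nat_pow_zero minus_eq)
    then show False by (metis minus_minus minus_zero one_closed zero_not_one)
  qed
  then have roots: "{x \<in> carrier R. x [^] d = \<one>} = set_mset (roots P)"
    using eval by (auto simp: roots_mem_iff_is_root[OF P] is_root_def r_right_minus_eq)
  have "degree P \<le> d"
    using poly_add_degree[of "monom \<one> d" "[\<ominus> \<one>]"] by (simp add: P_def monom_def)
  moreover have "card (set_mset (roots P)) \<le> size (roots P)"
    by (metis card_mono finite_set_mset mset_set_set_mset_msubset order_refl size_mset_mono size_mset_set)
  ultimately show ?thesis unfolding roots using size_roots_le_degree[OF P] by auto
qed

lemma pow_nonzero: "\<lbrakk>z \<in> carrier R; z \<noteq> \<zero>\<rbrakk> \<Longrightarrow> z [^] (i::nat) \<noteq> \<zero>"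
  by (induction i) (auto simp: integral_iff)

text \<open>The \<open>m\<close> distinct powers of \<open>z\<close> are roots of \<open>X\<^sup>m - 1\<close>, and there are no more.\<close>

lemma roots_of_unity_are_powers:
  assumes z: "z \<in> carrier R" "\<And>k::nat. z [^] k = \<one> \<longleftrightarrow> m dvd k" and m: "0 < m"
    and x: "x \<in> carrier R" "x [^] m = \<one>"
  shows "\<exists>i<m. x = z [^] (i::nat)"
proof -
  have z_unit: "z \<noteq> \<zero>" using z(2)[of m] m by (auto simp: nat_pow_zero)
  have inj: "inj_on (\<lambda>i::nat. z [^] i) {..<m}"
  proof (rule linorder_inj_onI)
    fix i j :: nat assume ij: "i < j" "i \<in> {..<m}" "j \<in> {..<m}"
    show "z [^] i \<noteq> z [^] j"
    proof
      assume eq: "z [^] i = z [^] j"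
      have "z [^] i \<otimes> z [^] (j - i) = z [^] j"
        using z(1) ij by (simp add: nat_pow_mult)
      then have "z [^] i \<otimes> z [^] (j - i) = z [^] i \<otimes> \<one>"
        using z(1) eq by simp
      then have "z [^] (j - i) = \<one>"
        using z(1) z_unit by (subst (asm) m_lcancel) (auto simp: pow_nonzero)
      then have "m dvd j - i" using z(2) by simp
      then show False using ij by (auto dest: dvd_imp_le)
    qed
  qed auto
  have sub: "(\<lambda>i. z [^] i) ` {..<m} \<subseteq> {x \<in> carrier R. x [^] m = \<one>}"
    using z by (auto simp: nat_pow_pow)
  have "(\<lambda>i. z [^] i) ` {..<m} = {x \<in> carrier R. x [^] m = \<one>}"
    using card_roots_of_unity[OF m] sub card_image[OF inj] by (intro card_seteq) auto
  then show ?thesis using x by (auto simp: image_iff)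
qed

lemma subfield_pow_eq_one:
  assumes F: "subfield F R" "finite F" and x: "x \<in> F" "x \<noteq> \<zero>"
  shows "x [^] (card F - 1) = \<one>"
proof -
  interpret F: field "R\<lparr>carrier := F\<rparr>" by (rule subfield_iff(2)[OF F(1)])
  interpret M: group "Multiplicative_Group.mult_of (R\<lparr>carrier := F\<rparr>)" by (rule F.field_mult_group)
  have "x [^]\<^bsub>Multiplicative_Group.mult_of (R\<lparr>carrier := F\<rparr>)\<^esub> order (Multiplicative_Group.mult_of (R\<lparr>carrier := F\<rparr>)) = \<one>"
    using M.pow_order_eq_1[of x] x by simp
  then show ?thesis
    using F.order_mult_of F(2) by (simp add: order_def nat_pow_def)
qed

lemma subfield_pow_card:
  assumes F: "subfield F R" "finite F" and x: "x \<in> F"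
  shows "x [^] card F = x"
proof (cases "x = \<zero>")
  case False
  have xR: "x \<in> carrier R" using subfieldE(3)[OF F(1)] x by auto
  have "card F \<noteq> 0" using F x by auto
  then have "x [^] card F = x [^] (card F - 1) \<otimes> x" by (metis Suc_pred' nat_pow_Suc not_gr_zero)
  then show ?thesis using subfield_pow_eq_one[OF F x False] xR by simp
next
  case True
  have "card F \<noteq> 0" using F x by auto
  then show ?thesis using True by (simp add: nat_pow_zero)
qed

text \<open>The nonzero elements of \<open>F\<close> exhaust the roots of \<open>X\<^bsup>|F|-1\<^esup> - 1\<close>.\<close>

lemma mem_finite_subfield:
  assumes F: "subfield F R" "finite F" and x: "x \<in> carrier R" "x [^] (card F - 1) = \<one>"
  shows "x \<in> F"
proof -
  have FR: "F \<subseteq> carrier R" and zF: "\<zero> \<in> F" and oF: "\<one> \<in> F"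
    using subfieldE(3)[OF F(1)] subringE(2,3)[OF subfieldE(1)[OF F(1)]] by auto
  have "card {\<zero>, \<one>} \<le> card F" using zF oF F(2) by (intro card_mono) auto
  then have pos: "0 < card F - 1" by simp
  have "F - {\<zero>} \<subseteq> {x \<in> carrier R. x [^] (card F - 1) = \<one>}"
    using FR subfield_pow_eq_one[OF F] by auto
  moreover have "card (F - {\<zero>}) = card F - 1" using zF by simp
  ultimately have "F - {\<zero>} = {x \<in> carrier R. x [^] (card F - 1) = \<one>}"
    using card_roots_of_unity[OF pos] by (intro card_seteq) auto
  then show ?thesis using x by blast
qed

lemma card_finite_dimension:
  assumes K: "subfield K R" and "finite K" and "dimension n K E"
  shows "card E = card K ^ n"
proof -
  obtain Us where Us: "set Us \<subseteq> carrier R" "independent K Us" "length Us = n" "Span K Us = E"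
    using exists_base[OF assms(1,3)] by blast
  have "bij_betw (\<lambda>Ks. combine Ks Us) {Ks. set Ks \<subseteq> K \<and> length Ks = n} E"
    unfolding bij_betw_def
  proof
    show img: "(\<lambda>Ks. combine Ks Us) ` {Ks. set Ks \<subseteq> K \<and> length Ks = n} = E"
      using Span_eq_combine_set_length_version[OF K Us(1)] Us by auto
    show "inj_on (\<lambda>Ks. combine Ks Us) {Ks. set Ks \<subseteq> K \<and> length Ks = n}"
    proof (rule inj_onI; clarify)
      fix Ks Ks' assume *: "set Ks \<subseteq> K" "set Ks' \<subseteq> K" "n = length Ks" "length Ks' = length Ks"
        "combine Ks Us = combine Ks' Us"
      have "combine Ks Us \<in> Span K Us" using * img Us by auto
      then show "Ks = Ks'" using unique_decomposition[OF K Us(2), of "combine Ks Us"] * Us(3) by auto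
    qed
  qed
  then show ?thesis using bij_betw_same_card card_lists_length_eq[OF assms(2)] by metis
qed

lemma subfield_card_multiple:
  assumes K: "subfield K R" and x: "x \<in> carrier R"
  shows "[card K] \<cdot>\<^bsub>R\<^esub> x = \<zero>"
proof -
  interpret K: field "R\<lparr>carrier := K\<rparr>" by (rule subfield_iff(2)[OF K])
  have "[order (add_monoid (R\<lparr>carrier := K\<rparr>))] \<cdot>\<^bsub>R\<lparr>carrier := K\<rparr>\<^esub> \<one> = \<zero>"
    using K.add.pow_order_eq_1[of \<one>] K.one_closed by simp
  then have "[card K] \<cdot>\<^bsub>R\<^esub> \<one> = \<zero>" by (simp add: order_def add_pow_def nat_pow_def)
  then show ?thesis using add_pow_ldistr[of \<one> x "card K"] x by simp
qed

lemma frobenius_add: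
  assumes p: "Factorial_Ring.prime (p::nat)" "\<And>x. x \<in> carrier R \<Longrightarrow> [p] \<cdot>\<^bsub>R\<^esub> x = \<zero>"
    and "x \<in> carrier R" "y \<in> carrier R"
  shows "(x \<oplus> y) [^] (p ^ k) = x [^] (p ^ k) \<oplus> y [^] (p ^ k)"
proof (induction k)
  case (Suc k)
  let ?x = "x [^] (p ^ k)" and ?y = "y [^] (p ^ k)"
  obtain z where z: "z \<in> carrier R" "(?x \<oplus> ?y) [^] p = ?x [^] p \<oplus> ?y [^] p \<oplus> [p] \<cdot>\<^bsub>R\<^esub> z"
    using prime_power_commuting[OF p(1), of ?x ?y] assms m_comm by auto
  have "(x \<oplus> y) [^] (p ^ Suc k) = ((x \<oplus> y) [^] (p ^ k)) [^] p"
    using assms by (simp add: nat_pow_pow mult.commute)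
  also have "\<dots> = ?x [^] p \<oplus> ?y [^] p" using Suc z p(2)[OF z(1)] assms by simp
  also have "\<dots> = x [^] (p ^ Suc k) \<oplus> y [^] (p ^ Suc k)"
    using assms by (simp add: nat_pow_pow mult.commute)
  finally show ?case .
qed (use assms in simp)

end

text \<open>The field \<open>K(x)\<close> has finite dimension over \<open>K\<close>, because \<open>x\<close> is algebraic.\<close>

lemma (in algebraic_closure) in_finite_subfield:
  assumes "finite K" "x \<in> carrier L"
  obtains E m where "subfield E L" "x \<in> E" "card E = card K ^ m" "0 < m"
proof -
  have alg: "(algebraic over K) x" using algebraic_extension[OF assms(2)] .
  have E: "subfield (simple_extension K x) L"
    using simple_extension_is_subfield[OF subfield_axioms assms(2)] alg by simp
  obtain m where m: "dimension m K (simple_extension K x)"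
    using finite_dimension_simple_extension[OF subfield_axioms assms(2)] alg by auto
  have "{\<zero>, \<one>} \<subseteq> simple_extension K x" using subringE(2,3)[OF subfieldE(1)[OF E]] by auto
  then have "simple_extension K x \<noteq> {\<zero>}" using zero_not_one by auto
  then have "0 < m" using m dimension_zero[OF subfield_axioms, of "simple_extension K x"] by (cases m) auto
  then show thesis
    using that[OF E simple_extension_mem[OF subfieldE(1)[OF subfield_axioms] assms(2)]
        card_finite_dimension[OF subfield_axioms assms(1) m]] by simp
qed

text \<open>Each power of \<open>q\<close> is \<open>1\<close> modulo \<open>t\<^sup>2\<close>, so the sum is \<open>t\<close> modulo \<open>t\<^sup>2\<close>.\<close>

lemma geometric_sum_mod_square:
  fixes q t :: nat
  assumes "t\<^sup>2 dvd q - 1" "0 < q"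
  obtains k where "(\<Sum>i<t. q ^ i) = t * (1 + t * k)"
proof -
  obtain a where a: "q = 1 + t\<^sup>2 * a" using assms by (metis Suc_diff_1 dvdE plus_1_eq_Suc)
  have pow: "\<exists>c. q ^ i = 1 + t\<^sup>2 * c" for i
  proof (induction i)
    case (Suc i)
    then obtain c where "q ^ i = 1 + t\<^sup>2 * c" by auto
    then have "q ^ Suc i = 1 + t\<^sup>2 * (c + a + t\<^sup>2 * a * c)" unfolding a by (simp add: algebra_simps)
    then show ?case by blast
  qed simp
  have "\<exists>k. (\<Sum>i<m. q ^ i) = m + t\<^sup>2 * k" for m
  proof (induction m)
    case (Suc m)
    then obtain k where "(\<Sum>i<m. q ^ i) = m + t\<^sup>2 * k" by auto
    moreover obtain c where "q ^ m = 1 + t\<^sup>2 * c" using pow by auto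
    ultimately have "(\<Sum>i<Suc m. q ^ i) = Suc m + t\<^sup>2 * (k + c)" by (simp add: algebra_simps)
    then show ?case by blast
  qed simp
  then obtain k where "(\<Sum>i<t. q ^ i) = t + t\<^sup>2 * k" by blast
  then show thesis by (intro that[of k]) (simp add: algebra_simps power2_eq_square)
qed

lemma geometric_sum_nat:
  fixes q :: nat
  assumes "0 < q"
  shows "(q - 1) * (\<Sum>i<t. q ^ i) = q ^ t - 1"
proof (induction t)
  case (Suc t)
  have "1 \<le> q ^ t" using assms by simp
  then show ?case using Suc assms by (simp add: algebra_simps)
qed simp

section \<open>Semidirect products\<close>

lemma semidirect_simps [simp]:
  "carrier (semidirect N H act) = carrier N \<times> carrier H"
  "\<one>\<^bsub>semidirect N H act\<^esub> = (\<one>\<^bsub>N\<^esub>, \<one>\<^bsub>H\<^esub>)"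
  "(n, h) \<otimes>\<^bsub>semidirect N H act\<^esub> (n', h') = (n \<otimes>\<^bsub>N\<^esub> act h n', h \<otimes>\<^bsub>H\<^esub> h')"
  by (simp_all add: semidirect_def)

lemma group_semidirect:
  assumes "group N" "group H"
    and hom: "\<And>h. h \<in> carrier H \<Longrightarrow> act h \<in> hom N N"
    and act_one: "\<And>n. n \<in> carrier N \<Longrightarrow> act \<one>\<^bsub>H\<^esub> n = n"
    and act_mult: "\<And>h h' n. \<lbrakk>h \<in> carrier H; h' \<in> carrier H; n \<in> carrier N\<rbrakk> \<Longrightarrow>
      act (h \<otimes>\<^bsub>H\<^esub> h') n = act h (act h' n)"
  shows "group (semidirect N H act)"
proof -
  interpret N: group N by fact
  interpret H: group H by fact
  have closed: "act h n \<in> carrier N" if "h \<in> carrier H" "n \<in> carrier N" for h n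
    using hom_in_carrier[OF hom[OF that(1)] that(2)] .
  have act_dist: "act h (n \<otimes>\<^bsub>N\<^esub> n') = act h n \<otimes>\<^bsub>N\<^esub> act h n'"
    if "h \<in> carrier H" "n \<in> carrier N" "n' \<in> carrier N" for h n n'
    using hom_mult[OF hom[OF that(1)] that(2,3)] .
  show ?thesis
  proof (rule groupI)
    fix x assume "x \<in> carrier (semidirect N H act)"
    then obtain n h where x: "x = (n, h)" "n \<in> carrier N" "h \<in> carrier H" by auto
    let ?y = "(act (inv\<^bsub>H\<^esub> h) (inv\<^bsub>N\<^esub> n), inv\<^bsub>H\<^esub> h)"
    have "?y \<otimes>\<^bsub>semidirect N H act\<^esub> x = (act (inv\<^bsub>H\<^esub> h) (inv\<^bsub>N\<^esub> n \<otimes>\<^bsub>N\<^esub> n), \<one>\<^bsub>H\<^esub>)"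
      using x by (subst act_dist) simp_all
    also have "\<dots> = \<one>\<^bsub>semidirect N H act\<^esub>"
      using x hom_one[OF hom N.is_group N.is_group, of "inv\<^bsub>H\<^esub> h"] by simp
    finally show "\<exists>y\<in>carrier (semidirect N H act). y \<otimes>\<^bsub>semidirect N H act\<^esub> x = \<one>\<^bsub>semidirect N H act\<^esub>"
      using x closed by (intro bexI[of _ ?y]) auto
  qed (auto simp: closed act_one act_mult act_dist N.m_assoc H.m_assoc)
qed

text \<open>An injective \<open>\<phi>\<close> that maps a finite class into itself maps it onto itself.\<close>

lemma (in group) Aut_cI:
  assumes "finite (carrier G)" "\<phi> \<in> auto G"
    and "\<And>x. x \<in> carrier G \<Longrightarrow> \<exists>y \<in> carrier G. y \<otimes> x = \<phi> x \<otimes> y"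
  shows "\<phi> \<in> Aut_c G"
proof -
  have hom: "\<phi> \<in> hom G G" and inj: "inj_on \<phi> (carrier G)"
    using assms(2) by (auto simp: auto_def Bij_def bij_betw_def)
  interpret \<phi>: group_hom G G \<phi> using hom by unfold_locales
  have "\<phi> ` conj_class G x = conj_class G x" if x: "x \<in> carrier G" for x
  proof (rule endo_inj_surj)
    have sub: "conj_class G x \<subseteq> carrier G" using x by (auto simp: conj_class_def)
    then show "finite (conj_class G x)" "inj_on \<phi> (conj_class G x)"
      using assms(1) inj by (auto intro: finite_subset inj_on_subset)
    show "\<phi> ` conj_class G x \<subseteq> conj_class G x"
    proof clarify
      fix z assume "z \<in> conj_class G x"
      then obtain w where w: "w \<in> carrier G" "z = w \<otimes> x \<otimes> inv w" by (auto simp: conj_class_def)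
      obtain y where y: "y \<in> carrier G" "y \<otimes> x = \<phi> x \<otimes> y" using assms(3)[OF x] by blast
      have "\<phi> x = y \<otimes> x \<otimes> inv y" using x y by (simp add: m_assoc)
      then have "\<phi> z = (\<phi> w \<otimes> y) \<otimes> x \<otimes> inv (\<phi> w \<otimes> y)"
        using x y(1) w by (simp add: m_assoc inv_mult_group)
      moreover have "\<phi> w \<otimes> y \<in> carrier G" using y(1) w(1) by simp
      ultimately show "\<phi> z \<in> conj_class G x" unfolding conj_class_def by blast
    qed
  qed
  then show ?thesis using assms(2) by (simp add: Aut_c_def)
qed

section \<open>The group of semilinear maps\<close>

text \<open>Here \<open>q\<close>, \<open>\<omega>\<close> and \<open>\<zeta>\<close> stand for \<open>p\<^sup>n\<close>, \<open>\<omega>\<^bsub>t\<^sup>2\<^esub>\<close> and \<open>\<omega>\<^sub>s\<close>. That \<open>\<omega>\<close> lies in the field with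
  \<open>q\<close> elements is expressed by \<open>t\<^sup>2 dvd q - 1\<close>, together with the order of \<open>\<omega>\<close>.\<close>

locale semilinear_group = field L for L :: "'l ring" (structure) +
  fixes F :: "'l set" and p t q s :: nat and \<omega> \<zeta> :: 'l
    and D :: "'l monoid" and A :: "('l \<Rightarrow> 'l) monoid"
    and \<mu> :: "'l \<Rightarrow> 'l \<Rightarrow> 'l" and \<Phi> g h :: "'l \<Rightarrow> 'l"
    and E :: "(('l \<Rightarrow> 'l) \<times> ('l \<Rightarrow> 'l)) monoid"
    and G :: "('l \<times> (('l \<Rightarrow> 'l) \<times> ('l \<Rightarrow> 'l))) monoid"
  assumes p: "Factorial_Ring.prime p" and char: "\<And>x. x \<in> carrier L \<Longrightarrow> [p] \<cdot>\<^bsub>L\<^esub> x = \<zero>"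
    and F: "subfield F L" "card F = q ^ t"
    and q_power: "\<exists>n>0. q = p ^ n" and t: "1 < t" "coprime t p" "t\<^sup>2 dvd q - 1"
    and s: "s * t * (q - 1) = q ^ t - 1" "coprime s p" "coprime s t"
    and \<omega>: "\<omega> \<in> carrier L" "\<And>k::nat. \<omega> [^] k = \<one> \<longleftrightarrow> t\<^sup>2 dvd k"
    and \<zeta>: "\<zeta> \<in> carrier L" "\<And>k::nat. \<zeta> [^] k = \<one> \<longleftrightarrow> s dvd k"
    and D: "D = add_monoid (L\<lparr>carrier := F\<rparr>)"
    and A: "A = AutoGroup D"
    and \<mu>: "\<And>c. \<mu> c = (\<lambda>x \<in> F. c \<otimes> x)"
    and \<Phi>: "\<Phi> = (\<lambda>x \<in> F. x [^] q)"
    and g: "g = \<mu> \<zeta>"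
    and h: "h = \<Phi> \<otimes>\<^bsub>A\<^esub> \<mu> \<omega>"
    and E: "E = semidirect (subgroup_generated A {g}) (subgroup_generated A {h})
      (\<lambda>y x. y \<otimes>\<^bsub>A\<^esub> x \<otimes>\<^bsub>A\<^esub> inv\<^bsub>A\<^esub> y)"
    and G: "G = semidirect D E (\<lambda>(x, y). x \<otimes>\<^bsub>A\<^esub> y)"
begin

lemma q: "1 < q"
  using q_power one_less_power[OF prime_gt_1_nat[OF p]] by auto

lemma finite_F: "finite F"
  using F(2) q by (intro card_ge_0_finite) simp

lemma F_L [simp]: "x \<in> F \<Longrightarrow> x \<in> carrier L"
  using subfieldE(3)[OF F(1)] by auto

lemma F_closed [simp]:
  "\<zero> \<in> F" "\<one> \<in> F" "\<lbrakk>x \<in> F; y \<in> F\<rbrakk> \<Longrightarrow> x \<oplus> y \<in> F" "\<lbrakk>x \<in> F; y \<in> F\<rbrakk> \<Longrightarrow> x \<otimes> y \<in> F"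
  "x \<in> F \<Longrightarrow> \<ominus> x \<in> F" "\<lbrakk>x \<in> F; y \<in> F\<rbrakk> \<Longrightarrow> x \<ominus> y \<in> F"
  using subringE(2,3,5,6,7)[OF subfieldE(1)[OF F(1)]] by (auto simp: minus_eq)

lemma F_pow [simp]: "x \<in> F \<Longrightarrow> x [^] (k::nat) \<in> F"
  by (induction k) auto

lemma s_pos: "0 < s"
  using s(1) one_less_power[OF q, of t] t(1) by (cases "s = 0") auto

lemma \<omega>_F [simp]: "\<omega> \<in> F"
proof (rule mem_finite_subfield[OF F(1) finite_F \<omega>(1)])
  have "t\<^sup>2 dvd q ^ t - 1" using t(3) s(1) by (metis dvd_mult dvd_trans dvd_triv_right)
  then show "\<omega> [^] (card F - 1) = \<one>" by (simp add: \<omega>(2) F(2))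
qed

lemma \<zeta>_F [simp]: "\<zeta> \<in> F"
proof (rule mem_finite_subfield[OF F(1) finite_F \<zeta>(1)])
  have "s dvd q ^ t - 1" using s(1) by (metis dvd_triv_left mult.assoc)
  then show "\<zeta> [^] (card F - 1) = \<one>" by (simp add: \<zeta>(2) F(2))
qed

lemma \<omega>_nonzero [simp]: "\<omega> \<noteq> \<zero>"
  using \<omega>(2)[of "t\<^sup>2"] t(1) by (auto simp: nat_pow_zero)

lemma \<zeta>_nonzero [simp]: "\<zeta> \<noteq> \<zero>"
  using \<zeta>(2)[of s] s_pos by (auto simp: nat_pow_zero)

lemma frob_period: "x \<in> F \<Longrightarrow> x [^] (q ^ (t * k)) = x"
proof (induction k)
  case (Suc k)
  have "x [^] (q ^ (t * Suc k)) = (x [^] (q ^ (t * k))) [^] (q ^ t)"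
  proof -
    have "q ^ (t * Suc k) = q ^ (t * k) * q ^ t" by (simp add: power_add[symmetric] add.commute)
    then show ?thesis using Suc.prems by (simp add: nat_pow_pow)
  qed
  then show ?case using Suc subfield_pow_card[OF F(1) finite_F] F(2) by simp
qed simp

lemma frob_mod: "x \<in> F \<Longrightarrow> x [^] (q ^ j) = x [^] (q ^ (j mod t))"
proof -
  assume x: "x \<in> F"
  have "x [^] (q ^ j) = x [^] (q ^ (t * (j div t)) * q ^ (j mod t))"
    by (metis mult_div_mod_eq power_add)
  also have "\<dots> = (x [^] (q ^ (t * (j div t)))) [^] (q ^ (j mod t))"
    using x by (simp add: nat_pow_pow)
  finally show ?thesis using frob_period[OF x] by simp
qed

lemma frob_add: "\<lbrakk>x \<in> F; y \<in> F\<rbrakk> \<Longrightarrow> (x \<oplus> y) [^] (q ^ j) = x [^] (q ^ j) \<oplus> y [^] (q ^ j)"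
proof -
  assume xy: "x \<in> F" "y \<in> F"
  obtain n where "q = p ^ n" using q_power by auto
  then show ?thesis using frobenius_add[OF p char, of x y "n * j"] xy by (simp add: power_mult)
qed

lemma frob_mult: "\<lbrakk>x \<in> F; y \<in> F\<rbrakk> \<Longrightarrow> (x \<otimes> y) [^] (k::nat) = x [^] k \<otimes> y [^] k"
  by (simp add: nat_pow_distrib)

lemma frob_\<omega> [simp]: "\<omega> [^] (q ^ j) = \<omega>"
proof (induction j)
  case (Suc j)
  have "\<omega> [^] q = \<omega> [^] (q - 1) \<otimes> \<omega>" using q by (metis Suc_diff_1 nat_pow_Suc less_trans zero_less_one)
  moreover have "\<omega> [^] (q - 1) = \<one>" using t(3) \<omega>(2) by blast
  ultimately have "\<omega> [^] q = \<omega>" using \<omega>(1) by simp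
  moreover have "\<omega> [^] (q ^ Suc j) = (\<omega> [^] (q ^ j)) [^] q"
    using \<omega>(1) by (simp add: nat_pow_pow mult.commute)
  ultimately show ?case using Suc.IH by simp
qed (use \<omega>(1) in simp)

text \<open>With \<open>r = j mod t\<close>, all \<open>q\<^sup>t\<close> elements of \<open>F\<close> would be roots of \<open>X\<^bsup>q^r\<^esup> - X\<close>, which is too many
  if \<open>0 < r < t\<close>.\<close>

lemma frob_trivial_imp_dvd:
  assumes "\<And>x. x \<in> F \<Longrightarrow> x [^] (q ^ j) = x" shows "t dvd j"
proof (rule ccontr)
  assume "\<not> t dvd j"
  define r where "r = j mod t"
  have r: "0 < r" "r < t" using \<open>\<not> t dvd j\<close> t(1) by (auto simp: r_def dvd_eq_mod_eq_0)
  have qr: "1 < q ^ r" using one_less_power[OF q r(1)] .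
  have "F - {\<zero>} \<subseteq> {x \<in> carrier L. x [^] (q ^ r - 1) = \<one>}"
  proof clarify
    fix x assume x: "x \<in> F" "x \<noteq> \<zero>"
    have "x [^] (q ^ r) = x" using assms[OF x(1)] frob_mod[OF x(1), of j] by (simp add: r_def)
    moreover have "x [^] (q ^ r) = x [^] (q ^ r - 1) \<otimes> x"
      using qr by (metis Suc_diff_1 nat_pow_Suc less_trans zero_less_one)
    ultimately have "x [^] (q ^ r - 1) \<otimes> x = \<one> \<otimes> x" using x by simp
    then have "x [^] (q ^ r - 1) = \<one>" using x by (subst (asm) m_rcancel) auto
    then show "x \<in> carrier L \<and> x [^] (q ^ r - 1) = \<one>" using x by simp
  qed
  moreover have "0 < q ^ r - 1" using qr by simp
  ultimately have "card (F - {\<zero>}) \<le> q ^ r - 1"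
    using card_roots_of_unity[of "q ^ r - 1"] card_mono by (meson le_trans)
  then have "q ^ t - 1 \<le> q ^ r - 1" using F(2) by simp
  then have "q ^ t \<le> q ^ r" using qr by simp
  then show False using r q by (simp add: power_increasing_iff)
qed

lemma D_simps [simp]: "carrier D = F" "x \<otimes>\<^bsub>D\<^esub> y = x \<oplus> y" "\<one>\<^bsub>D\<^esub> = \<zero>"
  by (simp_all add: D)

lemma comm_group_D: "comm_group D"
proof -
  interpret F: field "L\<lparr>carrier := F\<rparr>" by (rule subfield_iff(2)[OF F(1)])
  show ?thesis unfolding D by (rule F.a_comm_group)
qed

sublocale D: comm_group D by (rule comm_group_D)

sublocale A: group A unfolding A by (rule D.AutoGroup)

lemma A_carrier: "carrier A = auto D"
  by (simp add: A AutoGroup_def)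

lemma A_mult: "\<lbrakk>x \<in> carrier A; y \<in> carrier A\<rbrakk> \<Longrightarrow> x \<otimes>\<^bsub>A\<^esub> y = compose F x y"
  using D.AutoGroup_mult by (simp add: A_carrier A[symmetric])

lemma A_one: "\<one>\<^bsub>A\<^esub> = (\<lambda>x \<in> F. x)"
  by (simp add: A AutoGroup_def BijGroup_def)

lemma A_one_apply [simp]: "v \<in> F \<Longrightarrow> \<one>\<^bsub>A\<^esub> v = v"
  by (simp add: A_one)

lemma A_apply: "\<lbrakk>x \<in> carrier A; y \<in> carrier A; v \<in> F\<rbrakk> \<Longrightarrow> (x \<otimes>\<^bsub>A\<^esub> y) v = x (y v)"
  by (simp add: A_mult compose_def)

lemma A_closed: "\<lbrakk>x \<in> carrier A; v \<in> F\<rbrakk> \<Longrightarrow> x v \<in> F"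
  by (auto simp: A_carrier auto_def hom_def)

lemma A_add: "\<lbrakk>x \<in> carrier A; v \<in> F; w \<in> F\<rbrakk> \<Longrightarrow> x (v \<oplus> w) = x v \<oplus> x w"
  by (auto simp: A_carrier auto_def hom_def)

lemma A_eqI: "\<lbrakk>x \<in> carrier A; y \<in> carrier A; \<And>v. v \<in> F \<Longrightarrow> x v = y v\<rbrakk> \<Longrightarrow> x = y"
  by (auto simp: A_carrier auto_def Bij_def intro: extensionalityI)

lemma \<mu>_closed [simp]: "\<lbrakk>c \<in> F; c \<noteq> \<zero>\<rbrakk> \<Longrightarrow> \<mu> c \<in> carrier A"
proof -
  assume c: "c \<in> F" "c \<noteq> \<zero>"
  define c' where "c' = c [^] (card F - 2)"
  have "q \<le> q ^ t" using q t(1) by (intro self_le_power) auto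
  then have "card F - 1 = Suc (card F - 2)" using F(2) q by simp
  then have inv: "c' \<otimes> c = \<one>" "c \<otimes> c' = \<one>"
    using subfield_pow_eq_one[OF F(1) finite_F c] c by (simp_all add: c'_def m_comm)
  have c': "c' \<in> F" using c by (simp add: c'_def)
  have "bij_betw (\<mu> c) F F"
    using c c' inv by (intro bij_betw_byWitness[where f' = "\<mu> c'"]) (auto simp: \<mu> m_assoc[symmetric])
  then show ?thesis
    using c by (auto simp: A_carrier auto_def Bij_def hom_def \<mu> r_distr)
qed

lemma \<Phi>_closed [simp]: "\<Phi> \<in> carrier A"
proof -
  have per: "(x [^] q) [^] (q ^ (t - 1)) = x" "(x [^] (q ^ (t - 1))) [^] q = x" if x: "x \<in> F" for x
  proof -
    have "q * q ^ (t - 1) = q ^ t" using t(1) by (metis power_Suc Suc_diff_1 less_trans zero_less_one)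
    then show "(x [^] q) [^] (q ^ (t - 1)) = x" "(x [^] (q ^ (t - 1))) [^] q = x"
      using frob_period[OF x, of 1] x by (simp_all add: nat_pow_pow mult.commute)
  qed
  have "bij_betw \<Phi> F F"
    using per by (intro bij_betw_byWitness[where f' = "\<lambda>x. x [^] (q ^ (t - 1))"]) (auto simp: \<Phi>)
  then show ?thesis
    using frob_add[where j = 1] by (auto simp: A_carrier auto_def Bij_def hom_def \<Phi>)
qed

lemma g_closed [simp]: "g \<in> carrier A" and h_closed [simp]: "h \<in> carrier A"
  by (simp_all add: g h)

lemma g_apply: "v \<in> F \<Longrightarrow> g v = \<zeta> \<otimes> v"
  by (simp add: g \<mu>)

lemma g_pow: "v \<in> F \<Longrightarrow> (g [^]\<^bsub>A\<^esub> (i::nat)) v = \<zeta> [^] i \<otimes> v"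
  by (induction i arbitrary: v) (simp_all add: A_apply g_apply m_assoc)

lemma h_apply: "v \<in> F \<Longrightarrow> h v = \<omega> \<otimes> v [^] q"
  using frob_\<omega>[of 1] by (simp add: h A_apply) (simp add: \<Phi> \<mu> frob_mult)

lemma h_pow: "v \<in> F \<Longrightarrow> (h [^]\<^bsub>A\<^esub> (j::nat)) v = \<omega> [^] j \<otimes> v [^] (q ^ j)"
proof (induction j arbitrary: v)
  case (Suc j)
  then have "(h [^]\<^bsub>A\<^esub> Suc j) v = \<omega> [^] j \<otimes> (\<omega> \<otimes> v [^] q) [^] (q ^ j)"
    by (simp add: A_apply h_apply)
  then show ?case using Suc.prems by (simp add: frob_mult nat_pow_pow m_assoc)
qed simp

lemma ord_g: "A.ord g = s"
proof (rule iffD2[OF A.ord_unique]; simp?; intro allI)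
  fix i :: nat
  have "g [^]\<^bsub>A\<^esub> i = \<one>\<^bsub>A\<^esub> \<longleftrightarrow> \<zeta> [^] i = \<one>"
  proof
    assume "g [^]\<^bsub>A\<^esub> i = \<one>\<^bsub>A\<^esub>"
    then show "\<zeta> [^] i = \<one>" using g_pow[of \<one> i] by simp
  next
    assume "\<zeta> [^] i = \<one>"
    then show "g [^]\<^bsub>A\<^esub> i = \<one>\<^bsub>A\<^esub>" by (intro A_eqI) (simp_all add: g_pow)
  qed
  then show "g [^]\<^bsub>A\<^esub> i = \<one>\<^bsub>A\<^esub> \<longleftrightarrow> s dvd i" using \<zeta>(2) by simp
qed

lemma ord_h: "A.ord h = t\<^sup>2"
proof (rule iffD2[OF A.ord_unique]; simp?; intro allI)
  fix j :: nat
  show "h [^]\<^bsub>A\<^esub> j = \<one>\<^bsub>A\<^esub> \<longleftrightarrow> t\<^sup>2 dvd j"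
  proof
    assume "h [^]\<^bsub>A\<^esub> j = \<one>\<^bsub>A\<^esub>"
    then show "t\<^sup>2 dvd j" using h_pow[of \<one> j] by (simp add: \<omega>(2)[symmetric])
  next
    assume j: "t\<^sup>2 dvd j"
    then have "t dvd j" by (metis dvd_mult_left power2_eq_square)
    then obtain k where "j = t * k" by blast
    then show "h [^]\<^bsub>A\<^esub> j = \<one>\<^bsub>A\<^esub>"
      using j \<omega>(2)[of j] frob_period[of _ k] by (intro A_eqI) (simp_all add: h_pow)
  qed
qed

lemma h_pow_g_pow: "h [^]\<^bsub>A\<^esub> (j::nat) \<otimes>\<^bsub>A\<^esub> g [^]\<^bsub>A\<^esub> (i::nat) = g [^]\<^bsub>A\<^esub> (i * q ^ j) \<otimes>\<^bsub>A\<^esub> h [^]\<^bsub>A\<^esub> j"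
  by (intro A_eqI) (simp_all add: A_apply A_closed g_pow h_pow frob_mult nat_pow_pow m_ac)

lemma conj_pow: "h [^]\<^bsub>A\<^esub> (j::nat) \<otimes>\<^bsub>A\<^esub> g [^]\<^bsub>A\<^esub> (i::nat) \<otimes>\<^bsub>A\<^esub> inv\<^bsub>A\<^esub> (h [^]\<^bsub>A\<^esub> j) = g [^]\<^bsub>A\<^esub> (i * q ^ j)"
  by (simp add: h_pow_g_pow A.m_assoc)

lemma conj_g: "h \<otimes>\<^bsub>A\<^esub> g \<otimes>\<^bsub>A\<^esub> inv\<^bsub>A\<^esub> h = g [^]\<^bsub>A\<^esub> q"
  using conj_pow[of 1 1] by simp

abbreviation gens_g :: "('l \<Rightarrow> 'l) set" where "gens_g \<equiv> carrier (subgroup_generated A {g})"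
abbreviation gens_h :: "('l \<Rightarrow> 'l) set" where "gens_h \<equiv> carrier (subgroup_generated A {h})"

lemma gens_g: "gens_g = {g [^]\<^bsub>A\<^esub> i | i::nat. True}" "card gens_g = s"
proof -
  have gen: "gens_g = generate A {g}" by (simp add: carrier_subgroup_generated)
  show "gens_g = {g [^]\<^bsub>A\<^esub> i | i::nat. True}"
    unfolding gen using A.generate_pow_nat[OF g_closed] ord_g s_pos t(1) by auto
  show "card gens_g = s" unfolding gen using A.generate_pow_card[OF g_closed] ord_g by simp
qed

lemma gens_h: "gens_h = {h [^]\<^bsub>A\<^esub> i | i::nat. True}" "card gens_h = t\<^sup>2"
proof -
  have gen: "gens_h = generate A {h}" by (simp add: carrier_subgroup_generated)
  show "gens_h = {h [^]\<^bsub>A\<^esub> i | i::nat. True}"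
    unfolding gen using A.generate_pow_nat[OF h_closed] ord_h s_pos t(1) by auto
  show "card gens_h = t\<^sup>2" unfolding gen using A.generate_pow_card[OF h_closed] ord_h by simp
qed

lemma E_carrier: "carrier E = gens_g \<times> gens_h"
  by (simp add: E)

lemma E_mult: "(x, y) \<otimes>\<^bsub>E\<^esub> (x', y') = (x \<otimes>\<^bsub>A\<^esub> (y \<otimes>\<^bsub>A\<^esub> x' \<otimes>\<^bsub>A\<^esub> inv\<^bsub>A\<^esub> y), y \<otimes>\<^bsub>A\<^esub> y')"
  by (simp add: E)

lemma E_one: "\<one>\<^bsub>E\<^esub> = (\<one>\<^bsub>A\<^esub>, \<one>\<^bsub>A\<^esub>)"
  by (simp add: E)

lemma group_E: "group E"
  unfolding E
proof (rule group_semidirect)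
  show "(\<lambda>x. y \<otimes>\<^bsub>A\<^esub> x \<otimes>\<^bsub>A\<^esub> inv\<^bsub>A\<^esub> y) \<in> hom (subgroup_generated A {g}) (subgroup_generated A {g})"
    if "y \<in> gens_h" for y
  proof (rule homI)
    have y: "y \<in> carrier A" using that gens_h by auto
    show "y \<otimes>\<^bsub>A\<^esub> x \<otimes>\<^bsub>A\<^esub> inv\<^bsub>A\<^esub> y \<in> gens_g" if x: "x \<in> gens_g" for x
      using x \<open>y \<in> gens_h\<close> conj_pow unfolding gens_g gens_h by auto
    show "y \<otimes>\<^bsub>A\<^esub> (x \<otimes>\<^bsub>subgroup_generated A {g}\<^esub> x') \<otimes>\<^bsub>A\<^esub> inv\<^bsub>A\<^esub> y =
        y \<otimes>\<^bsub>A\<^esub> x \<otimes>\<^bsub>A\<^esub> inv\<^bsub>A\<^esub> y \<otimes>\<^bsub>subgroup_generated A {g}\<^esub> (y \<otimes>\<^bsub>A\<^esub> x' \<otimes>\<^bsub>A\<^esub> inv\<^bsub>A\<^esub> y)"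
      if "x \<in> gens_g" "x' \<in> gens_g" for x x'
      using that y unfolding gens_g by (auto simp: A.m_assoc)
  qed
qed (auto simp: gens_g gens_h A.m_assoc A.inv_mult_group)

sublocale E: group E by (rule group_E)

text \<open>The elements of \<open>E\<close> are pairs; \<open>\<rho>\<close> turns a pair into the automorphism of \<open>D\<close> that it stands for.\<close>

definition \<rho> :: "('l \<Rightarrow> 'l) \<times> ('l \<Rightarrow> 'l) \<Rightarrow> 'l \<Rightarrow> 'l"
  where "\<rho> = (\<lambda>(x, y). x \<otimes>\<^bsub>A\<^esub> y)"

lemma E_cases:
  assumes "e \<in> carrier E"
  obtains i j where "e = (g [^]\<^bsub>A\<^esub> (i::nat), h [^]\<^bsub>A\<^esub> (j::nat))"
    "\<And>v. v \<in> F \<Longrightarrow> \<rho> e v = \<zeta> [^] i \<otimes> \<omega> [^] j \<otimes> v [^] (q ^ j)"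
proof -
  obtain i j where "e = (g [^]\<^bsub>A\<^esub> (i::nat), h [^]\<^bsub>A\<^esub> (j::nat))"
    using assms unfolding E_carrier gens_g gens_h by auto
  moreover have "\<rho> (g [^]\<^bsub>A\<^esub> i, h [^]\<^bsub>A\<^esub> j) v = \<zeta> [^] i \<otimes> \<omega> [^] j \<otimes> v [^] (q ^ j)" if "v \<in> F" for v
    using that by (simp add: \<rho>_def A_apply A_closed g_pow h_pow m_assoc)
  ultimately show thesis using that by blast
qed

lemma powers_in_E: "(g [^]\<^bsub>A\<^esub> (i::nat), h [^]\<^bsub>A\<^esub> (j::nat)) \<in> carrier E"
  unfolding E_carrier gens_g gens_h by blast

lemma \<rho>_hom: "\<rho> \<in> hom E A"
proof (rule homI)
  show "\<rho> e \<in> carrier A" if "e \<in> carrier E" for e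
    using that unfolding E_carrier gens_g gens_h by (auto simp: \<rho>_def)
  show "\<rho> (e \<otimes>\<^bsub>E\<^esub> e') = \<rho> e \<otimes>\<^bsub>A\<^esub> \<rho> e'" if "e \<in> carrier E" "e' \<in> carrier E" for e e'
    using that unfolding E_carrier gens_g gens_h by (auto simp: \<rho>_def E_mult A.m_assoc)
qed

text \<open>The coprimality of the orders of \<open>g\<close> and \<open>h\<close> makes \<open>\<langle>g\<rangle>\<close> and \<open>\<langle>h\<rangle>\<close> intersect trivially in \<open>Aut(D)\<close>.\<close>

lemma \<rho>_inj: "inj_on \<rho> (carrier E)"
proof -
  interpret \<rho>: group_hom E A \<rho> using \<rho>_hom by unfold_locales
  have "e = \<one>\<^bsub>E\<^esub>" if e: "e \<in> carrier E" "\<rho> e = \<one>\<^bsub>A\<^esub>" for e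
  proof -
    obtain i j where ij: "e = (g [^]\<^bsub>A\<^esub> (i::nat), h [^]\<^bsub>A\<^esub> (j::nat))" using E_cases[OF e(1)] .
    let ?x = "g [^]\<^bsub>A\<^esub> i" and ?y = "h [^]\<^bsub>A\<^esub> j"
    have xy: "?x \<otimes>\<^bsub>A\<^esub> ?y = \<one>\<^bsub>A\<^esub>" using e ij by (simp add: \<rho>_def)
    have x_inv: "?x = inv\<^bsub>A\<^esub> ?y" using A.inv_equality[OF xy] by simp
    have "?x [^]\<^bsub>A\<^esub> s = \<one>\<^bsub>A\<^esub>"
      using A.pow_eq_id[of g "i * s"] ord_g by (simp add: A.nat_pow_pow)
    then have 1: "A.ord ?x dvd s" using A.pow_eq_id[of ?x s] by simp
    have "?y [^]\<^bsub>A\<^esub> (t\<^sup>2) = \<one>\<^bsub>A\<^esub>"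
      using A.pow_eq_id[of h "j * t\<^sup>2"] ord_h by (simp add: A.nat_pow_pow)
    then have "A.ord ?y dvd t\<^sup>2" using A.pow_eq_id[of ?y "t\<^sup>2"] by simp
    then have "A.ord ?x dvd t\<^sup>2" using A.ord_inv[of ?y] unfolding x_inv[symmetric] by simp
    moreover have "coprime s (t\<^sup>2)" using s(3) by simp
    ultimately have "A.ord ?x = 1" using 1 coprime_common_divisor_nat by blast
    then have "?x = \<one>\<^bsub>A\<^esub>" using A.ord_eq_1[of ?x] by simp
    then show ?thesis using ij xy by (simp add: E_one)
  qed
  then show ?thesis using \<rho>.inj_iff_trivial_ker by (auto simp: kernel_def)
qed

lemma faithful_E: "faithful_action E (carrier D) \<rho>"
proof -
  have sub: "carrier A \<subseteq> carrier (BijGroup (carrier D))"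
    by (auto simp: A_carrier auto_def BijGroup_def)
  have mult: "x \<otimes>\<^bsub>A\<^esub> y = x \<otimes>\<^bsub>BijGroup (carrier D)\<^esub> y" for x y
    by (simp add: A AutoGroup_def)
  have "\<rho> \<in> hom E (BijGroup (carrier D))"
    using \<rho>_hom sub unfolding hom_def mult by blast
  then have "group_hom E (BijGroup (carrier D)) \<rho>"
    by (simp add: group_hom_def group_hom_axioms_def group_E group_BijGroup)
  then show ?thesis
    by (simp add: faithful_action_def group_action_def faithful_action_axioms_def \<rho>_inj)
qed

lemma \<rho>_closed [simp]: "\<lbrakk>e \<in> carrier E; v \<in> F\<rbrakk> \<Longrightarrow> \<rho> e v \<in> F"
  using hom_in_carrier[OF \<rho>_hom] A_closed by blast

lemma \<rho>_add: "\<lbrakk>e \<in> carrier E; v \<in> F; w \<in> F\<rbrakk> \<Longrightarrow> \<rho> e (v \<oplus> w) = \<rho> e v \<oplus> \<rho> e w"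
  using hom_in_carrier[OF \<rho>_hom] A_add by blast

lemma \<rho>_mult: "\<lbrakk>e \<in> carrier E; e' \<in> carrier E; v \<in> F\<rbrakk> \<Longrightarrow> \<rho> (e \<otimes>\<^bsub>E\<^esub> e') v = \<rho> e (\<rho> e' v)"
  using hom_mult[OF \<rho>_hom, of e e'] hom_in_carrier[OF \<rho>_hom] A_apply by simp

lemma \<rho>_one: "v \<in> F \<Longrightarrow> \<rho> \<one>\<^bsub>E\<^esub> v = v"
  by (simp add: \<rho>_def E_one)

lemma \<rho>_\<omega>: "\<lbrakk>e \<in> carrier E; v \<in> F\<rbrakk> \<Longrightarrow> \<rho> e (\<omega> \<otimes> v) = \<omega> \<otimes> \<rho> e v"
  by (erule E_cases) (simp add: frob_mult m_ac)

lemma finite_E: "finite (carrier E)" "card (carrier E) = s * t\<^sup>2"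
proof -
  show card: "card (carrier E) = s * t\<^sup>2" by (simp add: E_carrier card_cartesian_product gens_g(2) gens_h(2))
  show "finite (carrier E)" using card s_pos t(1) by (intro card_ge_0_finite) simp
qed

lemma G_simps [simp]:
  "carrier G = F \<times> carrier E" "\<one>\<^bsub>G\<^esub> = (\<zero>, \<one>\<^bsub>E\<^esub>)"
  "(v, e) \<otimes>\<^bsub>G\<^esub> (v', e') = (v \<oplus> \<rho> e v', e \<otimes>\<^bsub>E\<^esub> e')"
  by (simp_all add: G \<rho>_def[symmetric])

lemma group_G: "group G"
  unfolding G \<rho>_def[symmetric]
  by (rule group_semidirect)
    (auto simp: D.is_group group_E \<rho>_one \<rho>_mult \<rho>_add intro!: homI)

sublocale G: group G by (rule group_G)

lemma finite_G: "finite (carrier G)"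
  using finite_F finite_E by simp

end

section \<open>A class-preserving automorphism that is not inner\<close>

context semilinear_group begin

definition \<psi> :: "'l \<times> (('l \<Rightarrow> 'l) \<times> ('l \<Rightarrow> 'l)) \<Rightarrow> 'l \<times> (('l \<Rightarrow> 'l) \<times> ('l \<Rightarrow> 'l))"
  where "\<psi> = (\<lambda>x\<in>carrier G. (\<omega> \<otimes> fst x, snd x))"

lemma \<psi>_apply: "\<lbrakk>v \<in> F; e \<in> carrier E\<rbrakk> \<Longrightarrow> \<psi> (v, e) = (\<omega> \<otimes> v, e)"
  by (simp add: \<psi>_def)

lemma \<psi>_auto: "\<psi> \<in> auto G"
proof -
  have inj: "inj_on \<psi> (carrier G)"
    by (auto simp: inj_on_def \<psi>_apply m_lcancel)
  moreover have "\<psi> ` carrier G \<subseteq> carrier G" by (auto simp: \<psi>_apply)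
  ultimately have "\<psi> ` carrier G = carrier G" using finite_G by (intro endo_inj_surj)
  moreover have "\<psi> \<in> hom G G"
    by (rule homI) (auto simp: \<psi>_apply \<rho>_\<omega> r_distr)
  ultimately show ?thesis using inj by (simp add: auto_def Bij_def bij_betw_def \<psi>_def)
qed

lemma \<rho>_minus: "\<lbrakk>e \<in> carrier E; v \<in> F; w \<in> F\<rbrakk> \<Longrightarrow> \<rho> e (v \<ominus> w) = \<rho> e v \<ominus> \<rho> e w"
proof -
  assume a: "e \<in> carrier E" "v \<in> F" "w \<in> F"
  have "\<rho> e (v \<ominus> w) \<oplus> \<rho> e w = \<rho> e v"
    using a \<rho>_add[of e "v \<ominus> w" w] by (simp add: minus_eq a_assoc l_neg)
  then show ?thesis using a by (metis F_L F_closed(6) \<rho>_closed add.inv_solve_right minus_eq)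
qed

lemma \<rho>_multiple: "\<lbrakk>e \<in> carrier E; v \<in> F\<rbrakk> \<Longrightarrow> [(k::nat)] \<cdot>\<^bsub>L\<^esub> v \<in> F \<and> \<rho> e ([k] \<cdot>\<^bsub>L\<^esub> v) = [k] \<cdot>\<^bsub>L\<^esub> (\<rho> e v)"
proof (induction k)
  case 0
  then show ?case using \<rho>_minus[of e v v] by (simp add: r_neg minus_eq)
next
  case (Suc k)
  then show ?case by (simp add: \<rho>_add)
qed

lemma \<rho>_powers:
  "v \<in> F \<Longrightarrow> \<rho> (g [^]\<^bsub>A\<^esub> (i::nat), h [^]\<^bsub>A\<^esub> (j::nat)) v = \<zeta> [^] i \<otimes> \<omega> [^] j \<otimes> v [^] (q ^ j)"
  by (simp add: \<rho>_def A_apply A_closed g_pow h_pow m_assoc)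

lemma \<rho>_pow: "\<lbrakk>e \<in> carrier E; v \<in> F\<rbrakk> \<Longrightarrow> \<rho> (e [^]\<^bsub>E\<^esub> Suc k) v = \<rho> e (\<rho> (e [^]\<^bsub>E\<^esub> k) v)"
  using E.nat_pow_Suc2[of e k] by (simp add: \<rho>_mult del: E.nat_pow_Suc)

text \<open>The order of \<open>E\<close> is prime to \<open>p\<close>, so \<open>v\<close> can be averaged over the powers of \<open>e\<close>. The difference
  between \<open>v\<close> and its average is a combination of the vectors \<open>v - e\<^sup>i v\<close>, which lie in the image of
  \<open>1 - e\<close>.\<close>

lemma fixed_point_decomposition:
  assumes e: "e \<in> carrier E" and v: "v \<in> F"
  obtains v0 w where "v0 \<in> F" "w \<in> F" "\<rho> e v0 = v0" "v = v0 \<oplus> (w \<ominus> \<rho> e w)"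
proof -
  \<comment> \<open>\<open>S\<close> is the sum of the vectors \<open>e\<^sup>i v\<close> for \<open>i < k\<close>.\<close>
  have "\<exists>S w. S \<in> F \<and> w \<in> F \<and> \<rho> e S \<oplus> v = S \<oplus> \<rho> (e [^]\<^bsub>E\<^esub> k) v \<and>
      [k] \<cdot>\<^bsub>L\<^esub> v = S \<oplus> (w \<ominus> \<rho> e w)" for k :: nat
  proof (induction k)
    case 0
    have "\<rho> e \<zero> = \<zero>" using \<rho>_multiple[OF e v, of 0] by simp
    then show ?case
      using v by (intro exI[of _ "\<zero>"]) (simp add: \<rho>_one[unfolded E_one] E_one minus_eq)
  next
    case (Suc k)
    then obtain S w where Sw: "S \<in> F" "w \<in> F" "\<rho> e S \<oplus> v = S \<oplus> \<rho> (e [^]\<^bsub>E\<^esub> k) v"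
      "[k] \<cdot>\<^bsub>L\<^esub> v = S \<oplus> (w \<ominus> \<rho> e w)" by blast
    define u where "u = \<rho> (e [^]\<^bsub>E\<^esub> k) v"
    have cl: "u \<in> F" "\<rho> e u \<in> F" "\<rho> e S \<in> F" "\<rho> e w \<in> F" using e v Sw by (simp_all add: u_def)
    have L: "u \<in> carrier L" "\<rho> e u \<in> carrier L" "\<rho> e S \<in> carrier L" "\<rho> e w \<in> carrier L"
      "S \<in> carrier L" "w \<in> carrier L" "v \<in> carrier L" using cl Sw v by simp_all
    have 1: "\<rho> e S \<oplus> v = S \<oplus> u" using Sw by (simp add: u_def)
    have "v = (\<rho> e S \<oplus> v) \<ominus> \<rho> e S" using L by algebra
    then have v_eq: "v = (S \<oplus> u) \<ominus> \<rho> e S" using 1 by simp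
    have "\<rho> e (S \<oplus> u) \<oplus> v = (\<rho> e S \<oplus> v) \<oplus> \<rho> e u"
    proof -
      have "\<rho> e (S \<oplus> u) = \<rho> e S \<oplus> \<rho> e u" using e Sw cl by (simp add: \<rho>_add)
      moreover have "\<rho> e S \<oplus> \<rho> e u \<oplus> v = (\<rho> e S \<oplus> v) \<oplus> \<rho> e u" using L by algebra
      ultimately show ?thesis by simp
    qed
    also have "\<dots> = (S \<oplus> u) \<oplus> \<rho> (e [^]\<^bsub>E\<^esub> Suc k) v"
      unfolding \<rho>_pow[OF e v] u_def[symmetric] 1 ..
    finally have 2: "\<rho> e (S \<oplus> u) \<oplus> v = (S \<oplus> u) \<oplus> \<rho> (e [^]\<^bsub>E\<^esub> Suc k) v" .
    have "[Suc k] \<cdot>\<^bsub>L\<^esub> v = (S \<oplus> (w \<ominus> \<rho> e w)) \<oplus> v" using Sw(4) by simp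
    also have "\<dots> = (S \<oplus> (w \<ominus> \<rho> e w)) \<oplus> ((S \<oplus> u) \<ominus> \<rho> e S)" using v_eq by simp
    also have "\<dots> = (S \<oplus> u) \<oplus> ((w \<oplus> S) \<ominus> (\<rho> e w \<oplus> \<rho> e S))" using L by algebra
    also have "\<rho> e w \<oplus> \<rho> e S = \<rho> e (w \<oplus> S)" using e Sw by (simp add: \<rho>_add)
    finally have 3: "[Suc k] \<cdot>\<^bsub>L\<^esub> v = (S \<oplus> u) \<oplus> ((w \<oplus> S) \<ominus> \<rho> e (w \<oplus> S))" .
    show ?case using 2 3 Sw cl by (intro exI[of _ "S \<oplus> u"] exI[of _ "w \<oplus> S"]) simp
  qed
  from this[of "order E"] obtain S w where Sw: "S \<in> F" "w \<in> F"
    "\<rho> e S \<oplus> v = S \<oplus> \<rho> (e [^]\<^bsub>E\<^esub> order E) v" "[(order E)] \<cdot>\<^bsub>L\<^esub> v = S \<oplus> (w \<ominus> \<rho> e w)" by blast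
  have "e [^]\<^bsub>E\<^esub> order E = \<one>\<^bsub>E\<^esub>" by (rule E.pow_order_eq_1[OF e])
  then have "\<rho> e S \<oplus> v = S \<oplus> v" using Sw(3) v by (simp add: \<rho>_one)
  then have fixed: "\<rho> e S = S" using e v Sw by (subst (asm) add.right_cancel) simp_all
  have "coprime (order E) p" using finite_E s(2) t(2) by (simp add: order_def)
  moreover have "0 < order E" using finite_E s_pos t(1) by (simp add: order_def)
  \<comment> \<open>Multiplication by \<open>x\<close> inverts multiplication by \<open>|E|\<close> on \<open>D\<close>.\<close>
  ultimately obtain x y where xy: "order E * x = p * y + 1"
    using bezout_nat[of "order E" p] by (auto simp: coprime_iff_gcd_eq_1)
  have "v = [(p * y + 1)] \<cdot>\<^bsub>L\<^esub> v"
  proof -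
    have "[(p * y)] \<cdot>\<^bsub>L\<^esub> v = [p] \<cdot>\<^bsub>L\<^esub> ([y] \<cdot>\<^bsub>L\<^esub> v)"
      using v add.nat_pow_pow[of v p y] by (simp add: mult.commute)
    also have "\<dots> = \<zero>" using v by (intro char) simp
    finally show ?thesis using v by simp
  qed
  also have "\<dots> = [x] \<cdot>\<^bsub>L\<^esub> ([(order E)] \<cdot>\<^bsub>L\<^esub> v)"
    unfolding xy[symmetric] using v by (intro add.nat_pow_pow[symmetric]) simp
  also have "\<dots> = [x] \<cdot>\<^bsub>L\<^esub> S \<oplus> ([x] \<cdot>\<^bsub>L\<^esub> w \<ominus> \<rho> e ([x] \<cdot>\<^bsub>L\<^esub> w))"
  proof -
    have neg: "[x] \<cdot>\<^bsub>L\<^esub> (\<ominus> \<rho> e w) = \<ominus> ([x] \<cdot>\<^bsub>L\<^esub> \<rho> e w)"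
      using e Sw by (simp add: add.nat_pow_inv)
    show ?thesis
      using e Sw \<rho>_multiple[OF e Sw(2), of x] by (simp add: minus_eq add.nat_pow_distrib neg)
  qed
  finally have "v = [x] \<cdot>\<^bsub>L\<^esub> S \<oplus> ([x] \<cdot>\<^bsub>L\<^esub> w \<ominus> \<rho> e ([x] \<cdot>\<^bsub>L\<^esub> w))" .
  moreover have "\<rho> e ([x] \<cdot>\<^bsub>L\<^esub> S) = [x] \<cdot>\<^bsub>L\<^esub> S" using \<rho>_multiple[OF e Sw(1), of x] fixed by simp
  ultimately show thesis
    using that \<rho>_multiple[OF e Sw(1), of x] \<rho>_multiple[OF e Sw(2), of x] by blast
qed

text \<open>The element \<open>l\<close> must be \<open>x \<mapsto> \<omega> v\<^bsup>1-q\<^esup> x\<^sup>q\<close>. It belongs to \<open>E\<close> because \<open>v\<^bsup>1-q\<^esup>\<close> is a root of unity of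
  order dividing \<open>(q\<^sup>t - 1) / (q - 1) = st\<close>, hence of the form \<open>\<zeta>\<^sup>i\<omega>\<^sup>t\<^sup>i\<close>, and \<open>g\<^sup>i h\<^sup>t\<^sup>i\<^sup>+\<^sup>1\<close> is the
  map \<open>x \<mapsto> \<zeta>\<^sup>i\<omega>\<^sup>t\<^sup>i\<^sup>+\<^sup>1 x\<^sup>q\<close>. That is why \<open>h\<close> is taken of order \<open>t\<^sup>2\<close> and not \<open>t\<close>.\<close>

lemma orbit_contains_multiple:
  assumes v: "v \<in> F" "v \<noteq> \<zero>"
  obtains l c where "l \<in> carrier E" "c \<in> F" "\<And>x. x \<in> F \<Longrightarrow> \<rho> l x = c \<otimes> x [^] q" "\<rho> l v = \<omega> \<otimes> v"
proof -
  \<comment> \<open>The factors have the coprime orders \<open>s\<close> and \<open>t\<close>, so \<open>z\<close> is a primitive \<open>st\<close>-th root of unity.\<close>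
  define z where "z = \<zeta> \<otimes> \<omega> [^] t"
  have z: "z \<in> carrier L" by (simp add: z_def)
  have z_pow: "z [^] k = \<zeta> [^] k \<otimes> \<omega> [^] (t * k)" for k :: nat
    by (simp add: z_def nat_pow_distrib nat_pow_pow)
  have z_order: "z [^] k = \<one> \<longleftrightarrow> s * t dvd k" for k :: nat
  proof
    assume k: "z [^] k = \<one>"
    have "(z [^] k) [^] s = \<zeta> [^] (k * s) \<otimes> \<omega> [^] (t * k * s)"
      by (simp add: z_pow nat_pow_distrib nat_pow_pow)
    moreover have "\<zeta> [^] (k * s) = \<one>" by (simp add: \<zeta>(2))
    ultimately have "\<omega> [^] (t * k * s) = \<one>" using k by simp
    then have "t * t dvd t * (k * s)" using \<omega>(2) by (simp add: power2_eq_square mult.assoc)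
    then have "t dvd k * s" using t(1) by simp
    then have "t dvd k" using s(3) by (simp add: coprime_commute coprime_dvd_mult_left_iff)
    have "(z [^] k) [^] t = \<zeta> [^] (k * t) \<otimes> \<omega> [^] (t * k * t)"
      by (simp add: z_pow nat_pow_distrib nat_pow_pow)
    moreover have "\<omega> [^] (t * k * t) = \<one>" by (simp add: \<omega>(2) power2_eq_square)
    ultimately have "\<zeta> [^] (k * t) = \<one>" using k by simp
    then have "s dvd k * t" using \<zeta>(2) by simp
    then have "s dvd k" using s(3) by (simp add: coprime_dvd_mult_left_iff)
    then show "s * t dvd k" using \<open>t dvd k\<close> s(3) by (rule semiring_gcd_class.divides_mult)
  next
    assume "s * t dvd k"
    then have "s dvd k" "t\<^sup>2 dvd t * k" by (auto simp: power2_eq_square)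
    then show "z [^] k = \<one>" using \<zeta>(2)[of k] \<omega>(2)[of "t * k"] by (simp add: z_pow)
  qed
  \<comment> \<open>This is \<open>v\<^bsup>1-q\<^esup>\<close>, because \<open>v\<^bsup>q^t\<^esup> = v\<close>.\<close>
  define c where "c = v [^] (q ^ t - q)"
  have qt: "q \<le> q ^ t" using q t(1) by (intro self_le_power) auto
  have c_mult: "c \<otimes> v [^] q = v"
    using v qt frob_period[OF v(1), of 1] by (simp add: c_def nat_pow_mult)
  have "c [^] (s * t) = \<one>"
  proof -
    have "q - 1 dvd (q ^ t - 1) - (q - 1)" using s(1) by (metis dvd_diff_nat dvd_refl dvd_triv_right)
    then have "q - 1 dvd q ^ t - q" using q by simp
    then obtain m where m: "q ^ t - q = (q - 1) * m" by blast
    have "(q ^ t - q) * (s * t) = m * (q ^ t - 1)" unfolding m s(1)[symmetric] by (simp add: mult_ac)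
    then have "c [^] (s * t) = (v [^] (q ^ t - 1)) [^] m"
      using v by (simp add: c_def nat_pow_pow mult.commute)
    also have "v [^] (q ^ t - 1) = \<one>" using subfield_pow_eq_one[OF F(1) finite_F v] F(2) by simp
    finally show ?thesis by simp
  qed
  then obtain i where i: "c = z [^] (i::nat)"
    using roots_of_unity_are_powers[OF z z_order, of c] s_pos t(1) v by (auto simp: c_def)
  define l where "l = (g [^]\<^bsub>A\<^esub> i, h [^]\<^bsub>A\<^esub> (t * i + 1))"
  have l: "\<rho> l x = (c \<otimes> \<omega>) \<otimes> x [^] q" if x: "x \<in> F" for x
  proof -
    have "(t * i + 1) mod t = 1" using t(1) by (metis add.commute mod_less mod_mult_self2)
    then have frob: "x [^] (q ^ (t * i + 1)) = x [^] q" using frob_mod[OF x, of "t * i + 1"] by simp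
    have "\<rho> l x = \<zeta> [^] i \<otimes> \<omega> [^] (t * i + 1) \<otimes> x [^] q"
      unfolding l_def \<rho>_powers[OF x] frob ..
    then show ?thesis using x by (simp add: i z_pow m_assoc)
  qed
  have cF: "c \<in> F" using v by (simp add: c_def)
  have "\<rho> l v = \<omega> \<otimes> (c \<otimes> v [^] q)" using l[OF v(1)] v cF by (simp add: m_ac)
  then have "\<rho> l v = \<omega> \<otimes> v" unfolding c_mult .
  moreover have "l \<in> carrier E" unfolding l_def by (rule powers_in_E)
  moreover have "c \<otimes> \<omega> \<in> F" using cF by simp
  ultimately show thesis using that l by blast
qed

text \<open>An element \<open>l\<close> that commutes with \<open>e\<close> and maps \<open>v0\<close> to \<open>\<omega>v0\<close> conjugates \<open>(v0, e)\<close> to \<open>(\<omega>v0, e)\<close>, and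
  \<open>(v, e)\<close> is conjugate to \<open>(v0, e)\<close> under \<open>D\<close>. The element of \<open>orbit_contains_multiple\<close> commutes
  with \<open>e\<close>, as \<open>v0\<close> is fixed by \<open>e\<close>: the maps \<open>le\<close> and \<open>el\<close> have the form \<open>x \<mapsto> c x\<^sup>m\<close> with the same
  \<open>m\<close>, and they agree at \<open>v0\<close>.\<close>

lemma \<psi>_class_preserving: "\<psi> \<in> Aut_c G"
proof (rule G.Aut_cI[OF finite_G \<psi>_auto])
  fix x assume "x \<in> carrier G"
  then obtain v e where x: "x = (v, e)" "v \<in> F" "e \<in> carrier E" by auto
  obtain v0 w where v0: "v0 \<in> F" "w \<in> F" "\<rho> e v0 = v0" "v = v0 \<oplus> (w \<ominus> \<rho> e w)"
    using fixed_point_decomposition[OF x(3,2)] .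
  have "\<exists>l\<in>carrier E. l \<otimes>\<^bsub>E\<^esub> e = e \<otimes>\<^bsub>E\<^esub> l \<and> \<rho> l v0 = \<omega> \<otimes> v0"
  proof (cases "v0 = \<zero>")
    case True
    then show ?thesis using x by (intro bexI[of _ "\<one>\<^bsub>E\<^esub>"]) (simp_all add: \<rho>_one)
  next
    case False
    obtain l c where l: "l \<in> carrier E" "c \<in> F" "\<And>x. x \<in> F \<Longrightarrow> \<rho> l x = c \<otimes> x [^] q" "\<rho> l v0 = \<omega> \<otimes> v0"
      using orbit_contains_multiple[OF v0(1) False] by blast
    obtain i j where "\<And>v. v \<in> F \<Longrightarrow> \<rho> e v = \<zeta> [^] (i::nat) \<otimes> \<omega> [^] (j::nat) \<otimes> v [^] (q ^ j)"
      using E_cases[OF x(3)] by metis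
    then obtain b where b: "b \<in> F" "\<And>v. v \<in> F \<Longrightarrow> \<rho> e v = b \<otimes> v [^] (q ^ j)"
      by (metis F_closed(4) F_pow \<omega>_F \<zeta>_F)
    have le: "\<rho> l (\<rho> e v) = c \<otimes> b [^] q \<otimes> v [^] (q ^ j * q)" if "v \<in> F" for v
      using that b l by (simp add: frob_mult nat_pow_pow m_assoc)
    have el: "\<rho> e (\<rho> l v) = b \<otimes> c [^] (q ^ j) \<otimes> v [^] (q ^ j * q)" if "v \<in> F" for v
      using that b l by (simp add: frob_mult nat_pow_pow m_assoc mult.commute)
    have "\<rho> l (\<rho> e v0) = \<rho> e (\<rho> l v0)" using v0 x by (simp add: l(4) \<rho>_\<omega>)
    then have "c \<otimes> b [^] q \<otimes> v0 [^] (q ^ j * q) = b \<otimes> c [^] (q ^ j) \<otimes> v0 [^] (q ^ j * q)"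
      using le[OF v0(1)] el[OF v0(1)] by simp
    then have "c \<otimes> b [^] q = b \<otimes> c [^] (q ^ j)"
      using b(1) l(2) v0(1) pow_nonzero[of v0 "q ^ j * q"] False by (subst (asm) m_rcancel) auto
    then have "\<rho> l (\<rho> e v) = \<rho> e (\<rho> l v)" if "v \<in> F" for v using le[OF that] el[OF that] by simp
    then have "\<rho> (l \<otimes>\<^bsub>E\<^esub> e) = \<rho> (e \<otimes>\<^bsub>E\<^esub> l)"
      using l(1) x by (intro A_eqI hom_in_carrier[OF \<rho>_hom]) (simp_all add: \<rho>_mult)
    then have "l \<otimes>\<^bsub>E\<^esub> e = e \<otimes>\<^bsub>E\<^esub> l" using \<rho>_inj l(1) x by (auto simp: inj_on_def)
    then show ?thesis using l by blast
  qed
  then obtain l where l: "l \<in> carrier E" "l \<otimes>\<^bsub>E\<^esub> e = e \<otimes>\<^bsub>E\<^esub> l" "\<rho> l v0 = \<omega> \<otimes> v0" by blast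
  \<comment> \<open>The conjugating element is \<open>(a, l)\<close>: translation by \<open>a\<close> turns \<open>lw - elw\<close> into \<open>\<omega>(w - ew)\<close>.\<close>
  define a where "a = \<omega> \<otimes> w \<ominus> \<rho> l w"
  have a: "a \<in> F" using l(1) v0 by (simp add: a_def)
  have comm: "\<rho> e (\<rho> l w) = \<rho> l (\<rho> e w)" using l x v0 by (simp add: \<rho>_mult[symmetric])
  have "a \<oplus> \<rho> l v = \<omega> \<otimes> v \<oplus> \<rho> e a"
  proof -
    have "\<rho> l v = \<omega> \<otimes> v0 \<oplus> (\<rho> l w \<ominus> \<rho> l (\<rho> e w))"
      using l v0 x by (simp add: \<rho>_add \<rho>_minus)
    moreover have "\<rho> e a = \<omega> \<otimes> \<rho> e w \<ominus> \<rho> l (\<rho> e w)"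
      using l v0 x comm by (simp add: a_def \<rho>_minus \<rho>_\<omega>)
    moreover have "(\<omega> \<otimes> w \<ominus> \<rho> l w) \<oplus> (\<omega> \<otimes> v0 \<oplus> (\<rho> l w \<ominus> \<rho> l (\<rho> e w))) =
        \<omega> \<otimes> (v0 \<oplus> (w \<ominus> \<rho> e w)) \<oplus> (\<omega> \<otimes> \<rho> e w \<ominus> \<rho> l (\<rho> e w))"
    proof -
      have "\<omega> \<in> carrier L" "w \<in> carrier L" "v0 \<in> carrier L" "\<rho> l w \<in> carrier L" "\<rho> e w \<in> carrier L"
        "\<rho> l (\<rho> e w) \<in> carrier L" using l v0 x by simp_all
      then show ?thesis by algebra
    qed
    ultimately show ?thesis using v0(4) by (simp add: a_def)
  qed
  then have "(a, l) \<otimes>\<^bsub>G\<^esub> x = \<psi> x \<otimes>\<^bsub>G\<^esub> (a, l)" using x l by (simp add: \<psi>_apply)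
  then show "\<exists>y\<in>carrier G. y \<otimes>\<^bsub>G\<^esub> x = \<psi> x \<otimes>\<^bsub>G\<^esub> y" using a l by (intro bexI[of _ "(a, l)"]) auto
qed

text \<open>On \<open>D\<close>, the element \<open>z\<close> acts by some \<open>x \<mapsto> \<zeta>\<^sup>i\<omega>\<^sup>j x\<^bsup>q^j\<^esup>\<close>, which would be multiplication by \<open>\<omega>\<^sup>-\<^sup>1\<close>. So
  this power of Frobenius is trivial, giving \<open>t dvd j\<close>, and \<open>\<zeta>\<^sup>i\<omega>\<^sup>j\<^sup>+\<^sup>1 = 1\<close>, whose \<open>s\<close>-th power gives
  \<open>t dvd j + 1\<close>.\<close>

lemma \<psi>_not_conjugation:
  assumes z: "z \<in> carrier G"
    and conj: "\<And>v. v \<in> F \<Longrightarrow> z \<otimes>\<^bsub>G\<^esub> (\<omega> \<otimes> v, \<one>\<^bsub>E\<^esub>) = (v, \<one>\<^bsub>E\<^esub>) \<otimes>\<^bsub>G\<^esub> z"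
  shows False
proof -
  obtain a k where zk: "z = (a, k)" "a \<in> F" "k \<in> carrier E" using z by auto
  obtain i j where k: "\<And>v. v \<in> F \<Longrightarrow> \<rho> k v = \<zeta> [^] (i::nat) \<otimes> \<omega> [^] (j::nat) \<otimes> v [^] (q ^ j)"
    using E_cases[OF zk(3)] by metis
  have fixed: "\<rho> k (\<omega> \<otimes> v) = v" if v: "v \<in> F" for v
  proof -
    have "a \<oplus> \<rho> k (\<omega> \<otimes> v) = a \<oplus> v" using conj[OF v] zk v by (simp add: \<rho>_one a_comm)
    then show ?thesis using zk v add.l_cancel[of a "\<rho> k (\<omega> \<otimes> v)" v] by simp
  qed
  have coeff: "\<zeta> [^] i \<otimes> \<omega> [^] Suc j = \<one>"
    using fixed[of \<one>] k[of \<omega>] by (simp add: m_assoc)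
  have "v [^] (q ^ j) = v" if v: "v \<in> F" for v
  proof -
    have "v = (\<zeta> [^] i \<otimes> \<omega> [^] Suc j) \<otimes> v [^] (q ^ j)"
      using fixed[OF v] k[of "\<omega> \<otimes> v"] v by (simp add: frob_mult m_assoc)
    then show ?thesis using coeff v by simp
  qed
  then have tj: "t dvd j" by (rule frob_trivial_imp_dvd)
  have "(\<zeta> [^] i \<otimes> \<omega> [^] m) [^] s = \<zeta> [^] (i * s) \<otimes> \<omega> [^] (m * s)" for m :: nat
    by (simp add: nat_pow_distrib nat_pow_pow)
  from this[of "Suc j"] have "(\<zeta> [^] i \<otimes> \<omega> [^] Suc j) [^] s = \<zeta> [^] (i * s) \<otimes> \<omega> [^] (Suc j * s)" .
  moreover have "\<zeta> [^] (i * s) = \<one>" by (simp add: \<zeta>(2))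
  ultimately have "\<omega> [^] (Suc j * s) = \<one>" unfolding coeff using \<omega>(1) by (simp del: nat_pow_Suc mult_Suc)
  then have "t\<^sup>2 dvd Suc j * s" using \<omega>(2) by blast
  then have "t dvd Suc j * s" by (metis dvd_mult_left power2_eq_square)
  then have "t dvd Suc j" using s(3) by (metis coprime_commute coprime_dvd_mult_left_iff)
  then have "t dvd 1" using tj by (metis Suc_eq_plus1 dvd_add_right_iff)
  then show False using t(1) by simp
qed

text \<open>The copy of \<open>D\<close> in \<open>G\<close>.\<close>

definition N :: "('l \<times> (('l \<Rightarrow> 'l) \<times> ('l \<Rightarrow> 'l))) set"
  where "N = F \<times> {\<one>\<^bsub>E\<^esub>}"

lemma N_normal: "N \<lhd> G"
proof -
  have inv: "inv\<^bsub>G\<^esub> (v, \<one>\<^bsub>E\<^esub>) = (\<ominus> v, \<one>\<^bsub>E\<^esub>)" if "v \<in> F" for v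
    using that by (intro G.inv_equality) (simp_all add: \<rho>_one l_neg)
  have "subgroup N G"
    by (rule G.subgroupI) (auto simp: N_def \<rho>_one inv intro: F_closed(1))
  moreover have "x \<otimes>\<^bsub>G\<^esub> d \<otimes>\<^bsub>G\<^esub> inv\<^bsub>G\<^esub> x \<in> N" if x: "x \<in> carrier G" and d: "d \<in> N" for x d
  proof -
    obtain a k v where *: "x = (a, k)" "a \<in> F" "k \<in> carrier E" "d = (v, \<one>\<^bsub>E\<^esub>)" "v \<in> F"
      using x d by (auto simp: N_def)
    have "x \<otimes>\<^bsub>G\<^esub> d = (\<rho> k v, \<one>\<^bsub>E\<^esub>) \<otimes>\<^bsub>G\<^esub> x" using * by (simp add: \<rho>_one a_comm)
    moreover have "(\<rho> k v, \<one>\<^bsub>E\<^esub>) \<in> carrier G" using * by simp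
    ultimately have "x \<otimes>\<^bsub>G\<^esub> d \<otimes>\<^bsub>G\<^esub> inv\<^bsub>G\<^esub> x = (\<rho> k v, \<one>\<^bsub>E\<^esub>)" using x by (simp only: G.m_assoc G.r_inv G.r_one G.inv_closed)
    then show ?thesis using * by (simp add: N_def)
  qed
  ultimately show ?thesis by (simp add: G.normal_inv_iff)
qed

lemma N_comm: "\<lbrakk>c \<in> N; d \<in> N\<rbrakk> \<Longrightarrow> c \<otimes>\<^bsub>G\<^esub> d = d \<otimes>\<^bsub>G\<^esub> c"
  by (auto simp: N_def \<rho>_one a_comm)

lemma N_exponent:
  assumes "d \<in> N" shows "d [^]\<^bsub>G\<^esub> p = \<one>\<^bsub>G\<^esub>"
proof -
  obtain v where v: "d = (v, \<one>\<^bsub>E\<^esub>)" "v \<in> F" using assms by (auto simp: N_def)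
  have "(v, \<one>\<^bsub>E\<^esub>) [^]\<^bsub>G\<^esub> k = ([k] \<cdot>\<^bsub>L\<^esub> v, \<one>\<^bsub>E\<^esub>)" for k :: nat
    by (induction k) (use v in \<open>simp_all add: \<rho>_one\<close>)
  then show ?thesis using v char by simp
qed

lemma N_self_centralizing:
  assumes x: "x \<in> carrier G" and "\<And>d. d \<in> N \<Longrightarrow> x \<otimes>\<^bsub>G\<^esub> d = d \<otimes>\<^bsub>G\<^esub> x"
  shows "x \<in> N"
proof -
  obtain a k where xk: "x = (a, k)" "a \<in> F" "k \<in> carrier E" using x by auto
  have "\<rho> k v = \<rho> \<one>\<^bsub>E\<^esub> v" if v: "v \<in> F" for v
  proof -
    have "a \<oplus> \<rho> k v = a \<oplus> v" using assms(2)[of "(v, \<one>\<^bsub>E\<^esub>)"] xk v by (simp add: N_def \<rho>_one a_comm)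
    then have "\<rho> k v = v" using xk v add.l_cancel[of a "\<rho> k v" v] by simp
    then show ?thesis using v by (simp add: \<rho>_one)
  qed
  then have "\<rho> k = \<rho> \<one>\<^bsub>E\<^esub>" using xk by (intro A_eqI hom_in_carrier[OF \<rho>_hom]) simp_all
  then have "k = \<one>\<^bsub>E\<^esub>" using \<rho>_inj xk by (auto simp: inj_on_def)
  then show ?thesis using xk by (simp add: N_def)
qed

end

section \<open>The modular system and the parameters\<close>

lemma (in ideal) char_quotient_multiple:
  "[(ring_char (R Quot I))] \<cdot>\<^bsub>R\<^esub> \<one> \<in> I"
proof -
  define m where "m = ring_char (R Quot I)"
  interpret q: ring "R Quot I" by (rule quotient_is_ring)
  have hom: "(+>) I \<in> ring_hom R (R Quot I)" by (rule rcos_ring_hom)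
  have "I +> ([k] \<cdot>\<^bsub>R\<^esub> \<one>) = [k] \<cdot>\<^bsub>R Quot I\<^esub> \<one>\<^bsub>R Quot I\<^esub>" for k :: nat
  proof (induction k)
    case 0
    then show ?case using ring_hom_zero[OF hom ring_axioms q.ring_axioms] by simp
  next
    case (Suc k)
    then show ?case using ring_hom_add[OF hom, of "[k] \<cdot>\<^bsub>R\<^esub> \<one>" \<one>] ring_hom_one[OF hom] by simp
  qed
  then have "I +> ([m] \<cdot>\<^bsub>R\<^esub> \<one>) = \<zero>\<^bsub>R Quot I\<^esub>"
    using q.add.pow_eq_id[of "\<one>\<^bsub>R Quot I\<^esub>" m] by (simp add: m_def ring_char_def)
  then show ?thesis
    using rcos_const_imp_mem[of "[m] \<cdot>\<^bsub>R\<^esub> \<one>"] by (simp add: FactRing_def m_def)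
qed

text \<open>The valuation ring is local, so its Jacobson radical is its maximal ideal; that this contains \<open>p\<close> is
  what the characteristic of the residue field says.\<close>

lemma p_modular_systemD:
  assumes "p_modular_system p K S"
  defines "R \<equiv> K\<lparr>carrier := S\<rparr>"
  shows "Factorial_Ring.prime p" "field K" "subring S K" "principal_domain R"
    "ideal (jacobson_radical R) R" "\<one>\<^bsub>R\<^esub> \<notin> jacobson_radical R"
    "[p] \<cdot>\<^bsub>R\<^esub> \<one>\<^bsub>R\<^esub> \<in> jacobson_radical R"
proof -
  note sys = assms(1)[unfolded p_modular_system_def Let_def, folded R_def]
  show "Factorial_Ring.prime p" "field K" "subring S K" using sys by auto
  have dvr: "principal_domain R" "\<exists>!M. maximalideal M R"
    using sys by (auto simp: complete_dvr_def)
  show "principal_domain R" by (rule dvr(1))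
  obtain M where M: "maximalideal M R" "\<And>M'. maximalideal M' R \<Longrightarrow> M' = M" using dvr(2) by auto
  interpret M: maximalideal M R by (rule M(1))
  have J: "jacobson_radical R = M"
  proof
    show "jacobson_radical R \<subseteq> M" using M(1) by (simp add: jacobson_radical_def subset_iff)
    show "M \<subseteq> jacobson_radical R" using M(2) M.Icarr by (auto simp: jacobson_radical_def)
  qed
  show ideal: "ideal (jacobson_radical R) R" unfolding J by (rule M.is_ideal)
  show "\<one>\<^bsub>R\<^esub> \<notin> jacobson_radical R" unfolding J using M.one_imp_carrier M.I_notcarr by metis
  have "ring_char (R Quot jacobson_radical R) = p" using sys by simp
  then show "[p] \<cdot>\<^bsub>R\<^esub> \<one>\<^bsub>R\<^esub> \<in> jacobson_radical R"
    using ideal.char_quotient_multiple[OF ideal] by simp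
qed

lemma (in field) primitive_root_pow:
  assumes "x \<in> carrier (units_of R)" "group.ord (units_of R) x = i"
  shows "x \<in> carrier R" "x [^] (k::nat) = \<one> \<longleftrightarrow> i dvd k"
proof -
  interpret U: group "units_of R" by (rule units_group)
  have x: "x \<in> Units R" using assms(1) by (simp add: units_of_carrier)
  then show "x \<in> carrier R" by (rule Units_closed)
  show "x [^] k = \<one> \<longleftrightarrow> i dvd k"
    using U.pow_eq_id[OF assms(1), of k] x assms(2) by (simp add: units_of_pow units_of_one)
qed

text \<open>The product \<open>st\<close> is \<open>1 + q + \<dots> + q\<^sup>t\<^sup>-\<^sup>1\<close> with \<open>q = p\<^sup>n\<close>. This is \<open>t\<close> modulo \<open>t\<^sup>2\<close>, whence
  \<open>s\<close> is \<open>1\<close> modulo \<open>t\<close>, and it is \<open>1\<close> modulo \<open>p\<close>.\<close>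

lemma cyclotomic_quotient:
  fixes p n t :: nat
  assumes "Factorial_Ring.prime p" "0 < n" "1 < t" "coprime t p" "t\<^sup>2 dvd p ^ n - 1"
  defines "s \<equiv> (p ^ (n * t) - 1) div (t * (p ^ n - 1))"
  shows "s * t * (p ^ n - 1) = (p ^ n) ^ t - 1" "coprime s p" "coprime s t"
proof -
  define q where "q = p ^ n"
  have q: "1 < q" using one_less_power[OF prime_gt_1_nat[OF assms(1)] assms(2)] by (simp add: q_def)
  obtain k where k: "(\<Sum>i<t. q ^ i) = t * (1 + t * k)"
    using geometric_sum_mod_square[OF assms(5)[folded q_def]] q by auto
  have prod: "q ^ t - 1 = (1 + t * k) * (t * (q - 1))"
    using geometric_sum_nat[of q t] q unfolding k by (simp only: mult_ac)
  have s: "s = 1 + t * k"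
    unfolding s_def power_mult q_def[symmetric] prod using q assms(3) by simp
  show "s * t * (p ^ n - 1) = (p ^ n) ^ t - 1"
    unfolding q_def[symmetric] prod s by (simp only: mult.assoc)
  have coprime: "coprime (1 + a * c) a" for a c :: nat
    by (metis add.commute coprime_iff_gcd_eq_1 gcd.commute gcd_add_mult gcd_1_nat mult.commute)
  have "coprime (1 + t * k) t" by (rule coprime)
  then show "coprime s t" by (simp only: s)
  have "(\<Sum>i<Suc m. q ^ i) = 1 + p * (p ^ (n - 1) * (\<Sum>i<m. q ^ i))" for m
  proof -
    have "q = p * p ^ (n - 1)" using assms(2) by (cases n) (simp_all add: q_def)
    then show ?thesis by (simp only: sum.lessThan_Suc_shift sum_distrib_left power_Suc power_0 mult.assoc)
  qed
  from this[of "t - 1"] have "t * s = 1 + p * (p ^ (n - 1) * (\<Sum>i<t - 1. q ^ i))"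
    using k s assms(3) by simp
  then have "coprime (t * s) p" by (simp only: coprime)
  then show "coprime s p" by simp
qed

theorem proposition4p2:
  fixes K :: "'k ring" and \<O> :: "'k set"
    and L :: "'l ring" and Fp F :: "'l set" and \<omega> :: "nat \<Rightarrow> 'l"
    and p t n s :: nat
    and D :: "'l monoid" and A :: "('l \<Rightarrow> 'l) monoid"
    and \<mu> :: "'l \<Rightarrow> 'l \<Rightarrow> 'l" and \<Phi> g h :: "'l \<Rightarrow> 'l"
    and E :: "(('l \<Rightarrow> 'l) \<times> ('l \<Rightarrow> 'l)) monoid"
    and G :: "('l \<times> (('l \<Rightarrow> 'l) \<times> ('l \<Rightarrow> 'l))) monoid"
  assumes modular: "p_modular_system p K \<O>"
    and large: "contains_roots_of_unity K (order G)"
    and t: "t > 1" "coprime t p"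
    and closure: "algebraic_closure L Fp" "card Fp = p"
    and \<omega>: "\<And>i. coprime i p \<Longrightarrow>
      \<omega> i \<in> carrier (units_of L) \<and> group.ord (units_of L) (\<omega> i) = i"
    and n: "n = (LEAST m. 0 < m \<and>
      (\<exists>F'. subfield F' L \<and> card F' = p ^ m \<and> \<omega> (t\<^sup>2) \<in> F'))"
    and s: "s = (p ^ (n * t) - 1) div (t * (p ^ n - 1))"
    and F: "subfield F L" "card F = p ^ (n * t)"
    and D: "D = add_monoid (L\<lparr>carrier := F\<rparr>)"
    and A: "A = AutoGroup D"
    and \<mu>: "\<And>c. \<mu> c = (\<lambda>x \<in> F. c \<otimes>\<^bsub>L\<^esub> x)"
    and \<Phi>: "\<Phi> = (\<lambda>x \<in> F. x [^]\<^bsub>L\<^esub> (p ^ n))"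
    and g: "g = \<mu> (\<omega> s)"
    and h: "h = \<Phi> \<otimes>\<^bsub>A\<^esub> \<mu> (\<omega> (t\<^sup>2))"
    and E: "E = semidirect (subgroup_generated A {g}) (subgroup_generated A {h})
      (\<lambda>y x. y \<otimes>\<^bsub>A\<^esub> x \<otimes>\<^bsub>A\<^esub> inv\<^bsub>A\<^esub> y)"
    and G: "G = semidirect D E (\<lambda>(x, y). x \<otimes>\<^bsub>A\<^esub> y)"
  shows
    "t * (p ^ n - 1) dvd p ^ (n * t) - 1 \<and> coprime s p \<and> coprime s t \<and>
     g \<in> carrier A \<and> group.ord A g = s \<and>
     h \<in> carrier A \<and> group.ord A h = t\<^sup>2 \<and>
     h \<otimes>\<^bsub>A\<^esub> g \<otimes>\<^bsub>A\<^esub> inv\<^bsub>A\<^esub> h = g [^]\<^bsub>A\<^esub> (p ^ n) \<and>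
     faithful_action E (carrier D) (\<lambda>(x, y). x \<otimes>\<^bsub>A\<^esub> y) \<and>
     block_idempotent (group_algebra (K\<lparr>carrier := \<O>\<rparr>) G)
       \<one>\<^bsub>group_algebra (K\<lparr>carrier := \<O>\<rparr>) G\<^esub> \<and>
     carrier (Out_c G) \<noteq> {\<one>\<^bsub>Out_c G\<^esub>} \<and>
     Out_c_to_Picent K \<O> G ` carrier (Out_c G) \<subseteq> carrier (Picent_group_algebra K \<O> G) \<and>
     Out_c_to_Picent K \<O> G ` carrier (Out_c G) \<noteq> {\<one>\<^bsub>Picent_group_algebra K \<O> G\<^esub>}"
proof -
  note sys = p_modular_systemD[OF modular]
  note prime = sys(1)
  interpret closure: algebraic_closure L Fp by (rule closure(1))
  have Fp: "subfield Fp L" by (rule closure.subfield_axioms)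
  have "finite Fp" using closure(2) prime_gt_0_nat[OF prime] by (intro card_ge_0_finite) simp
  have coprime: "coprime (t\<^sup>2) p" using t(2) by simp
  note root = closure.primitive_root_pow[OF conjunct1[OF \<omega>] conjunct2[OF \<omega>]]
  obtain F0 m where "subfield F0 L" "\<omega> (t\<^sup>2) \<in> F0" "card F0 = card Fp ^ m" "0 < m"
    using closure.in_finite_subfield[OF \<open>finite Fp\<close> root(1)[OF coprime coprime]] .
  then have "\<exists>m. 0 < m \<and> (\<exists>F'. subfield F' L \<and> card F' = p ^ m \<and> \<omega> (t\<^sup>2) \<in> F')"
    using closure(2) by auto
  from LeastI_ex[OF this] obtain F' where n_pos: "0 < n" and F': "subfield F' L" "card F' = p ^ n" "\<omega> (t\<^sup>2) \<in> F'"
    unfolding n[symmetric] by blast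
  have "finite F'" using F'(2) prime_gt_0_nat[OF prime] by (intro card_ge_0_finite) simp
  have "\<omega> (t\<^sup>2) \<noteq> \<zero>\<^bsub>L\<^esub>"
    using root(2)[OF coprime coprime, of "t\<^sup>2"] t(1) by (auto simp: closure.nat_pow_zero)
  then have "\<omega> (t\<^sup>2) [^]\<^bsub>L\<^esub> (p ^ n - 1) = \<one>\<^bsub>L\<^esub>"
    using closure.subfield_pow_eq_one[OF F'(1) \<open>finite F'\<close> F'(3)] F'(2) by simp
  then have t_dvd: "t\<^sup>2 dvd p ^ n - 1" using root(2)[OF coprime coprime] by simp
  note s_props = cyclotomic_quotient[OF prime n_pos t t_dvd, folded s]
  interpret ex: semilinear_group L F p t "p ^ n" s "\<omega> (t\<^sup>2)" "\<omega> s" D A \<mu> \<Phi> g h E G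
    using prime closure.subfield_card_multiple[OF Fp] closure(2) F n_pos t t_dvd s_props
      root[OF coprime coprime] root[OF s_props(2) s_props(2)] D A \<mu> \<Phi> g h E G
    by (intro semilinear_group.intro semilinear_group_axioms.intro closure.field_axioms)
      (auto simp: power_mult)
  interpret K: field K by (rule sys(2))
  interpret OG: scalar_extension K G \<O>
    by (intro scalar_extension.intro scalar_extension_axioms.intro finite_group_algebra.intro
        finite_group_algebra_axioms.intro K.cring_axioms ex.group_G ex.finite_G sys(3))
  let ?R = "K\<lparr>carrier := \<O>\<rparr>"
  let ?J = "jacobson_radical ?R"
  interpret P: p_group_algebra ?R G ex.N p ?J
    by (intro p_group_algebra.intro OG.O.finite_group_algebra_axioms p_group_algebra_axioms.intro
        prime ex.N_normal ex.N_comm ex.N_exponent sys(5-7))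
  have not_inner: False
    if y: "y \<in> carrier G" and u: "u \<in> carrier OG.OG" and v: "v \<in> carrier OG.OG"
      and uv: "u \<otimes>\<^bsub>OG.OG\<^esub> v = \<one>\<^bsub>OG.OG\<^esub>"
      and eq: "\<And>x. x \<in> carrier G \<Longrightarrow> ga_single K G \<one>\<^bsub>K\<^esub> x \<otimes>\<^bsub>OG.OG\<^esub> u =
        u \<otimes>\<^bsub>OG.OG\<^esub> ga_single K G \<one>\<^bsub>K\<^esub> (y \<otimes>\<^bsub>G\<^esub> ex.\<psi> x \<otimes>\<^bsub>G\<^esub> inv\<^bsub>G\<^esub> y)" for y u v
  proof -
    have "OG.O.augmentation u \<otimes>\<^bsub>?R\<^esub> OG.O.augmentation v = \<one>\<^bsub>?R\<^esub>"
      using OG.O.augmentation_mult[OF u v] OG.O.augmentation_one uv by simp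
    then have aug: "OG.O.augmentation u \<notin> ?J"
      using P.J.I_r_closed[of "OG.O.augmentation u" "OG.O.augmentation v"] OG.O.augmentation_closed[OF v] sys(6) by auto
    have \<psi>_N: "ex.\<psi> d \<in> ex.N" if "d \<in> ex.N" for d
      using that by (auto simp: ex.N_def ex.\<psi>_apply)
    have N_G: "d \<in> carrier G" if "d \<in> ex.N" for d using that P.D.subset by blast
    obtain x where x: "x \<in> carrier G"
      "\<And>d. d \<in> ex.N \<Longrightarrow> y \<otimes>\<^bsub>G\<^esub> ex.\<psi> d \<otimes>\<^bsub>G\<^esub> inv\<^bsub>G\<^esub> y = inv\<^bsub>G\<^esub> x \<otimes>\<^bsub>G\<^esub> d \<otimes>\<^bsub>G\<^esub> x"
      using P.intertwiner_imp_conjugation[OF u aug, of "\<lambda>d. y \<otimes>\<^bsub>G\<^esub> ex.\<psi> d \<otimes>\<^bsub>G\<^esub> inv\<^bsub>G\<^esub> y"]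
        P.conj_in_D(1)[OF y \<psi>_N] eq N_G by auto
    \<comment> \<open>By the intertwining relation, conjugation by \<open>xy\<close> inverts \<open>\<psi>\<close> on \<open>D\<close>.\<close>
    show False
    proof (rule ex.\<psi>_not_conjugation[of "x \<otimes>\<^bsub>G\<^esub> y"])
      show "x \<otimes>\<^bsub>G\<^esub> y \<in> carrier G" using x(1) y by (rule ex.G.m_closed)
      fix v assume v: "v \<in> F"
      define d where "d = (v, \<one>\<^bsub>E\<^esub>)"
      have d: "d \<in> ex.N" "ex.\<psi> d = (\<omega> (t\<^sup>2) \<otimes>\<^bsub>L\<^esub> v, \<one>\<^bsub>E\<^esub>)"
        using v by (auto simp: d_def ex.N_def ex.\<psi>_apply)
      note cl = x(1) y N_G[OF d(1)] N_G[OF \<psi>_N[OF d(1)]]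
      have "x \<otimes>\<^bsub>G\<^esub> y \<otimes>\<^bsub>G\<^esub> ex.\<psi> d = x \<otimes>\<^bsub>G\<^esub> (y \<otimes>\<^bsub>G\<^esub> ex.\<psi> d \<otimes>\<^bsub>G\<^esub> inv\<^bsub>G\<^esub> y) \<otimes>\<^bsub>G\<^esub> y"
        using cl by (simp only: ex.G.m_assoc ex.G.m_closed ex.G.inv_closed ex.G.l_inv ex.G.r_one)
      also have "\<dots> = d \<otimes>\<^bsub>G\<^esub> (x \<otimes>\<^bsub>G\<^esub> y)"
        unfolding x(2)[OF d(1)] using cl
        by (simp only: ex.G.m_assoc[symmetric] ex.G.m_closed ex.G.inv_closed ex.G.r_inv ex.G.l_one)
      finally show "x \<otimes>\<^bsub>G\<^esub> y \<otimes>\<^bsub>G\<^esub> (\<omega> (t\<^sup>2) \<otimes>\<^bsub>L\<^esub> v, \<one>\<^bsub>E\<^esub>) = (v, \<one>\<^bsub>E\<^esub>) \<otimes>\<^bsub>G\<^esub> (x \<otimes>\<^bsub>G\<^esub> y)"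
        unfolding d(2) unfolding d_def .
    qed
  qed
  have dvd: "t * (p ^ n - 1) dvd p ^ (n * t) - 1"
    using s_props(1) by (metis dvd_triv_right mult.assoc power_mult)
  have block: "block_idempotent OG.OG \<one>\<^bsub>OG.OG\<^esub>"
    by (rule P.block_idempotent_one[OF sys(4)]) (rule ex.N_self_centralizing)
  have nontrivial: "Out_c_to_Picent K \<O> G ` carrier (Out_c G) \<noteq> {\<one>\<^bsub>Picent_group_algebra K \<O> G\<^esub>}"
    by (rule OG.Out_c_to_Picent_nontrivial(1)[OF ex.\<psi>_class_preserving], erule (3) not_inner) simp
  have outer: "carrier (Out_c G) \<noteq> {\<one>\<^bsub>Out_c G\<^esub>}"
    by (rule OG.Out_c_to_Picent_nontrivial(2)[OF ex.\<psi>_class_preserving], erule (3) not_inner) simp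
  show ?thesis
    by (intro conjI dvd s_props(2,3) ex.g_closed ex.ord_g ex.h_closed ex.ord_h ex.conj_g
        ex.faithful_E[unfolded ex.\<rho>_def] block OG.Out_c_to_Picent_closed outer nontrivial)
qed

end
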